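(* Let $f,g\in C^2(0,\infty)$ with $f>0$, and write $r=g/f$. Let $\overline h>0$ and $X>0$. Consider the constant steady state $h_{\rm ss}\equiv\overline h$ of $h_t=-(f(h)h_{xxx})_x-(g(h)h_x)_x$. Then $\tau_1(\overline h)=(2\pi/X)^2-r(\overline h)$, and the $\tau_1(\overline h)$-eigenspace is spanned by $\sin(2\pi x/X)$ and $\cos(2\pi x/X)$. Thus with respect to zero-mean perturbations at period $X$, the constant steady state is: linearly unstable if $r(\overline h)X^2>4\pi^2$; linearly neutrally stable if $r(\overline h)X^2=4\pi^2$; linearly asymptotically stable if $r(\overline h)X^2<4\pi^2$. (a) If $r(\overline h)X^2>4\pi^2$, or if $r(\overline h)X^2=4\pi^2$ and $r''(\overline h)>0$, then the constant steady state is energy unstable in the directions $\pm\sin(2\pi x/X)$ and $\pm\cos(2\pi x/X)$. (b) If $r(\overline h)X^2<4\pi^2$, or if $r(\overline h)X^2=4\pi^2$ and $r''(\overline h)<0$, then the constant steady state is energy stable with respect to zero-mean perturbations of period $X$. In fact, if $r(\overline h)X^2<4\pi^2$ then the constant steady state is a strict local minimum of the energy with respect to zero-mean perturbations in $H^1(\mathbb T_X)$, and $\overline h$ is nonlinearly stable under the evolution in the following sense: there is a constant $C(\overline h)\ge1$ such that for all sufficiently small $\delta>0$, if $T>0$ and $h(x,t)$ is a smooth positive solution of $h_t=-(f(h)h_{xxx})_x-(g(h)h_x)_x$ for $x\in\mathbb T_X$, $t\in[0,T]$, such that $h(\cdot,0)$ has mean value $\overline h$ and $\|h(\cdot,0)-\overline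 h\|_{H^1(\mathbb T_X)}<\sqrt{\delta^3/(4C(\overline h))}$, then $\|h(\cdot,t)-\overline h\|_{H^1(\mathbb T_X)}<\delta/2$ for all $t\in[0,T]$.
   Context: $\mathbb T_X$ is the circle of circumference $X$; functions on it are identified with $X$-periodic functions on $\mathbb R$. For a positive $X$-periodic steady state $h_{\rm ss}$, $$\tau_1(h_{\rm ss})=\min_u\frac{\int_0^X[(u')^2-r(h_{\rm ss})u^2]\,dx}{\int_0^Xu^2\,dx},$$ the minimum over nonzero $u\in H^1(\mathbb T_X)$ with $\int_0^Xu\,dx=0$. The $\tau_1$-eigenspace consists of the minimizers together with $0$. With respect to zero-mean perturbations at period $X$, $h_{\rm ss}$ is linearly unstable if $\tau_1<0$, linearly neutrally stable if $\tau_1=0$, linearly asymptotically stable if $\tau_1>0$. Energy: for positive $\ell\in H^1(\mathbb T_X)$, $\mathcal E(\ell)=\int_0^X[\frac12(\ell')^2-H(\ell)]dx$, where $H$ is a fixed function on $(0,\infty)$ with $H''=r$. $h_{\rm ss}$ is energy unstable in the direction $u$ (mean-zero, $X$-periodic) if $\mathcal E(h_{\rm ss}+\varepsilon u)<\mathcal E(h_{\rm ss})$ for all sufficiently small $\varepsilon>0$. It is energy stable with respect to zero-mean perturbations of period $X$ if for each $u\in H^1(\mathbb T_X)\setminus\{0\}$ with $\int_0^Xu\,dx=0$, $\mathcal E(h_{\rm ss}+\varepsilon u)>\mathcal E(h_{\rm ss})$ for all sufficiently small $\varepsilon>0$ (how small may depend on $u$). It is a strict local minimum of the energy with respect to zero-mean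 perturbations in $H^1(\mathbb T_X)$ if there is $\delta>0$ such that $\mathcal E(h_{\rm ss}+u)>\mathcal E(h_{\rm ss})$ for all mean-zero $u\in H^1(\mathbb T_X)$ with $0<\|u\|_{H^1(\mathbb T_X)}\le\delta$. *)

theory Defs
  imports "HOL-Analysis.Analysis"
begin

definition C2_on :: "real set \<Rightarrow> (real \<Rightarrow> real) \<Rightarrow> bool" where
  "C2_on S f \<longleftrightarrow>
     (\<exists>f' f''. (\<forall>x\<in>S. (f has_real_derivative f' x) (at x)) \<and>
              (\<forall>x\<in>S. (f' has_real_derivative f'' x) (at x)) \<and>
              continuous_on S f'')"

subsection \<open>The Sobolev space on the circle of circumference X\<close>

text \<open>
  A function on the circle is an X-periodic function on the real line, and an element of
  H1 is represented by its continuous representative: an X-periodic, absolutely continuous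
  function with square integrable derivative. The derivative is determined only almost
  everywhere. On the bounded interval square integrability implies integrability, so the
  integral of \<open>v\<close> below is meaningful.
\<close>

definition has_L2_derivative :: "real \<Rightarrow> (real \<Rightarrow> real) \<Rightarrow> (real \<Rightarrow> real) \<Rightarrow> bool" where
  "has_L2_derivative X u v \<longleftrightarrow>
     v \<in> borel_measurable borel \<and>
     set_integrable lborel {0..X} (\<lambda>x. (v x)\<^sup>2) \<and>
     (\<forall>x\<in>{0..X}. u x = u 0 + (LBINT y:{0..x}. v y))"

definition H1 :: "real \<Rightarrow> (real \<Rightarrow> real) set" where
  "H1 X = {u. (\<forall>x. u (x + X) = u x) \<and> (\<exists>v. has_L2_derivative X u v)}"

text \<open>Some version of the derivative; it is only used inside integrals over one period.\<close>

definition H1_deriv :: "real \<Rightarrow> (real \<Rightarrow> real) \<Rightarrow> real \<Rightarrow> real" where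
  "H1_deriv X u = (SOME v. has_L2_derivative X u v)"

definition H1_norm :: "real \<Rightarrow> (real \<Rightarrow> real) \<Rightarrow> real" where
  "H1_norm X u = sqrt ((LBINT x:{0..X}. (u x)\<^sup>2) + (LBINT x:{0..X}. (H1_deriv X u x)\<^sup>2))"

definition H1_zero_mean :: "real \<Rightarrow> (real \<Rightarrow> real) set" where
  "H1_zero_mean X = {u \<in> H1 X. (LBINT x:{0..X}. u x) = 0}"

subsection \<open>Linear stability\<close>

definition rayleigh ::
  "(real \<Rightarrow> real) \<Rightarrow> real \<Rightarrow> (real \<Rightarrow> real) \<Rightarrow> (real \<Rightarrow> real) \<Rightarrow> real" where
  "rayleigh r X hss u =
     (LBINT x:{0..X}. (H1_deriv X u x)\<^sup>2 - r (hss x) * (u x)\<^sup>2) / (LBINT x:{0..X}. (u x)\<^sup>2)"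

text \<open>
  \<open>LEAST\<close> denotes a minimum that is attained; that it is attained is part of the assertion
  that \<open>tau1_eigenspace\<close> contains a nonzero function.
\<close>

definition tau1 :: "(real \<Rightarrow> real) \<Rightarrow> real \<Rightarrow> (real \<Rightarrow> real) \<Rightarrow> real" where
  "tau1 r X hss = (LEAST \<tau>. \<tau> \<in> rayleigh r X hss ` (H1_zero_mean X - {\<lambda>x. 0}))"

definition tau1_eigenspace :: "(real \<Rightarrow> real) \<Rightarrow> real \<Rightarrow> (real \<Rightarrow> real) \<Rightarrow> (real \<Rightarrow> real) set" where
  "tau1_eigenspace r X hss =
     insert (\<lambda>x. 0) {u. is_arg_min (rayleigh r X hss) (\<lambda>u. u \<in> H1_zero_mean X - {\<lambda>x. 0}) u}"

definition linearly_unstable :: "(real \<Rightarrow> real) \<Rightarrow> real \<Rightarrow> (real \<Rightarrow> real) \<Rightarrow> bool" where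
  "linearly_unstable r X hss \<longleftrightarrow> tau1 r X hss < 0"

definition linearly_neutrally_stable :: "(real \<Rightarrow> real) \<Rightarrow> real \<Rightarrow> (real \<Rightarrow> real) \<Rightarrow> bool" where
  "linearly_neutrally_stable r X hss \<longleftrightarrow> tau1 r X hss = 0"

definition linearly_asymptotically_stable ::
  "(real \<Rightarrow> real) \<Rightarrow> real \<Rightarrow> (real \<Rightarrow> real) \<Rightarrow> bool" where
  "linearly_asymptotically_stable r X hss \<longleftrightarrow> tau1 r X hss > 0"

subsection \<open>Energy\<close>

text \<open>
  The energy is meaningful only for positive functions in H1, because \<open>H\<close> is a function on
  the positive half line. The comparisons below therefore include positivity of the perturbed
  function, which holds for all sufficiently small perturbations.
\<close>

definition energy :: "(real \<Rightarrow> real) \<Rightarrow> real \<Rightarrow> (real \<Rightarrow> real) \<Rightarrow> real" where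
  "energy H X l = (LBINT x:{0..X}. 1/2 * (H1_deriv X l x)\<^sup>2 - H (l x))"

definition energy_unstable_in_direction ::
  "(real \<Rightarrow> real) \<Rightarrow> real \<Rightarrow> (real \<Rightarrow> real) \<Rightarrow> (real \<Rightarrow> real) \<Rightarrow> bool" where
  "energy_unstable_in_direction H X hss u \<longleftrightarrow>
     u \<in> H1_zero_mean X \<and>
     (\<forall>\<^sub>F \<epsilon> in at_right 0. (\<forall>x. hss x + \<epsilon> * u x > 0) \<and>
        energy H X (\<lambda>x. hss x + \<epsilon> * u x) < energy H X hss)"

definition energy_stable :: "(real \<Rightarrow> real) \<Rightarrow> real \<Rightarrow> (real \<Rightarrow> real) \<Rightarrow> bool" where
  "energy_stable H X hss \<longleftrightarrow>
     (\<forall>u \<in> H1_zero_mean X - {\<lambda>x. 0}.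
        \<forall>\<^sub>F \<epsilon> in at_right 0. (\<forall>x. hss x + \<epsilon> * u x > 0) \<and>
          energy H X (\<lambda>x. hss x + \<epsilon> * u x) > energy H X hss)"

definition strict_local_energy_min :: "(real \<Rightarrow> real) \<Rightarrow> real \<Rightarrow> (real \<Rightarrow> real) \<Rightarrow> bool" where
  "strict_local_energy_min H X hss \<longleftrightarrow>
     (\<exists>\<delta>>0. \<forall>u \<in> H1_zero_mean X. 0 < H1_norm X u \<and> H1_norm X u \<le> \<delta> \<longrightarrow>
        (\<forall>x. hss x + u x > 0) \<and> energy H X (\<lambda>x. hss x + u x) > energy H X hss)"

subsection \<open>The evolution equation\<close>

text \<open>
  Smoothness up to the boundary of \<open>UNIV \<times> {0..T}\<close>: \<open>D i j\<close> is the partial derivative of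
  order i in x and j in t, the time derivatives being one-sided at 0 and T.
\<close>

definition smooth_on_strip :: "real \<Rightarrow> (real \<Rightarrow> real \<Rightarrow> real) \<Rightarrow> bool" where
  "smooth_on_strip T h \<longleftrightarrow>
     (\<exists>D :: nat \<Rightarrow> nat \<Rightarrow> real \<Rightarrow> real \<Rightarrow> real.
        (\<forall>x. \<forall>t\<in>{0..T}. D 0 0 x t = h x t) \<and>
        (\<forall>i j. continuous_on (UNIV \<times> {0..T}) (\<lambda>(x, t). D i j x t) \<and>
           (\<forall>x. \<forall>t\<in>{0..T}.
              ((\<lambda>y. D i j y t) has_real_derivative D (Suc i) j x t) (at x) \<and>
              ((\<lambda>s. D i j x s) has_real_derivative D i (Suc j) x t) (at t within {0..T}))))"

definition smooth_positive_solution ::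
  "(real \<Rightarrow> real) \<Rightarrow> (real \<Rightarrow> real) \<Rightarrow> real \<Rightarrow> real \<Rightarrow> (real \<Rightarrow> real \<Rightarrow> real) \<Rightarrow> bool" where
  "smooth_positive_solution f g X T h \<longleftrightarrow>
     smooth_on_strip T h \<and>
     (\<forall>x. \<forall>t\<in>{0..T}. h (x + X) t = h x t \<and> h x t > 0 \<and>
        ((\<lambda>s. h x s) has_real_derivative
           - deriv (\<lambda>y. f (h y t) * (deriv ^^ 3) (\<lambda>z. h z t) y) x
           - deriv (\<lambda>y. g (h y t) * deriv (\<lambda>z. h z t) y) x) (at t within {0..T}))"

definition nonlinearly_stable ::
  "(real \<Rightarrow> real) \<Rightarrow> (real \<Rightarrow> real) \<Rightarrow> real \<Rightarrow> real \<Rightarrow> bool" where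
  "nonlinearly_stable f g X hbar \<longleftrightarrow>
     (\<exists>C\<ge>1. \<forall>\<^sub>F \<delta> in at_right 0. \<forall>T>0. \<forall>h.
        smooth_positive_solution f g X T h \<and>
        (LBINT x:{0..X}. h x 0) / X = hbar \<and>
        H1_norm X (\<lambda>x. h x 0 - hbar) < sqrt (\<delta> ^ 3 / (4 * C)) \<longrightarrow>
        (\<forall>t\<in>{0..T}. H1_norm X (\<lambda>x. h x t - hbar) < \<delta> / 2))"

end

theory Submission
  imports Defs
begin

text \<open>
  Everything rests on Wirtinger's inequality with its equality case. A mean-zero periodic \<open>u\<close>
  takes some value \<open>\<alpha>\<close> at two points half a period apart, so \<open>u - \<alpha>\<close> vanishes at the ends of
  two half periods and can be compared with the sine there.

  Expanding the energy about \<open>hbar\<close> along \<open>u\<close> gives \<open>\<epsilon>\<^sup>2/2\<close> times the quadratic form of the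
  Rayleigh quotient. If \<open>r (hbar) \<le> (2 \<pi> / X)\<^sup>2\<close>, this form is nonnegative and vanishes only in
  the case of equality and on the first mode, whose cube integrates to zero; then the term \<open>- \<epsilon>\<^sup>4 r''/24 \<integral> u\<^sup>4\<close> decides.

  Below the critical period the energy excess is comparable to \<open>\<parallel>u\<parallel>\<^sup>2\<close> for small \<open>u\<close>. Since the
  evolution preserves the mean and does not increase the energy, a solution whose norm reached
  \<open>\<delta>/2\<close> for the first time would have too much energy.
\<close>

text \<open>Absolutely continuous functions are therefore treated as primitives of integrable
  functions, and the Sturm comparison rests on a product rule for primitives. Half periods are the
  right length because the lowest Dirichlet frequency on an interval of length \<open>X / 2\<close>
  is exactly the lowest periodic frequency \<open>2 * pi / X\<close>; subtracting \<alpha> loses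
  nothing, since mean zero kills the cross term. Both positivity and the Taylor expansion of
  \<open>H\<close> need perturbations that are small pointwise. A mean-zero function is controlled
  pointwise by its \<open>H1_norm\<close>, which bridges the two notions of smallness. At the
  critical period the quadratic form is positive off the first modes but has no uniform lower bound
  near them. The leading order then depends on the direction, and so does the admissible size of
  \<epsilon>.\<close>

definition primitive_on :: "real \<Rightarrow> real \<Rightarrow> (real \<Rightarrow> real) \<Rightarrow> (real \<Rightarrow> real) \<Rightarrow> bool" where
  "primitive_on a b u v \<longleftrightarrow>
     set_integrable lborel {a..b} v \<and> (\<forall>x\<in>{a..b}. u x = u a + (LBINT y:{a..x}. v y))"

section \<open>Integrals over compact intervals\<close>

lemma LBINT_eq_integral:
  fixes f :: "real \<Rightarrow> real"
  assumes "set_integrable lborel S f"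
  shows "(LBINT x:S. f x) = integral S f"
  using set_borel_integral_eq_integral(2)[OF assms] .

lemma set_integrable_Icc_subset:
  fixes f :: "real \<Rightarrow> real"
  assumes "set_integrable lborel {a..b} f" "a \<le> c" "d \<le> b"
  shows "set_integrable lborel {c..d} f"
  by (rule set_integrable_subset[OF assms(1)]) (use assms in auto)

lemma LBINT_Icc_combine:
  fixes f :: "real \<Rightarrow> real"
  assumes "set_integrable lborel {a..c} f" "a \<le> b" "b \<le> c"
  shows "(LBINT x:{a..c}. f x) = (LBINT x:{a..b}. f x) + (LBINT x:{b..c}. f x)"
  using assms Henstock_Kurzweil_Integration.integral_combine[of a b c f]
    set_borel_integral_eq_integral(1)[OF assms(1)]
  by (simp add: LBINT_eq_integral set_integrable_Icc_subset[OF assms(1)])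

lemma LBINT_Icc_shift:
  fixes f :: "real \<Rightarrow> real"
  shows "(LBINT x:{a + c..b + c}. f x) = (LBINT x:{a..b}. f (x + c))"
  unfolding set_lebesgue_integral_def
  by (subst lborel_integral_real_affine[where c=1 and t=c])
     (auto intro!: Bochner_Integration.integral_cong split: split_indicator simp: add.commute)

lemma set_integrable_Icc_shift:
  fixes f :: "real \<Rightarrow> real"
  shows "set_integrable lborel {a + c..b + c} f \<longleftrightarrow> set_integrable lborel {a..b} (\<lambda>x. f (x + c))"
proof -
  have "integrable lborel (\<lambda>x. indicator {a + c..b + c} x *\<^sub>R f x) \<longleftrightarrow>
      integrable lborel (\<lambda>x. indicator {a + c..b + c} (c + 1 * x) *\<^sub>R f (c + 1 * x))"
    by (rule lborel_integrable_real_affine_iff[symmetric]) auto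
  also have "(\<lambda>x. indicator {a + c..b + c} (c + 1 * x) *\<^sub>R f (c + 1 * x)) =
      (\<lambda>x. indicator {a..b} x *\<^sub>R f (x + c))"
    by (auto simp: fun_eq_iff add.commute split: split_indicator)
  finally show ?thesis unfolding set_integrable_def .
qed

lemma LBINT_const: "a \<le> b \<Longrightarrow> (LBINT x:{a..b}. (k::real)) = k * (b - a)"
  by (simp add: LBINT_eq_integral borel_integrable_atLeastAtMost' mult.commute)

text \<open>Compactness bounds the continuous factor. This is the integrability behind the product
  rule, where one factor is a primitive and the other a merely integrable derivative.\<close>

lemma set_integrable_mult_continuous:
  fixes f g :: "real \<Rightarrow> real"
  assumes "set_integrable lborel {a..b} f" "continuous_on {a..b} g"
  shows "set_integrable lborel {a..b} (\<lambda>x. f x * g x)"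
proof -
  have "bounded (g ` {a..b})"
    by (intro compact_imp_bounded compact_continuous_image assms compact_Icc)
  then obtain B where B: "\<And>x. x \<in> {a..b} \<Longrightarrow> \<bar>g x\<bar> \<le> B"
    by (force simp: bounded_iff)
  have mf: "set_borel_measurable lborel {a..b} f"
    using assms(1) by (simp add: set_borel_measurable_def set_integrable_def borel_measurable_integrable)
  have mg: "set_borel_measurable lborel {a..b} g"
    using borel_integrable_atLeastAtMost'[OF assms(2)]
    by (simp add: set_borel_measurable_def set_integrable_def borel_measurable_integrable)
  have eq: "(\<lambda>x. indicator {a..b} x *\<^sub>R (f x * g x)) =
      (\<lambda>x. (indicator {a..b} x *\<^sub>R f x) * (indicator {a..b} x *\<^sub>R g x))"
    by (auto simp: fun_eq_iff split: split_indicator)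
  show ?thesis
  proof (rule set_integrable_bound)
    show "set_integrable lborel {a..b} (\<lambda>x. B * f x)" using assms(1) by simp
    show "set_borel_measurable lborel {a..b} (\<lambda>x. f x * g x)"
      using mf mg unfolding set_borel_measurable_def eq by simp
    show "AE x in lborel. x \<in> {a..b} \<longrightarrow> norm (f x * g x) \<le> norm (B * f x)"
    proof (intro AE_I2 impI)
      fix x assume "x \<in> {a..b}"
      with B have "\<bar>g x\<bar> \<le> \<bar>B\<bar>" by fastforce
      then show "norm (f x * g x) \<le> norm (B * f x)"
        using mult_left_mono[of "\<bar>g x\<bar>" "\<bar>B\<bar>" "\<bar>f x\<bar>"] by (simp add: abs_mult mult.commute)
    qed
  qed
qed

section \<open>Primitives of integrable functions and their product rule\<close>

lemma primitive_on_integrable: "primitive_on a b u v \<Longrightarrow> set_integrable lborel {a..b} v"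
  by (simp add: primitive_on_def)

lemma primitive_onD:
  assumes "primitive_on a b u v" "a \<le> x" "x \<le> b"
  shows "u x = u a + (LBINT y:{a..x}. v y)"
  using assms unfolding primitive_on_def by (meson atLeastAtMost_iff)

lemma primitive_on_eq:
  assumes "primitive_on a b u v" "a \<le> c" "c \<le> d" "d \<le> b"
  shows "u d = u c + (LBINT x:{c..d}. v x)"
proof -
  have "u d = u a + (LBINT x:{a..d}. v x)" "u c = u a + (LBINT x:{a..c}. v x)"
    by (rule primitive_onD[OF assms(1)]; use assms in simp)+
  then show ?thesis
    using LBINT_Icc_combine[of a d v c] set_integrable_Icc_subset[OF primitive_on_integrable, of a b u v a d]
      assms by simp
qed

lemma primitive_on_subset:
  assumes "primitive_on a b u v" "a \<le> c" "d \<le> b"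
  shows "primitive_on c d u v"
  unfolding primitive_on_def
proof (intro conjI ballI)
  show "set_integrable lborel {c..d} v"
    using set_integrable_Icc_subset[OF primitive_on_integrable] assms by blast
  show "u x = u c + (LBINT y:{c..x}. v y)" if "x \<in> {c..d}" for x
    using that assms by (intro primitive_on_eq[OF assms(1)]) auto
qed

lemma primitive_on_continuous:
  assumes "primitive_on a b u v"
  shows "continuous_on {a..b} u"
proof -
  have "continuous_on {a..b} (\<lambda>x. u a + integral {a..x} v)"
    by (intro continuous_intros indefinite_integral_continuous_1)
       (use assms set_borel_integral_eq_integral(1) in \<open>auto simp: primitive_on_def\<close>)
  then show ?thesis
  proof (rule continuous_on_eq)
    fix x assume "x \<in> {a..b}"
    then show "u a + integral {a..x} v = u x"
      using primitive_onD[OF assms, of x] set_integrable_Icc_subset[OF primitive_on_integrable[OF assms], of a x]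
      by (simp add: LBINT_eq_integral)
  qed
qed

text \<open>The entry point for explicit functions such as the cotangent, the reciprocal sine and
  the trigonometric modes; derivatives within the interval suffice, so the endpoints need no
  extension.\<close>

lemma primitive_on_C1:
  assumes "\<And>x. x \<in> {a..b} \<Longrightarrow> (u has_real_derivative v x) (at x within {a..b})"
    and "continuous_on {a..b} v"
  shows "primitive_on a b u v"
  unfolding primitive_on_def
proof (intro conjI ballI)
  show "set_integrable lborel {a..b} v" by (rule borel_integrable_atLeastAtMost') fact
  fix x assume x: "x \<in> {a..b}"
  have "(LBINT y:{a..x}. v y) = u x - u a"
    unfolding set_lebesgue_integral_def
  proof (rule integral_FTC_atLeastAtMost)
    show "continuous_on {a..x} v" by (rule continuous_on_subset[OF assms(2)]) (use x in auto)
    show "(u has_vector_derivative v y) (at y within {a..x})" if "a \<le> y" "y \<le> x" for y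
      using assms(1)[of y] that x
      by (auto simp: has_real_derivative_iff_has_vector_derivative[symmetric] intro: DERIV_subset)
  qed (use x in auto)
  then show "u x = u a + (LBINT y:{a..x}. v y)" by simp
qed

lemma primitive_on_const: "primitive_on a b (\<lambda>x. c) (\<lambda>x. 0)"
  by (rule primitive_on_C1) auto

lemma primitive_on_add:
  assumes "primitive_on a b u v" "primitive_on a b w z"
  shows "primitive_on a b (\<lambda>x. u x + w x) (\<lambda>x. v x + z x)"
  unfolding primitive_on_def
proof (intro conjI ballI)
  note i = primitive_on_integrable[OF assms(1)] primitive_on_integrable[OF assms(2)]
  show "set_integrable lborel {a..b} (\<lambda>x. v x + z x)" using i by (rule set_integral_add)
  fix x assume x: "x \<in> {a..b}"
  then show "u x + w x = u a + w a + (LBINT y:{a..x}. v y + z y)"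
    using primitive_on_eq[OF assms(1), of a x] primitive_on_eq[OF assms(2), of a x]
      set_integral_add(2)[OF set_integrable_Icc_subset[OF i(1), of a x] set_integrable_Icc_subset[OF i(2), of a x]]
    by simp
qed

lemma primitive_on_cmult:
  assumes "primitive_on a b u v"
  shows "primitive_on a b (\<lambda>x. c * u x) (\<lambda>x. c * v x)"
  unfolding primitive_on_def
proof (intro conjI ballI)
  show "set_integrable lborel {a..b} (\<lambda>x. c * v x)"
    using primitive_on_integrable[OF assms] by simp
  show "c * u x = c * u a + (LBINT y:{a..x}. c * v y)" if "x \<in> {a..b}" for x
    using that primitive_onD[OF assms, of x] by (simp add: distrib_left)
qed

text \<open>Fubini on the square, split along the diagonal, gives integration by parts for primitives.\<close>

lemma LBINT_mult_LBINT:
  fixes v z :: "real \<Rightarrow> real"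
  assumes v: "set_integrable lborel {a..b} v" and z: "set_integrable lborel {a..b} z"
  shows "(LBINT x:{a..b}. v x) * (LBINT x:{a..b}. z x) =
      (LBINT x:{a..b}. (LBINT y:{a..x}. v y) * z x) + (LBINT x:{a..b}. v x * (LBINT y:{a..x}. z y))"
proof -
  define F where "F = (\<lambda>x. indicator {a..b} x * v x)"
  define G where "G = (\<lambda>x. indicator {a..b} x * z x)"
  have F: "integrable lborel F" and G: "integrable lborel G"
    using v z by (simp_all add: F_def G_def set_integrable_def)
  have [measurable]: "F \<in> borel_measurable borel" "G \<in> borel_measurable borel"
    using F G by auto
  have FG: "integrable (lborel \<Otimes>\<^sub>M lborel) (\<lambda>(s, t). F s * G t)"
  proof (rule lborel_pair.Fubini_integrable)
    have "(\<lambda>x. LBINT y. norm (F x * G y)) = (\<lambda>x. \<bar>F x\<bar> * (LBINT y. \<bar>G y\<bar>))"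
      by (simp add: abs_mult)
    then show "integrable lborel (\<lambda>x. LBINT y. norm (case (x, y) of (s, t) \<Rightarrow> F s * G t))"
      using F by simp
  qed (use G in auto)
  define P where "P = (\<lambda>(s, t). if s \<le> t then F s * G t else 0)"
  \<comment> \<open>The diagonal belongs to \<open>P\<close>, so the slices of \<open>Q\<close> are
    half-open intervals; their missing endpoint is a null set and is restored below.\<close>
  define Q where "Q = (\<lambda>(s, t). if t < s then F s * G t else 0)"
  have P: "integrable (lborel \<Otimes>\<^sub>M lborel) P"
    by (rule Bochner_Integration.integrable_bound[OF FG]) (auto simp: P_def)
  have Q: "integrable (lborel \<Otimes>\<^sub>M lborel) Q"
    by (rule Bochner_Integration.integrable_bound[OF FG]) (auto simp: Q_def)
  have "(LBINT x:{a..b}. v x) * (LBINT x:{a..b}. z x) = (LBINT s. F s * (LBINT t. G t))"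
    by (simp add: set_lebesgue_integral_def F_def G_def)
  also have "\<dots> = (LBINT s. LBINT t. F s * G t)"
    by simp
  also have "\<dots> = (\<integral>p. (case p of (s, t) \<Rightarrow> F s * G t) \<partial>(lborel \<Otimes>\<^sub>M lborel))"
    using lborel_pair.integral_fst'[OF FG] by simp
  also have "\<dots> = (\<integral>p. P p + Q p \<partial>(lborel \<Otimes>\<^sub>M lborel))"
    by (rule Bochner_Integration.integral_cong) (auto simp: P_def Q_def)
  also have "\<dots> = (\<integral>p. P p \<partial>(lborel \<Otimes>\<^sub>M lborel)) + (\<integral>p. Q p \<partial>(lborel \<Otimes>\<^sub>M lborel))"
    using P Q by simp
  also have "(\<integral>p. P p \<partial>(lborel \<Otimes>\<^sub>M lborel)) = (LBINT t. LBINT s. P (s, t))"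
  proof -
    have "integrable (lborel \<Otimes>\<^sub>M lborel) (\<lambda>(s, t). P (s, t))" using P by simp
    from lborel_pair.integral_snd[OF this] show ?thesis by simp
  qed
  also have "\<dots> = (LBINT x:{a..b}. (LBINT y:{a..x}. v y) * z x)"
    unfolding set_lebesgue_integral_def
  proof (rule Bochner_Integration.integral_cong)
    fix t
    have "(LBINT s. P (s, t)) = (LBINT s. (indicator {a..t} s *\<^sub>R v s) * (indicator {a..b} t *\<^sub>R z t))"
      by (rule Bochner_Integration.integral_cong) (auto simp: P_def F_def G_def split: split_indicator)
    then show "(LBINT s. P (s, t)) = indicator {a..b} t *\<^sub>R ((LBINT y. indicator {a..t} y *\<^sub>R v y) * z t)"
      by simp
  qed simp
  also have "(\<integral>p. Q p \<partial>(lborel \<Otimes>\<^sub>M lborel)) = (LBINT s. LBINT t. Q (s, t))"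
    using lborel_pair.integral_fst'[OF Q] by simp
  also have "\<dots> = (LBINT x:{a..b}. v x * (LBINT y:{a..x}. z y))"
    unfolding set_lebesgue_integral_def
  proof (rule Bochner_Integration.integral_cong)
    fix s
    have "(LBINT t. Q (s, t)) = (LBINT t. (indicator {a..b} s *\<^sub>R v s) * (indicator {a..<s} t *\<^sub>R z t))"
      by (rule Bochner_Integration.integral_cong) (auto simp: Q_def F_def G_def split: split_indicator)
    also have "\<dots> = (indicator {a..b} s *\<^sub>R v s) * (LBINT t. indicator {a..<s} t *\<^sub>R z t)"
      by simp
    also have "(LBINT t. indicator {a..<s} t *\<^sub>R z t) = (LBINT t:{a..s}. z t)" if "s \<in> {a..b}"
    proof -
      have m: "set_borel_measurable lborel A z" if "A \<subseteq> {a..b}" "A \<in> sets borel" for A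
        using set_integrable_subset[OF z] that
        by (auto simp: set_borel_measurable_def set_integrable_def borel_measurable_integrable)
      have "AE x in lborel. x \<noteq> s" by (rule AE_lborel_singleton)
      then have "(LBINT t:{a..<s}. z t) = (LBINT t:{a..s}. z t)"
        by (intro set_integral_cong_set m) (use that in \<open>auto elim: eventually_mono\<close>)
      then show ?thesis by (simp add: set_lebesgue_integral_def)
    qed
    then have "(indicator {a..b} s *\<^sub>R v s) * (LBINT t. indicator {a..<s} t *\<^sub>R z t) =
       indicator {a..b} s *\<^sub>R (v s * (LBINT y. indicator {a..s} y *\<^sub>R z y))"
      by (auto simp: set_lebesgue_integral_def split: split_indicator)
    finally show "(LBINT t. Q (s, t)) =
       indicator {a..b} s *\<^sub>R (v s * (LBINT y. indicator {a..s} y *\<^sub>R z y))" .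
  qed simp
  finally show ?thesis .
qed

text \<open>After subtraction of the initial values, \<open>U\<close> and \<open>W\<close> are pure
  integrals and their product is given by the Fubini identity; the remaining terms have a constant
  factor \<open>u a\<close> or \<open>w a\<close> and integrate directly.\<close>

lemma primitive_on_mult:
  assumes u: "primitive_on a b u v" and w: "primitive_on a b w z"
  shows "primitive_on a b (\<lambda>x. u x * w x) (\<lambda>x. v x * w x + z x * u x)"
  unfolding primitive_on_def
proof (intro conjI ballI)
  note i = primitive_on_integrable[OF u] primitive_on_integrable[OF w]
  note j = set_integrable_mult_continuous[OF i(1) primitive_on_continuous[OF w]]
    set_integrable_mult_continuous[OF i(2) primitive_on_continuous[OF u]]
  show "set_integrable lborel {a..b} (\<lambda>x. v x * w x + z x * u x)" using j by (rule set_integral_add)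
  fix x assume x: "x \<in> {a..b}"
  note iv = set_integrable_Icc_subset[OF i(1), of a x] and iz = set_integrable_Icc_subset[OF i(2), of a x]
  define U where "U y = (LBINT s:{a..y}. v s)" for y
  define W where "W y = (LBINT s:{a..y}. z s)" for y
  have U: "U y = u y - u a" and W: "W y = w y - w a" if "y \<in> {a..b}" for y
    using that primitive_onD[OF u, of y] primitive_onD[OF w, of y] by (simp_all add: U_def W_def)
  have "continuous_on {a..x} (\<lambda>y. u y - u a)"
    by (intro continuous_on_diff continuous_on_const
        continuous_on_subset[OF primitive_on_continuous[OF u]]) (use x in auto)
  then have cU: "continuous_on {a..x} U"
    by (rule continuous_on_eq) (use x in \<open>simp add: U\<close>)
  have "continuous_on {a..x} (\<lambda>y. w y - w a)"
    by (intro continuous_on_diff continuous_on_const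
        continuous_on_subset[OF primitive_on_continuous[OF w]]) (use x in auto)
  then have cW: "continuous_on {a..x} W"
    by (rule continuous_on_eq) (use x in \<open>simp add: W\<close>)
  have ivW: "set_integrable lborel {a..x} (\<lambda>y. v y * W y)"
    by (rule set_integrable_mult_continuous[OF iv cW]) (use x in auto)
  have izU: "set_integrable lborel {a..x} (\<lambda>y. z y * U y)"
    by (rule set_integrable_mult_continuous[OF iz cU]) (use x in auto)
  have "(LBINT y:{a..x}. v y * w y + z y * u y) =
      (LBINT y:{a..x}. (w a * v y + u a * z y) + (v y * W y + z y * U y))"
    by (rule set_lebesgue_integral_cong) (use x in \<open>auto simp: U W algebra_simps\<close>)
  also have "\<dots> = w a * U x + u a * W x + ((LBINT y:{a..x}. v y * W y) + (LBINT y:{a..x}. z y * U y))"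
    using iv iz ivW izU x by (simp add: U_def[symmetric] W_def[symmetric])
  also have "(LBINT y:{a..x}. v y * W y) + (LBINT y:{a..x}. z y * U y) = U x * W x"
    using LBINT_mult_LBINT[of a x v z] iv iz x
    by (simp add: U_def[symmetric] W_def[symmetric] mult.commute)
  finally show "u x * w x = u a * w a + (LBINT y:{a..x}. v y * w y + z y * u y)"
    using U[OF x] W[OF x] by (simp add: algebra_simps)
qed

text \<open>The rays \<open>{..x}\<close> are stable under intersection and generate the Borel sets,
  so a Dynkin argument spreads the vanishing of the integral from rays to all Borel sets. A density
  with all integrals zero is zero almost everywhere.\<close>

lemma AE_zero_if_primitive_zero:
  fixes f :: "real \<Rightarrow> real"
  assumes f: "set_integrable lborel {a..b} f" and "a \<le> b"
    and zero: "\<And>x. x \<in> {a..b} \<Longrightarrow> (LBINT y:{a..x}. f y) = 0"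
  shows "AE x\<in>{a..b} in lborel. f x = 0"
proof -
  define F where "F = (\<lambda>x. indicator {a..b} x * f x)"
  have F: "integrable lborel F" using f by (simp add: F_def set_integrable_def)
  have FA: "set_integrable lborel A F" if "A \<in> sets borel" for A
    using F that unfolding set_integrable_def by (intro integrable_mult_indicator) auto
  have tot: "(LBINT x. F x) = 0"
    using zero[of b] \<open>a \<le> b\<close> by (simp add: F_def set_lebesgue_integral_def)
  have gen: "Int_stable (range (\<lambda>x::real. {..x}))" "range (\<lambda>x::real. {..x}) \<subseteq> Pow UNIV"
    by (auto simp: Int_stable_def)
  have "(LBINT x:A. F x) = 0" if "A \<in> sigma_sets UNIV (range (\<lambda>x::real. {..x}))" for A
    using gen that
  proof (induction rule: sigma_sets_induct_disjoint)
    case (basic A)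
    then obtain x where A: "A = {..x}" by auto
    have "(LBINT y:A. F y) = (LBINT y:{a..min x b}. f y)"
      unfolding set_lebesgue_integral_def A F_def
      by (rule Bochner_Integration.integral_cong) (auto split: split_indicator)
    also have "\<dots> = 0"
    proof (cases "a \<le> x")
      case True then show ?thesis using zero[of "min x b"] \<open>a \<le> b\<close> by auto
    next
      case False then have "{a..min x b} = {}" by auto
      then show ?thesis by (simp add: set_lebesgue_integral_def)
    qed
    finally show ?case .
  next
    case empty then show ?case by (simp add: set_lebesgue_integral_def)
  next
    case (compl A)
    then have A: "A \<in> sets borel" by (simp add: borel_eq_atMost image_def Setcompr_eq_image)
    have "0 = (LBINT x:A \<union> (UNIV - A). F x)" using tot by (simp add: set_lebesgue_integral_def)
    also have "\<dots> = (LBINT x:A. F x) + (LBINT x:(UNIV - A). F x)"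
      by (rule set_integral_Un) (use A FA in auto)
    finally show ?case using compl.IH by simp
  next
    case (union A)
    then have A: "A i \<in> sets borel" for i by (auto simp: borel_eq_atMost)
    have "(LBINT x:(\<Union>i. A i). F x) = (\<Sum>i. (LBINT x:A i. F x))"
      by (rule lebesgue_integral_countable_add)
         (use union.hyps A FA in \<open>auto simp: disjoint_family_on_def\<close>)
    then show ?case using union.IH by simp
  qed
  then have "AE x in lborel. F x = 0"
    using density_unique_real[OF F, of "\<lambda>x. 0"] by (auto simp: borel_eq_atMost)
  then show ?thesis by (auto simp: F_def elim: eventually_mono)
qed

text \<open>Cauchy-Schwarz against the constant 1, obtained as nonnegativity of the variance:
  \<open>m\<close> is the mean of \<open>v\<close>.\<close>

lemma LBINT_square_le:
  fixes v :: "real \<Rightarrow> real"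
  assumes v: "set_integrable lborel {a..b} v" and v2: "set_integrable lborel {a..b} (\<lambda>x. (v x)\<^sup>2)"
    and "a \<le> b"
  shows "(LBINT x:{a..b}. v x)\<^sup>2 \<le> (b - a) * (LBINT x:{a..b}. (v x)\<^sup>2)"
proof (cases "a = b")
  case True
  then show ?thesis using LBINT_eq_integral[OF v] by simp
next
  case False
  define m where "m = (LBINT x:{a..b}. v x) / (b - a)"
  note i = v v2 borel_integrable_atLeastAtMost'[of a b "\<lambda>x. m\<^sup>2"]
  have "0 \<le> (LBINT x:{a..b}. (v x - m)\<^sup>2)"
    unfolding set_lebesgue_integral_def by (rule integral_nonneg_AE) auto
  also have "\<dots> = (LBINT x:{a..b}. ((v x)\<^sup>2 - 2 * m * v x) + m\<^sup>2)"
    by (simp add: power2_diff algebra_simps)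
  also have "\<dots> = (LBINT x:{a..b}. (v x)\<^sup>2) - 2 * m * (LBINT x:{a..b}. v x) + m\<^sup>2 * (b - a)"
    using i \<open>a \<le> b\<close> by (simp add: LBINT_const)
  also have "\<dots> = (LBINT x:{a..b}. (v x)\<^sup>2) - (LBINT x:{a..b}. v x)\<^sup>2 / (b - a)"
  proof -
    have "q - 2 * (I / d) * I + (I / d)\<^sup>2 * d = q - I\<^sup>2 / d" if "d \<noteq> 0" for q I d :: real
      using that by (simp add: power2_eq_square field_simps)
    from this[of "b - a"] False show ?thesis by (simp add: m_def)
  qed
  finally show ?thesis using False \<open>a \<le> b\<close> by (simp add: field_simps)
qed

lemma LBINT_nonneg:
  fixes f :: "real \<Rightarrow> real"
  assumes "\<And>x. x \<in> S \<Longrightarrow> 0 \<le> f x"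
  shows "0 \<le> (LBINT x:S. f x)"
  unfolding set_lebesgue_integral_def
  by (rule integral_nonneg_AE) (use assms in \<open>auto split: split_indicator\<close>)

section \<open>Wirtinger's inequality for functions vanishing at both ends\<close>

text \<open>Equivalently \<open>y * cot y \<le> 1\<close> inside the interval: the pole of the
  cotangent is of first order with coefficient one, which is what the boundary terms below can
  afford. The difference of the two sides has derivative \<open>y * sin y\<close>.\<close>

lemma mult_cos_le_sin:
  assumes "0 \<le> y" "y \<le> pi"
  shows "y * cos y \<le> sin y"
proof -
  have "(\<lambda>y. sin y - y * cos y) 0 \<le> (\<lambda>y. sin y - y * cos y) y"
  proof (rule DERIV_nonneg_imp_nondecreasing[OF assms(1)])
    fix x assume "0 \<le> x" "x \<le> y"
    then show "\<exists>z. ((\<lambda>y. sin y - y * cos y) has_real_derivative z) (at x) \<and> 0 \<le> z"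
      using assms sin_ge_zero[of x]
      by (intro exI[of _ "x * sin x"]) (auto intro!: derivative_eq_intros)
  qed
  then show ?thesis by simp
qed

text \<open>Sturm comparison with \<open>sin (k (x - a))\<close>: writing \<open>\<phi> = k cot (k (x - a))\<close>, one has
  \<open>(v - w \<phi>)\<^sup>2 = v\<^sup>2 - k\<^sup>2 w\<^sup>2 - (w\<^sup>2 \<phi>)'\<close>, and the boundary terms, singular at both ends, are
  controlled by \<open>w (p)\<^sup>2 \<le> (p - a) \<integral> v\<^sup>2\<close>.\<close>

locale vanishing_at_ends =
  fixes a L k :: real and w v :: "real \<Rightarrow> real"
  assumes L: "L > 0" and k: "k = pi / L"
    and w: "primitive_on a (a + L) w v"
    and v2: "set_integrable lborel {a..a + L} (\<lambda>x. (v x)\<^sup>2)"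
    and ends: "w a = 0" "w (a + L) = 0"
begin

definition \<phi> :: "real \<Rightarrow> real" where "\<phi> x = k * cot (k * (x - a))"

lemma k_pos: "k > 0" using L k by simp

lemma kL: "k * L = pi" using L k by simp

lemma phase:
  assumes "a < x" "x < a + L"
  shows "0 < k * (x - a)" "k * (x - a) < pi"
  using assms k_pos mult_strict_left_mono[of "x - a" L k] by (simp_all add: kL)

lemma sin_pos: "a < x \<Longrightarrow> x < a + L \<Longrightarrow> sin (k * (x - a)) > 0"
  using phase by (intro sin_gt_zero) auto

lemma w2_integrable: "set_integrable lborel {a..a + L} (\<lambda>x. (w x)\<^sup>2)"
  by (intro borel_integrable_atLeastAtMost' continuous_on_power primitive_on_continuous[OF w])

lemma continuous_\<phi>: "a < p \<Longrightarrow> q < a + L \<Longrightarrow> continuous_on {p..q} \<phi>"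
  unfolding \<phi>_def cot_def
proof (intro continuous_intros ballI)
  fix x assume "a < p" "q < a + L" "x \<in> {p..q}"
  then show "sin (k * (x - a)) \<noteq> 0" using sin_pos[of x] by auto
qed

lemma integrable_defect:
  assumes "a < p" "q < a + L"
  shows "set_integrable lborel {p..q} (\<lambda>x. (v x - w x * \<phi> x)\<^sup>2)"
proof -
  have wpq: "primitive_on p q w v" using primitive_on_subset[OF w] assms by auto
  note c = primitive_on_continuous[OF wpq] continuous_\<phi>[OF assms]
  have "set_integrable lborel {p..q} (\<lambda>x. (v x)\<^sup>2 - v x * (2 * w x * \<phi> x) + (w x * \<phi> x)\<^sup>2)"
    by (intro set_integral_add(1) set_integral_diff(1) set_integrable_mult_continuous
        borel_integrable_atLeastAtMost' continuous_intros c primitive_on_integrable[OF wpq]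
        set_integrable_Icc_subset[OF v2]) (use assms in auto)
  then show ?thesis by (simp add: power2_diff algebra_simps)
qed

text \<open>The Riccati equation \<open>\<phi>' = - (k ^ 2 + \<phi> ^ 2)\<close> turns the square
  into a quadratic form plus an exact derivative. The interval stays strictly inside because \<phi>
  has poles at \<open>a\<close> and \<open>a + L\<close>.\<close>

lemma defect_eq:
  assumes pq: "a < p" "p \<le> q" "q < a + L"
  shows "(LBINT x:{p..q}. (v x - w x * \<phi> x)\<^sup>2) =
    (LBINT x:{p..q}. (v x)\<^sup>2) - k\<^sup>2 * (LBINT x:{p..q}. (w x)\<^sup>2) - (w q)\<^sup>2 * \<phi> q + (w p)\<^sup>2 * \<phi> p"
proof -
  have wpq: "primitive_on p q w v" using primitive_on_subset[OF w] pq by auto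
  have c\<phi>: "continuous_on {p..q} \<phi>" using continuous_\<phi> pq by auto
  have d\<phi>: "(\<phi> has_real_derivative - (k\<^sup>2 + (\<phi> x)\<^sup>2)) (at x within {p..q})" if "x \<in> {p..q}" for x
  proof -
    have s: "sin (k * (x - a)) \<noteq> 0" using sin_pos[of x] that pq by auto
    have "(\<phi> has_real_derivative k * (- inverse ((sin (k * (x - a)))\<^sup>2) * k)) (at x within {p..q})"
      unfolding \<phi>_def
      by (rule derivative_eq_intros refl DERIV_chain2[OF DERIV_cot] s)+ simp
    also have "k * (- inverse ((sin (k * (x - a)))\<^sup>2) * k) = - (k\<^sup>2 + (\<phi> x)\<^sup>2)"
    proof -
      have "inverse ((sin (k * (x - a)))\<^sup>2) = 1 + (cot (k * (x - a)))\<^sup>2"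
        using s sin_cos_squared_add[of "k * (x - a)"]
        by (simp add: cot_def field_simps)
      then show ?thesis by (simp add: \<phi>_def power2_eq_square algebra_simps)
    qed
    finally show ?thesis .
  qed
  have p\<phi>: "primitive_on p q \<phi> (\<lambda>x. - (k\<^sup>2 + (\<phi> x)\<^sup>2))"
    by (rule primitive_on_C1[OF d\<phi>]) (auto intro!: continuous_intros c\<phi>)
  define D where "D x = (v x * w x + v x * w x) * \<phi> x + - (k\<^sup>2 + (\<phi> x)\<^sup>2) * (w x * w x)" for x
  have prim: "primitive_on p q (\<lambda>x. w x * w x * \<phi> x) D"
    unfolding D_def by (intro primitive_on_mult wpq p\<phi>)
  have "w q * w q * \<phi> q = w p * w p * \<phi> p + (LBINT x:{p..q}. D x)"
    using primitive_onD[OF prim, of q] pq by simp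
  moreover have "(LBINT x:{p..q}. (v x - w x * \<phi> x)\<^sup>2) =
      (LBINT x:{p..q}. (v x)\<^sup>2 - k\<^sup>2 * (w x)\<^sup>2 - D x)"
    by (simp add: D_def power2_eq_square algebra_simps)
  moreover have "\<dots> = (LBINT x:{p..q}. (v x)\<^sup>2) - k\<^sup>2 * (LBINT x:{p..q}. (w x)\<^sup>2) - (LBINT x:{p..q}. D x)"
    using set_integrable_Icc_subset[OF v2, of p q] set_integrable_Icc_subset[OF w2_integrable, of p q]
      primitive_on_integrable[OF prim] pq by simp
  ultimately show ?thesis by (simp add: power2_eq_square)
qed

text \<open>Since \<open>w a = 0\<close>, Cauchy-Schwarz gives a factor \<open>p - a\<close> that
  cancels the pole of \<phi>. The bound uses only the part of the integral of \<open>v ^ 2\<close>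
  to the left of \<open>p\<close>, which \<open>defect_eq\<close> on an interval starting at
  \<open>p\<close> leaves untouched.\<close>

lemma left_boundary_term:
  assumes "a < p" "p < a + L"
  shows "(w p)\<^sup>2 * \<phi> p \<le> (LBINT x:{a..p}. (v x)\<^sup>2)"
proof -
  have "(p - a) * \<phi> p = k * (p - a) * cos (k * (p - a)) / sin (k * (p - a))"
    by (simp add: \<phi>_def cot_def)
  also have "\<dots> \<le> 1"
    using sin_pos[OF assms] mult_cos_le_sin[of "k * (p - a)"] phase[OF assms] by simp
  finally have "(p - a) * \<phi> p \<le> 1" .
  then have "(w p)\<^sup>2 * ((p - a) * \<phi> p) \<le> (w p)\<^sup>2 * 1"
    by (intro mult_left_mono) auto
  also have "(w p)\<^sup>2 \<le> (p - a) * (LBINT x:{a..p}. (v x)\<^sup>2)"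
    using LBINT_square_le[of a p v] primitive_onD[OF w, of p] ends assms
      set_integrable_Icc_subset[OF v2, of a p]
      set_integrable_Icc_subset[OF primitive_on_integrable[OF w], of a p] by simp
  finally have "(p - a) * ((w p)\<^sup>2 * \<phi> p) \<le> (p - a) * (LBINT x:{a..p}. (v x)\<^sup>2)"
    by (simp add: mult_ac)
  then show ?thesis using assms by simp
qed

lemma right_boundary_term:
  assumes "a < q" "q < a + L"
  shows "- ((w q)\<^sup>2 * \<phi> q) \<le> (LBINT x:{q..a + L}. (v x)\<^sup>2)"
proof -
  \<comment> \<open>Reflection at the midpoint: the phase at \<open>q\<close> is
    \<open>pi - y\<close>, and the cotangent changes sign, so the estimate at the left end
    applies.\<close>
  define y where "y = k * (a + L - q)"
  have y: "k * (q - a) = pi - y" using kL by (simp add: y_def algebra_simps)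
  have "- ((a + L - q) * \<phi> q) = y * cos y / sin y"
    unfolding \<phi>_def cot_def y by (simp add: y_def)
  also have "\<dots> \<le> 1"
    using sin_pos[OF assms, unfolded y] mult_cos_le_sin[of y] phase[OF assms, unfolded y] by simp
  finally have "- ((a + L - q) * \<phi> q) \<le> 1" .
  then have "(w q)\<^sup>2 * - ((a + L - q) * \<phi> q) \<le> (w q)\<^sup>2 * 1"
    by (intro mult_left_mono) auto
  also have "(w q)\<^sup>2 \<le> (a + L - q) * (LBINT x:{q..a + L}. (v x)\<^sup>2)"
  proof -
    have "w q = - (LBINT x:{q..a + L}. v x)"
      using primitive_on_eq[OF w, of q "a + L"] ends assms by simp
    then show ?thesis
      using LBINT_square_le[of q "a + L" v] assms
        set_integrable_Icc_subset[OF v2, of q "a + L"]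
        set_integrable_Icc_subset[OF primitive_on_integrable[OF w], of q "a + L"] by simp
  qed
  finally have "(a + L - q) * - ((w q)\<^sup>2 * \<phi> q) \<le> (a + L - q) * (LBINT x:{q..a + L}. (v x)\<^sup>2)"
    by (simp add: mult_ac)
  then show ?thesis using assms by (subst (asm) mult_le_cancel_left_pos) auto
qed

text \<open>The defect is nonnegative, so enlarging the interval to distance \<eta> from both ends
  only increases its integral. The outer pieces of the integral of \<open>v ^ 2\<close> pay for the
  boundary terms; what is missing is the integral of \<open>w ^ 2\<close> near the ends, which is of
  order \<eta> because \<open>w\<close> is bounded.\<close>

lemma defect_le:
  assumes pq: "a < p" "p \<le> q" "q < a + L"
  shows "(LBINT x:{p..q}. (v x - w x * \<phi> x)\<^sup>2) \<le>
    (LBINT x:{a..a + L}. (v x)\<^sup>2) - k\<^sup>2 * (LBINT x:{a..a + L}. (w x)\<^sup>2)"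
    (is "?D p q \<le> ?R")
proof -
  have "bounded (w ` {a..a + L})"
    by (intro compact_imp_bounded compact_continuous_image primitive_on_continuous[OF w] compact_Icc)
  then obtain B where B: "\<And>x. x \<in> {a..a + L} \<Longrightarrow> \<bar>w x\<bar> \<le> B"
    by (force simp: bounded_iff)
  have small: "(LBINT x:{c..d}. (w x)\<^sup>2) \<le> B\<^sup>2 * (d - c)" if "a \<le> c" "c \<le> d" "d \<le> a + L" for c d
  proof -
    have "(LBINT x:{c..d}. (w x)\<^sup>2) \<le> (LBINT x:{c..d}. B\<^sup>2)"
    proof (rule set_integral_mono)
      show "set_integrable lborel {c..d} (\<lambda>x. (w x)\<^sup>2)"
        by (rule set_integrable_Icc_subset[OF w2_integrable]) (use that in auto)
      show "(w x)\<^sup>2 \<le> B\<^sup>2" if "x \<in> {c..d}" for x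
        using B[of x] that \<open>a \<le> c\<close> \<open>d \<le> a + L\<close> by (intro abs_le_square_iff[THEN iffD1]) auto
    qed (intro borel_integrable_atLeastAtMost' continuous_intros)
    then show ?thesis using that by (simp add: LBINT_const)
  qed
  have est: "?D p q \<le> ?R + k\<^sup>2 * (2 * B\<^sup>2 * \<eta>)" if \<eta>: "0 < \<eta>" "\<eta> \<le> p - a" "\<eta> \<le> a + L - q" for \<eta>
  proof -
    define p' where "p' = a + \<eta>"
    define q' where "q' = a + L - \<eta>"
    have o: "a < p'" "p' \<le> p" "q \<le> q'" "q' < a + L" "p' \<le> q'"
      using \<eta> pq by (auto simp: p'_def q'_def)
    have split: "(LBINT x:{c..d}. f x) = (LBINT x:{c..p}. f x) + (LBINT x:{p..q}. f x) + (LBINT x:{q..d}. f x)"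
      if "set_integrable lborel {c..d} f" "c \<le> p" "p \<le> q" "q \<le> d" for f :: "real \<Rightarrow> real" and c p q d
      using LBINT_Icc_combine[of c d f p] LBINT_Icc_combine[of p d f q] that
        set_integrable_Icc_subset[of c d f p d] by simp
    have "?D p q \<le> ?D p' q'"
      using split[OF integrable_defect[OF o(1) o(4)] o(2) pq(2) o(3)]
        LBINT_nonneg[of "{p'..p}" "\<lambda>x. (v x - w x * \<phi> x)\<^sup>2"]
        LBINT_nonneg[of "{q..q'}" "\<lambda>x. (v x - w x * \<phi> x)\<^sup>2"] by simp
    also have "\<dots> \<le> (LBINT x:{a..a + L}. (v x)\<^sup>2) - k\<^sup>2 * (LBINT x:{p'..q'}. (w x)\<^sup>2)"
      using defect_eq[OF o(1) o(5) o(4)] left_boundary_term[of p'] right_boundary_term[of q']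
        split[OF v2, of p' q'] o by simp
    also have "\<dots> = ?R + k\<^sup>2 * ((LBINT x:{a..p'}. (w x)\<^sup>2) + (LBINT x:{q'..a + L}. (w x)\<^sup>2))"
      using split[OF w2_integrable, of p' q'] o by (simp add: algebra_simps)
    also have "\<dots> \<le> ?R + k\<^sup>2 * (2 * B\<^sup>2 * \<eta>)"
      using small[of a p'] small[of q' "a + L"] o
      by (intro add_left_mono mult_left_mono) (auto simp: p'_def q'_def)
    finally show ?thesis .
  qed
  have "((\<lambda>\<eta>. ?R + k\<^sup>2 * (2 * B\<^sup>2 * \<eta>)) \<longlongrightarrow> ?R + k\<^sup>2 * (2 * B\<^sup>2 * 0)) (at_right 0)"
    by (intro tendsto_intros)
  moreover have "\<forall>\<^sub>F \<eta> in at_right 0. ?D p q \<le> ?R + k\<^sup>2 * (2 * B\<^sup>2 * \<eta>)"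
    unfolding eventually_at_right_field
    by (rule exI[of _ "min (p - a) (a + L - q)"]) (use pq est in auto)
  ultimately show ?thesis
    using tendsto_lowerbound by fastforce
qed

text \<open>By nonnegativity of the defect, the one-point interval at the middle is enough.\<close>

lemma wirtinger_le: "k\<^sup>2 * (LBINT x:{a..a + L}. (w x)\<^sup>2) \<le> (LBINT x:{a..a + L}. (v x)\<^sup>2)"
  using defect_le[of "a + L / 2" "a + L / 2"] LBINT_nonneg[of "{a + L / 2..a + L / 2}" "\<lambda>x. (v x - w x * \<phi> x)\<^sup>2"] L
  by simp

text \<open>Equality leaves no room for a defect, so \<open>v = w * \<phi>\<close> almost everywhere
  inside. This linear equation is solved by the sine, hence the quotient of \<open>w\<close> by the
  sine is a primitive of zero, that is, a constant.\<close>

lemma wirtinger_eq: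
  assumes eq: "(LBINT x:{a..a + L}. (v x)\<^sup>2) \<le> k\<^sup>2 * (LBINT x:{a..a + L}. (w x)\<^sup>2)"
  shows "\<exists>C. \<forall>x\<in>{a..a + L}. w x = C * sin (k * (x - a))"
proof -
  define S where "S x = inverse (sin (k * (x - a)))" for x
  have const: "w q * S q = w p * S p" if pq: "a < p" "p \<le> q" "q < a + L" for p q
  proof -
    have wpq: "primitive_on p q w v" using primitive_on_subset[OF w] pq by auto
    have s: "sin (k * (x - a)) \<noteq> 0" if "x \<in> {p..q}" for x
      using sin_pos[of x] that pq by auto
    have dS: "(S has_real_derivative - \<phi> x * S x) (at x within {p..q})" if "x \<in> {p..q}" for x
      unfolding S_def \<phi>_def cot_def using s[OF that]
      by (auto intro!: derivative_eq_intros simp: field_simps)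
    have cS: "continuous_on {p..q} S"
      using dS by (meson DERIV_continuous continuous_on_eq_continuous_within)
    have pS: "primitive_on p q S (\<lambda>x. - \<phi> x * S x)"
      by (rule primitive_on_C1[OF dS]) (auto intro!: continuous_intros cS continuous_\<phi> pq)
    have "(LBINT x:{p..q}. (v x - w x * \<phi> x)\<^sup>2) = 0"
      using defect_le[OF pq] eq LBINT_nonneg[of "{p..q}" "\<lambda>x. (v x - w x * \<phi> x)\<^sup>2"] by simp
    then have "AE x in lborel. indicator {p..q} x *\<^sub>R (v x - w x * \<phi> x)\<^sup>2 = 0"
      unfolding set_lebesgue_integral_def
      by (subst (asm) integral_nonneg_eq_0_iff_AE)
         (use integrable_defect[of p q] pq in \<open>auto simp: set_integrable_def\<close>)
    \<comment> \<open>\<open>S\<close> has derivative \<open>- \<phi> * S\<close>, so the product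
      rule gives \<open>w * S\<close> the derivative \<open>(v - w * \<phi>) * S\<close>, which
      vanishes where the defect does.\<close>
    then have "AE x in lborel. indicator {p..q} x *\<^sub>R (v x * S x + - \<phi> x * S x * w x) = 0"
      by (rule eventually_mono) (auto split: split_indicator simp: algebra_simps)
    then have "(LBINT x:{p..q}. v x * S x + - \<phi> x * S x * w x) = 0"
      unfolding set_lebesgue_integral_def by (rule integral_eq_zero_AE)
    then show ?thesis
      using primitive_onD[OF primitive_on_mult[OF wpq pS], of q] pq by simp
  qed
  define m where "m = a + L / 2"
  have m: "a < m" "m < a + L" using L by (auto simp: m_def)
  have "w x = w m * S m * sin (k * (x - a))" if x: "x \<in> {a..a + L}" for x
  proof (cases "x = a \<or> x = a + L")
    case True
    then show ?thesis using ends kL by auto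
  next
    case False
    then have "a < x" "x < a + L" using x by auto
    then have "w x * S x = w m * S m"
      using const[of x m] const[of m x] m by (cases "x \<le> m") auto
    then show ?thesis using sin_pos[OF \<open>a < x\<close> \<open>x < a + L\<close>] by (simp add: S_def field_simps)
  qed
  then show ?thesis by blast
qed

end

section \<open>Square integrable derivatives\<close>

lemma has_L2_derivative_measurable:
  "has_L2_derivative X u v \<Longrightarrow> v \<in> borel_measurable borel"
  by (simp only: has_L2_derivative_def)

lemma has_L2_derivative_square_integrable:
  "has_L2_derivative X u v \<Longrightarrow> set_integrable lborel {0..X} (\<lambda>x. (v x)\<^sup>2)"
  by (simp only: has_L2_derivative_def)

lemma has_L2_derivative_integrable:
  assumes "has_L2_derivative X u v"
  shows "set_integrable lborel {0..X} v"
proof (rule set_integrable_bound)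
  show "set_integrable lborel {0..X} (\<lambda>x. 1 + (v x)\<^sup>2)"
    by (intro set_integral_add(1) borel_integrable_atLeastAtMost' continuous_on_const
        has_L2_derivative_square_integrable[OF assms])
  show "set_borel_measurable lborel {0..X} v"
    using has_L2_derivative_measurable[OF assms] by (auto simp: set_borel_measurable_def)
  have "\<bar>y\<bar> \<le> 1 + y\<^sup>2" for y :: real
  proof -
    have "0 \<le> (\<bar>y\<bar> - 1)\<^sup>2" by simp
    then show ?thesis by (simp add: power2_diff)
  qed
  then show "AE x in lborel. x \<in> {0..X} \<longrightarrow> norm (v x) \<le> norm (1 + (v x)\<^sup>2)"
    by auto
qed

lemma has_L2_derivative_primitive:
  assumes "has_L2_derivative X u v"
  shows "primitive_on 0 X u v"
  unfolding primitive_on_def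
  using has_L2_derivative_integrable[OF assms] assms unfolding has_L2_derivative_def by blast

lemma has_L2_derivative_unique:
  assumes "has_L2_derivative X u v" "has_L2_derivative X u w" "0 < X"
  shows "AE x\<in>{0..X} in lborel. v x = w x"
proof -
  note p = assms(1,2)[THEN has_L2_derivative_primitive]
  note i = assms(1,2)[THEN has_L2_derivative_integrable]
  have "AE x\<in>{0..X} in lborel. v x - w x = 0"
  proof (rule AE_zero_if_primitive_zero)
    show "set_integrable lborel {0..X} (\<lambda>x. v x - w x)" using i by (rule set_integral_diff)
    show "(LBINT y:{0..x}. v y - w y) = 0" if "x \<in> {0..X}" for x
      using that primitive_onD[OF p(1), of x] primitive_onD[OF p(2), of x]
        set_integrable_Icc_subset[OF i(1), of 0 x] set_integrable_Icc_subset[OF i(2), of 0 x] by simp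
  qed (use assms in auto)
  then show ?thesis by simp
qed

lemma has_L2_derivative_H1_deriv:
  "has_L2_derivative X u v \<Longrightarrow> has_L2_derivative X u (H1_deriv X u)"
  by (metis H1_deriv_def someI_ex)

lemma H1_deriv_has_L2_derivative: "u \<in> H1 X \<Longrightarrow> has_L2_derivative X u (H1_deriv X u)"
  unfolding H1_def using has_L2_derivative_H1_deriv by blast

text \<open>\<open>H1_deriv\<close> is an unknown version picked by the choice operator. Two
  versions agree almost everywhere, so any explicit derivative may replace it under the
  integral.\<close>

lemma LBINT_H1_deriv:
  assumes v: "has_L2_derivative X u v" and "0 < X"
  shows "(LBINT x:{0..X}. (H1_deriv X u x)\<^sup>2) = (LBINT x:{0..X}. (v x)\<^sup>2)"
proof (rule set_lebesgue_integral_cong_AE)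
  have d: "has_L2_derivative X u (H1_deriv X u)"
    by (rule has_L2_derivative_H1_deriv) fact
  show "AE x\<in>{0..X} in lborel. (H1_deriv X u x)\<^sup>2 = (v x)\<^sup>2"
    using has_L2_derivative_unique[OF d v \<open>0 < X\<close>] by (auto elim: eventually_mono)
  show "(\<lambda>x. (H1_deriv X u x)\<^sup>2) \<in> borel_measurable lborel" "(\<lambda>x. (v x)\<^sup>2) \<in> borel_measurable lborel"
    using d[THEN has_L2_derivative_measurable] v[THEN has_L2_derivative_measurable] by auto
qed simp

lemma has_L2_derivative_deriv_integrable:
  assumes v: "has_L2_derivative X u v"
  shows "set_integrable lborel {0..X} (\<lambda>x. (H1_deriv X u x)\<^sup>2)"
  by (rule has_L2_derivative_square_integrable[OF has_L2_derivative_H1_deriv[OF v]])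

lemma has_L2_derivative_C1:
  assumes "\<And>x. (u has_real_derivative v x) (at x)" "continuous_on UNIV v"
  shows "has_L2_derivative X u v"
proof -
  have "primitive_on 0 X u v"
    by (rule primitive_on_C1) (use assms in \<open>auto intro: DERIV_subset continuous_on_subset\<close>)
  moreover have "set_integrable lborel {0..X} (\<lambda>x. (v x)\<^sup>2)"
    by (intro borel_integrable_atLeastAtMost' continuous_intros continuous_on_subset[OF assms(2)]) auto
  ultimately show ?thesis
    unfolding has_L2_derivative_def primitive_on_def
    using borel_measurable_continuous_onI[OF assms(2)] by blast
qed

lemma has_L2_derivative_affine:
  assumes "has_L2_derivative X u v"
  shows "has_L2_derivative X (\<lambda>x. c + e * u x) (\<lambda>x. e * v x)"
proof -
  have "primitive_on 0 X (\<lambda>x. c + e * u x) (\<lambda>x. 0 + e * v x)"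
    by (intro primitive_on_add primitive_on_const primitive_on_cmult has_L2_derivative_primitive assms)
  moreover have "(\<lambda>x. e * v x) \<in> borel_measurable borel"
    using has_L2_derivative_measurable[OF assms] by auto
  moreover have "set_integrable lborel {0..X} (\<lambda>x. (e * v x)\<^sup>2)"
    using has_L2_derivative_square_integrable[OF assms] by (simp add: power_mult_distrib)
  ultimately show ?thesis
    unfolding has_L2_derivative_def primitive_on_def by (simp only: add_0) blast
qed

section \<open>Periodic functions and Wirtinger's inequality on the circle\<close>

lemma periodic_int_shift:
  fixes u :: "real \<Rightarrow> 'a"
  assumes "\<And>x. u (x + X) = u x"
  shows "u (x + of_int n * X) = u x"
proof (induction n rule: int_induct[of _ 0])
  case (step1 i)
  then show ?case using assms[of "x + of_int i * X"] by (simp add: algebra_simps)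
next
  case (step2 i)
  then show ?case using assms[of "x + of_int (i - 1) * X"] by (simp add: algebra_simps)
qed simp

lemma periodic_representative:
  fixes c X x :: real
  assumes "0 < X"
  shows "\<exists>n::int. x + of_int n * X \<in> {c..c + X}"
proof
  define m where "m = \<lfloor>(x - c) / X\<rfloor>"
  have "of_int m \<le> (x - c) / X" "(x - c) / X < of_int m + 1" unfolding m_def by linarith+
  then have "of_int m * X \<le> x - c" "x - c < (of_int m + 1) * X"
    using assms by (simp_all add: field_simps)
  then show "x + of_int (- m) * X \<in> {c..c + X}" by (auto simp: algebra_simps)
qed

lemma H1_periodic: "u \<in> H1 X \<Longrightarrow> u (x + X) = u x"
  by (simp add: H1_def)

lemma H1_continuous_Icc: "u \<in> H1 X \<Longrightarrow> continuous_on {0..X} u"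
  using primitive_on_continuous[OF has_L2_derivative_primitive[OF H1_deriv_has_L2_derivative]] .

text \<open>A second copy of the period is appended so that half periods starting anywhere in the
  first half fit inside one interval.\<close>

definition two_periods :: "real \<Rightarrow> (real \<Rightarrow> real) \<Rightarrow> real \<Rightarrow> real" where
  "two_periods X f x = (if x \<le> X then f x else f (x - X))"

lemma two_periods_measurable [measurable]:
  assumes [measurable]: "f \<in> borel_measurable borel"
  shows "two_periods X f \<in> borel_measurable borel"
  unfolding two_periods_def by measurable

lemma LBINT_two_periods:
  assumes f: "set_integrable lborel {0..X} f" and m [measurable]: "f \<in> borel_measurable borel"
    and "0 < X"
  shows "set_integrable lborel {0..2 * X} (two_periods X f)"
    and "x \<le> X \<Longrightarrow> (LBINT y:{0..x}. two_periods X f y) = (LBINT y:{0..x}. f y)"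
    and "c \<in> {0..X} \<Longrightarrow> (LBINT y:{X..X + c}. two_periods X f y) = (LBINT y:{0..c}. f y)"
    and "c \<in> {0..X} \<Longrightarrow> (LBINT y:{c..c + X}. two_periods X f y) = (LBINT y:{0..X}. f y)"
proof -
  let ?g = "two_periods X f"
  \<comment> \<open>At \<open>x = 0\<close> the extension takes the value \<open>f X\<close>, which
    may differ from \<open>f 0\<close>, since \<open>f\<close> is not assumed periodic; the identity
    holds only off this point.\<close>
  have AE: "AE x in lborel. x \<in> {0..c} \<longrightarrow> ?g (x + X) = f x" for c
    using AE_lborel_singleton[of 0] by eventually_elim (auto simp: two_periods_def)
  have "set_integrable lborel {0..X} (\<lambda>x. ?g (x + X)) \<longleftrightarrow> set_integrable lborel {0..X} f"
    by (rule set_integrable_cong_AE) (use AE in auto)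
  then have 1: "set_integrable lborel {0 + X..X + X} ?g" using f set_integrable_Icc_shift by blast
  have 2: "set_integrable lborel {0..X} ?g"
    using f by (subst set_integrable_cong[where f'=f]) (auto simp: two_periods_def)
  have "set_integrable lborel ({0..X} \<union> {0 + X..X + X}) ?g"
    by (rule set_integrable_Un) (use 1 2 in auto)
  also have "{0..X} \<union> {0 + X..X + X} = {0..2 * X}" using \<open>0 < X\<close> by auto
  finally show i: "set_integrable lborel {0..2 * X} ?g" .
  show l: "(LBINT y:{0..x}. ?g y) = (LBINT y:{0..x}. f y)" if "x \<le> X" for x
    by (rule set_lebesgue_integral_cong) (use that in \<open>auto simp: two_periods_def\<close>)
  have r: "(LBINT y:{X..X + c}. ?g y) = (LBINT y:{0..c}. f y)" for c
  proof -
    have "(LBINT y:{0 + X..c + X}. ?g y) = (LBINT y:{0..c}. ?g (y + X))" by (rule LBINT_Icc_shift)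
    also have "\<dots> = (LBINT y:{0..c}. f y)"
      by (rule set_lebesgue_integral_cong_AE) (use AE in auto)
    finally show ?thesis by (simp add: add.commute)
  qed
  then show "(LBINT y:{X..X + c}. ?g y) = (LBINT y:{0..c}. f y)" .
  show "(LBINT y:{c..c + X}. ?g y) = (LBINT y:{0..X}. f y)" if c: "c \<in> {0..X}"
  proof -
    have "(LBINT y:{0..X + c}. ?g y) = (LBINT y:{0..X}. ?g y) + (LBINT y:{X..X + c}. ?g y)"
      by (rule LBINT_Icc_combine[OF set_integrable_Icc_subset[OF i]]) (use c in auto)
    moreover have "(LBINT y:{0..X + c}. ?g y) = (LBINT y:{0..c}. ?g y) + (LBINT y:{c..X + c}. ?g y)"
      by (rule LBINT_Icc_combine[OF set_integrable_Icc_subset[OF i]]) (use c in auto)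
    ultimately show ?thesis using l[of X] l[of c] r[of c] c by (simp add: add.commute)
  qed
qed

text \<open>Periodicity of \<open>u\<close> makes the integral of \<open>v\<close> over one period
  zero, so the second copy of \<open>v\<close> starts again from \<open>u 0\<close> and reproduces
  the first period.\<close>

lemma primitive_on_two_periods:
  assumes v: "has_L2_derivative X u v" and per: "\<And>x. u (x + X) = u x" and "0 < X"
  shows "primitive_on 0 (2 * X) u (two_periods X v)"
  unfolding primitive_on_def
proof (intro conjI ballI)
  have m: "v \<in> borel_measurable borel" using has_L2_derivative_measurable[OF v] .
  note p = has_L2_derivative_primitive[OF v]
  note T = LBINT_two_periods[OF has_L2_derivative_integrable[OF v] m \<open>0 < X\<close>]
  show "set_integrable lborel {0..2 * X} (two_periods X v)" by (rule T)
  fix x assume x: "x \<in> {0..2 * X}"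
  show "u x = u 0 + (LBINT y:{0..x}. two_periods X v y)"
  proof (cases "x \<le> X")
    case True
    then show ?thesis using T(2)[of x] primitive_onD[OF p, of x] x by simp
  next
    case False
    have "(LBINT y:{0..x}. two_periods X v y) =
        (LBINT y:{0..X}. two_periods X v y) + (LBINT y:{X..x}. two_periods X v y)"
      by (rule LBINT_Icc_combine[OF set_integrable_Icc_subset[OF T(1)]]) (use False x \<open>0 < X\<close> in auto)
    also have "(LBINT y:{0..X}. two_periods X v y) = 0"
      using T(2)[of X] primitive_onD[OF p, of X] per[of 0] \<open>0 < X\<close> by simp
    also have "(LBINT y:{X..x}. two_periods X v y) = (LBINT y:{0..x - X}. v y)"
      using T(3)[of "x - X"] False x by simp
    finally show ?thesis using primitive_onD[OF p, of "x - X"] per[of "x - X"] False x by simp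
  qed
qed

text \<open>Both half periods are lossless: the sine comparison on each has frequency
  \<open>2 * pi / X\<close>, and the shift by \<alpha> even adds a term
  \<open>\<alpha> ^ 2 * X\<close> on the right side. In the case of equality this surplus must
  vanish, each half carries a sine arch, and the zero mean matches the two amplitudes.\<close>

lemma
  assumes u: "u \<in> H1_zero_mean X" and v: "has_L2_derivative X u v" and "0 < X"
  shows wirtinger_inequality:
      "(2 * pi / X)\<^sup>2 * (LBINT x:{0..X}. (u x)\<^sup>2) \<le> (LBINT x:{0..X}. (v x)\<^sup>2)" (is ?le)
    and wirtinger_equality:
      "(LBINT x:{0..X}. (v x)\<^sup>2) \<le> (2 * pi / X)\<^sup>2 * (LBINT x:{0..X}. (u x)\<^sup>2) \<Longrightarrow>
        \<exists>a b. u = (\<lambda>x. a * sin (2 * pi * x / X) + b * cos (2 * pi * x / X))" (is "?eq \<Longrightarrow> ?sc")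
proof -
  define L where "L = X / 2"
  define k where "k = 2 * pi / X"
  define v' where "v' = two_periods X v"
  have L: "L > 0" "X = 2 * L" and kL: "k = pi / L" "k * L = pi" using \<open>0 < X\<close> by (auto simp: L_def k_def)
  have uH: "u \<in> H1 X" and mean: "(LBINT x:{0..X}. u x) = 0" using u by (auto simp: H1_zero_mean_def)
  note per = H1_periodic[OF uH]
  have m: "v \<in> borel_measurable borel" using has_L2_derivative_measurable[OF v] .
  have pu: "primitive_on 0 (2 * X) u v'"
    unfolding v'_def by (rule primitive_on_two_periods[OF v per \<open>0 < X\<close>])
  have cu: "continuous_on {0..2 * X} u" by (rule primitive_on_continuous[OF pu])
  have sq: "(\<lambda>x. (v' x)\<^sup>2) = two_periods X (\<lambda>x. (v x)\<^sup>2)"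
    by (auto simp: v'_def two_periods_def fun_eq_iff)
  have m2: "(\<lambda>x. (v x)\<^sup>2) \<in> borel_measurable borel" using m by measurable
  note T = LBINT_two_periods[OF has_L2_derivative_square_integrable[OF v] m2 \<open>0 < X\<close>, folded sq]
  have "\<exists>c. 0 \<le> c \<and> c \<le> L \<and> u c = u (c + L)"
  proof -
    \<comment> \<open>Periodicity gives \<open>d L = - d 0\<close>, so the increment over half a
      period changes sign and has a zero.\<close>
    define d where "d x = u (x + L) - u x" for x
    have cd: "continuous_on {0..L} d"
      unfolding d_def
      by (intro continuous_intros continuous_on_compose2[OF cu]) (use L in auto)
    have "d L = - d 0" using per[of 0] L by (simp add: d_def)
    then have "\<exists>x\<ge>0. x \<le> L \<and> d x = 0"
      using IVT'[of d 0 0 L] IVT2'[of d L 0 0] cd L by (cases "d 0 \<le> 0") auto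
    then show ?thesis by (auto simp: d_def)
  qed
  then obtain c where c: "0 \<le> c" "c \<le> L" and uc: "u c = u (c + L)" by blast
  define \<alpha> where "\<alpha> = u c"
  define w where "w x = u x + (- \<alpha>)" for x
  have pw: "primitive_on 0 (2 * X) w v'"
    using primitive_on_add[OF pu primitive_on_const[of _ _ "- \<alpha>"]] unfolding w_def by simp
  have uX: "u (c + L + L) = u c" using per[of c] L by (simp add: add.assoc)
  interpret A: vanishing_at_ends c L k w v'
  proof
    show "primitive_on c (c + L) w v'" by (rule primitive_on_subset[OF pw]) (use c L in auto)
    show "set_integrable lborel {c..c + L} (\<lambda>x. (v' x)\<^sup>2)"
      by (rule set_integrable_Icc_subset[OF T(1)]) (use c L in auto)
  qed (use L kL uc in \<open>auto simp: w_def \<alpha>_def\<close>)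
  interpret B: vanishing_at_ends "c + L" L k w v'
  proof
    show "primitive_on (c + L) (c + L + L) w v'" by (rule primitive_on_subset[OF pw]) (use c L in auto)
    show "set_integrable lborel {c + L..c + L + L} (\<lambda>x. (v' x)\<^sup>2)"
      by (rule set_integrable_Icc_subset[OF T(1)]) (use c L in auto)
  qed (use L kL uc uX in \<open>auto simp: w_def \<alpha>_def\<close>)
  have period: "(LBINT x:{c..c + L}. f x) + (LBINT x:{c + L..c + L + L}. f x) = (LBINT x:{c..c + X}. f x)"
    if "set_integrable lborel {0..2 * X} f" for f :: "real \<Rightarrow> real"
    using LBINT_Icc_combine[OF set_integrable_Icc_subset[OF that, of c "c + X"], of "c + L"] c L
    by (simp add: add.assoc)
  have v_eq: "(LBINT x:{c..c + L}. (v' x)\<^sup>2) + (LBINT x:{c + L..c + L + L}. (v' x)\<^sup>2) = (LBINT x:{0..X}. (v x)\<^sup>2)"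
    using period[OF T(1)] T(4)[of c] c L by simp
  have u_per: "(LBINT x:{c..c + X}. f (u x)) = (LBINT x:{0..X}. f (u x))"
    if cf: "continuous_on UNIV f" for f :: "real \<Rightarrow> real"
  proof -
    have cfu: "continuous_on {0..2 * X} (\<lambda>x. f (u x))"
      by (rule continuous_on_compose2[OF cf cu]) auto
    \<comment> \<open>The indicator makes the integrand Borel measurable on the whole line;
      continuity of \<open>u\<close> has been established only on two periods.\<close>
    have "(LBINT x:{c..c + X}. f (u x)) = (LBINT x:{c..c + X}. two_periods X (\<lambda>x. indicator {0..X} x * f (u x)) x)"
    proof (rule set_lebesgue_integral_cong, simp, intro allI impI)
      fix x assume "x \<in> {c..c + X}"
      then show "f (u x) = two_periods X (\<lambda>x. indicator {0..X} x * f (u x)) x"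
        using per[of "x - X"] c L by (auto simp: two_periods_def)
    qed
    also have "\<dots> = (LBINT x:{0..X}. indicator {0..X} x * f (u x))"
    proof (rule LBINT_two_periods(4)[OF _ _ \<open>0 < X\<close>])
      have i: "set_integrable lborel {0..X} (\<lambda>x. f (u x))"
        by (intro borel_integrable_atLeastAtMost' continuous_on_subset[OF cfu]) (use L in auto)
      then show "(\<lambda>x. indicator {0..X} x * f (u x)) \<in> borel_measurable borel"
        unfolding set_integrable_def using borel_measurable_integrable by fastforce
      show "set_integrable lborel {0..X} (\<lambda>x. indicator {0..X} x * f (u x))"
        using i by (subst set_integrable_cong[where f'="\<lambda>x. f (u x)"]) auto
    qed (use c L in auto)
    also have "\<dots> = (LBINT x:{0..X}. f (u x))"
      by (rule set_lebesgue_integral_cong) auto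
    finally show ?thesis .
  qed
  have iu: "set_integrable lborel {0..X} (\<lambda>x. u x)" "set_integrable lborel {0..X} (\<lambda>x. (u x)\<^sup>2)"
    by (intro borel_integrable_atLeastAtMost' continuous_intros continuous_on_subset[OF cu]; use L in auto)+
  have "(LBINT x:{c..c + L}. (w x)\<^sup>2) + (LBINT x:{c + L..c + L + L}. (w x)\<^sup>2) = (LBINT x:{c..c + X}. (u x + (- \<alpha>))\<^sup>2)"
    unfolding w_def
    by (rule period) (intro borel_integrable_atLeastAtMost' continuous_intros cu)
  also have "\<dots> = (LBINT x:{0..X}. (u x + (- \<alpha>))\<^sup>2)"
    by (rule u_per[of "\<lambda>y. (y + (- \<alpha>))\<^sup>2"]) (intro continuous_intros)
  also have "\<dots> = (LBINT x:{0..X}. (u x)\<^sup>2 - 2 * \<alpha> * u x + \<alpha>\<^sup>2)"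
    by (simp add: power2_eq_square algebra_simps)
  \<comment> \<open>The cross term \<open>- 2 * \<alpha> * u\<close> integrates to zero because
    \<open>u\<close> has zero mean.\<close>
  also have "\<dots> = (LBINT x:{0..X}. (u x)\<^sup>2) + \<alpha>\<^sup>2 * X"
    using iu mean borel_integrable_atLeastAtMost'[of 0 X "\<lambda>x. \<alpha>\<^sup>2"] L by (simp add: LBINT_const)
  finally have w_eq: "(LBINT x:{c..c + L}. (w x)\<^sup>2) + (LBINT x:{c + L..c + L + L}. (w x)\<^sup>2) =
      (LBINT x:{0..X}. (u x)\<^sup>2) + \<alpha>\<^sup>2 * X" .
  have sum_le: "k\<^sup>2 * (LBINT x:{0..X}. (u x)\<^sup>2) + k\<^sup>2 * \<alpha>\<^sup>2 * X \<le> (LBINT x:{0..X}. (v x)\<^sup>2)"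
    using add_mono[OF A.wirtinger_le B.wirtinger_le] v_eq w_eq
    by (simp add: distrib_left[symmetric] mult.assoc)
  moreover have "0 \<le> k\<^sup>2 * \<alpha>\<^sup>2 * X" using L by simp
  ultimately show ?le unfolding k_def[symmetric] by linarith
  assume ?eq
  then have eq: "(LBINT x:{0..X}. (v x)\<^sup>2) \<le> k\<^sup>2 * (LBINT x:{0..X}. (u x)\<^sup>2)" by (simp add: k_def)
  with sum_le have "k\<^sup>2 * \<alpha>\<^sup>2 * X \<le> 0" by linarith
  then have \<alpha>: "\<alpha> = 0" using L A.k_pos by (simp add: mult_le_0_iff not_le)
  have wsum: "k\<^sup>2 * (LBINT x:{c..c + L}. (w x)\<^sup>2) + k\<^sup>2 * (LBINT x:{c + L..c + L + L}. (w x)\<^sup>2) =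
      k\<^sup>2 * (LBINT x:{0..X}. (u x)\<^sup>2)"
    using w_eq \<alpha> by (simp add: distrib_left[symmetric])
  \<comment> \<open>The two half-period inequalities add up to an equality, so each of them is an
    equality.\<close>
  obtain C where C: "\<And>x. x \<in> {c..c + L} \<Longrightarrow> u x = C * sin (k * (x - c))"
    using A.wirtinger_eq B.wirtinger_le v_eq wsum eq \<alpha> unfolding w_def by fastforce
  obtain D where D': "\<And>x. x \<in> {c + L..c + L + L} \<Longrightarrow> u x = D * sin (k * (x - (c + L)))"
    using B.wirtinger_eq A.wirtinger_le v_eq wsum eq \<alpha> unfolding w_def by fastforce
  have D: "u x = - D * sin (k * (x - c))" if "x \<in> {c + L..c + L + L}" for x
  proof -
    \<comment> \<open>Half a period is a phase of \<open>pi\<close>; the sign it produces allows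
      both arches to be written with the same sine.\<close>
    have e: "k * (x - (c + L)) = k * (x - c) - pi" using kL(2) by (simp add: algebra_simps)
    show ?thesis unfolding D'[OF that] e by (simp add: sin_diff)
  qed
  have half: "(LBINT x:{p..p + L}. sin (k * (x - c))) = (cos (k * (p - c)) - cos (k * (p + L - c))) / k" for p
  proof -
    have "primitive_on p (p + L) (\<lambda>x. - cos (k * (x - c)) / k) (\<lambda>x. sin (k * (x - c)))"
      by (rule primitive_on_C1) (use A.k_pos in \<open>auto intro!: derivative_eq_intros continuous_intros\<close>)
    from primitive_onD[OF this, of "p + L"] L show ?thesis by (simp add: diff_divide_distrib)
  qed
  have cosX: "cos (k * (L + L)) = 1"
  proof -
    have "k * (L + L) = 2 * pi" using kL(2) by (simp add: distrib_left)
    then show ?thesis by (simp only: cos_two_pi)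
  qed
  \<comment> \<open>So far the amplitudes of the two arches are independent. Each arch has integral
    proportional to its amplitude, and the zero mean forces the continuation of one and the same
    sine wave.\<close>
  have "0 = (LBINT x:{c..c + X}. u x)"
    using u_per[of "\<lambda>y. y"] mean by simp
  also have "\<dots> = (LBINT x:{c..c + L}. u x) + (LBINT x:{c + L..c + L + L}. u x)"
    by (rule period[symmetric]) (rule borel_integrable_atLeastAtMost'[OF cu])
  also have "(LBINT x:{c..c + L}. u x) = (LBINT x:{c..c + L}. C * sin (k * (x - c)))"
    by (rule set_lebesgue_integral_cong) (use C in auto)
  also have "(LBINT x:{c + L..c + L + L}. u x) = (LBINT x:{c + L..c + L + L}. - D * sin (k * (x - c)))"
    by (rule set_lebesgue_integral_cong) (use D in auto)
  also have "(LBINT x:{c..c + L}. C * sin (k * (x - c))) + (LBINT x:{c + L..c + L + L}. - D * sin (k * (x - c)))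
      = (2 * C + 2 * D) / k"
    unfolding set_integral_mult_right half using kL(2) cosX by (simp add: diff_divide_distrib add_divide_distrib algebra_simps)
  finally have "D = - C" using A.k_pos by simp
  then have uC: "u x = C * sin (k * (x - c))" if "x \<in> {c..c + X}" for x
    using C[of x] D[of x] that L by (cases "x \<le> c + L") auto
  have "u x = C * sin (k * (x - c))" for x
  proof -
    obtain n :: int where n: "x + of_int n * X \<in> {c..c + X}"
      using periodic_representative[OF \<open>0 < X\<close>] by blast
    have "u x = u (x + of_int n * X)" by (rule periodic_int_shift[symmetric]) (rule per)
    also have "\<dots> = C * sin (k * (x + of_int n * X - c))" by (rule uC[OF n])
    also have "k * (x + of_int n * X - c) = k * (x - c) + of_int n * (2 * pi)"
      using \<open>0 < X\<close> by (simp add: k_def field_simps)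
    also have "sin \<dots> = sin (k * (x - c))"
      by (rule periodic_int_shift) simp
    finally show ?thesis .
  qed
  moreover have "C * sin (k * (x - c)) =
      (C * cos (k * c)) * sin (2 * pi * x / X) + (- C * sin (k * c)) * cos (2 * pi * x / X)" for x
  proof -
    have "2 * pi * x / X = k * x" by (simp add: k_def)
    then show ?thesis by (simp only: right_diff_distrib sin_diff) (simp add: algebra_simps)
  qed
  ultimately have "u = (\<lambda>x. (C * cos (k * c)) * sin (2 * pi * x / X) + (- C * sin (k * c)) * cos (2 * pi * x / X))"
    by (simp only: fun_eq_iff) blast
  then show ?sc by blast
qed

section \<open>Norms and pointwise bounds\<close>

lemma H1_zero_mean_H1: "u \<in> H1_zero_mean X \<Longrightarrow> u \<in> H1 X"
  by (simp add: H1_zero_mean_def)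

lemma H1_power_integrable: "u \<in> H1 X \<Longrightarrow> set_integrable lborel {0..X} (\<lambda>x. (u x) ^ n)"
  by (intro borel_integrable_atLeastAtMost' continuous_on_power H1_continuous_Icc)

lemma LBINT_power_pos:
  assumes "u \<in> H1 X" "u \<noteq> (\<lambda>x. 0)" "0 < X" "even n"
  shows "0 < (LBINT x:{0..X}. (u x) ^ n)"
proof -
  have c: "continuous_on {0..X} (\<lambda>x. (u x) ^ n)"
    by (intro continuous_on_power H1_continuous_Icc assms)
  have "(LBINT x:{0..X}. (u x) ^ n) \<noteq> 0"
  proof
    assume "(LBINT x:{0..X}. (u x) ^ n) = 0"
    then have "integral {0..X} (\<lambda>x. (u x) ^ n) = 0"
      using LBINT_eq_integral[OF H1_power_integrable[OF assms(1)]] by simp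
    then have "\<forall>x\<in>{0..X}. (u x) ^ n = 0"
      by (subst (asm) integral_eq_0_iff[OF c \<open>0 < X\<close>]) (use assms(4) in \<open>auto intro: zero_le_even_power\<close>)
    then have z: "u x = 0" if "x \<in> {0..X}" for x
      using that power_eq_0_iff by blast
    have "u x = 0" for x
    proof -
      obtain n :: int where "x + of_int n * X \<in> {0..0 + X}"
        using periodic_representative[OF \<open>0 < X\<close>] by blast
      then show ?thesis
        using z[of "x + of_int n * X"] periodic_int_shift[of u X x n] H1_periodic[OF assms(1)] by simp
    qed
    then show False using assms(2) by auto
  qed
  moreover have "0 \<le> (LBINT x:{0..X}. (u x) ^ n)"
    by (intro LBINT_nonneg zero_le_even_power assms)
  ultimately show ?thesis by simp
qed

lemma H1_norm_eq:
  assumes "has_L2_derivative X u v" "0 < X"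
  shows "H1_norm X u = sqrt ((LBINT x:{0..X}. (u x)\<^sup>2) + (LBINT x:{0..X}. (v x)\<^sup>2))"
  unfolding H1_norm_def LBINT_H1_deriv[OF assms] ..

lemma H1_norm_square:
  assumes "has_L2_derivative X u v" "0 < X"
  shows "(H1_norm X u)\<^sup>2 = (LBINT x:{0..X}. (u x)\<^sup>2) + (LBINT x:{0..X}. (v x)\<^sup>2)"
  unfolding H1_norm_eq[OF assms] by (simp add: LBINT_nonneg)

text \<open>A continuous function with zero mean vanishes somewhere. Integrating the derivative from
  that zero to the given point and applying Cauchy-Schwarz gives the bound.\<close>

lemma zero_mean_sup_bound:
  assumes u: "u \<in> H1_zero_mean X" and v: "has_L2_derivative X u v" and "0 < X"
  shows "(u x)\<^sup>2 \<le> X * (LBINT x:{0..X}. (v x)\<^sup>2)"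
proof -
  note p = has_L2_derivative_primitive[OF v]
  note cu = primitive_on_continuous[OF p]
  have "\<exists>z\<in>{0..X}. u z = 0"
  proof (rule ccontr)
    assume nz: "\<not> (\<exists>z\<in>{0..X}. u z = 0)"
    have "(\<forall>z\<in>{0..X}. 0 < u z) \<or> (\<forall>z\<in>{0..X}. u z < 0)"
    proof (rule ccontr)
      assume "\<not> ?thesis"
      then obtain y z where yz: "y \<in> {0..X}" "u y \<le> 0" "z \<in> {0..X}" "0 \<le> u z" by fastforce
      then have "0 \<in> u ` {0..X}"
        using connectedD_interval[OF connected_continuous_image[OF cu]] by (meson atLeastAtMost_iff connected_Icc image_eqI)
      then show False using nz by auto
    qed
    \<comment> \<open>The factor \<open>s\<close>, used with 1 and -1, treats positive and negative
      functions at once: a continuous function of one sign with integral zero is zero.\<close>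
    moreover have "u 0 = 0" if s: "s \<noteq> 0" "\<forall>z\<in>{0..X}. 0 \<le> s * u z" for s :: real
    proof -
      have c: "continuous_on {0..X} (\<lambda>x. s * u x)" by (intro continuous_intros cu)
      have "(LBINT x:{0..X}. s * u x) = 0"
        using u by (simp add: H1_zero_mean_def)
      then have "integral {0..X} (\<lambda>x. s * u x) = 0"
        unfolding LBINT_eq_integral[OF borel_integrable_atLeastAtMost'[OF c]] .
      then have "\<forall>x\<in>{0..X}. s * u x = 0" using integral_eq_0_iff[OF c \<open>0 < X\<close>] s by blast
      then have "s * u 0 = 0" by (rule bspec) (use \<open>0 < X\<close> in simp)
      then show ?thesis using s(1) by simp
    qed
    from this[of 1] this[of "-1"] have "(\<forall>z\<in>{0..X}. 0 < u z) \<or> (\<forall>z\<in>{0..X}. u z < 0) \<Longrightarrow> u 0 = 0"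
      by fastforce
    ultimately show False using nz \<open>0 < X\<close> by auto
  qed
  then obtain z where z: "z \<in> {0..X}" "u z = 0" by blast
  have on: "(u y)\<^sup>2 \<le> X * (LBINT x:{0..X}. (v x)\<^sup>2)" if y: "y \<in> {0..X}" for y
  proof -
    define c where "c = min y z"
    define d where "d = max y z"
    have cd: "0 \<le> c" "c \<le> d" "d \<le> X" using y z by (auto simp: c_def d_def)
    have "(LBINT x:{c..d}. v x) = u d - u c" using primitive_on_eq[OF p cd] by simp
    then have "(u y)\<^sup>2 = (LBINT x:{c..d}. v x)\<^sup>2"
      using z(2) by (auto simp: c_def d_def min_def max_def)
    also have "\<dots> \<le> (d - c) * (LBINT x:{c..d}. (v x)\<^sup>2)"
      using cd by (intro LBINT_square_le set_integrable_Icc_subset[OF primitive_on_integrable[OF p]]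
        set_integrable_Icc_subset[OF has_L2_derivative_square_integrable[OF v]])
    also have "\<dots> \<le> X * (LBINT x:{0..X}. (v x)\<^sup>2)"
    proof (intro mult_mono)
      have "(LBINT x:{0..X}. (v x)\<^sup>2) = (LBINT x:{0..c}. (v x)\<^sup>2) + (LBINT x:{c..X}. (v x)\<^sup>2)"
        using cd by (intro LBINT_Icc_combine has_L2_derivative_square_integrable[OF v]) auto
      moreover have "(LBINT x:{c..X}. (v x)\<^sup>2) = (LBINT x:{c..d}. (v x)\<^sup>2) + (LBINT x:{d..X}. (v x)\<^sup>2)"
        using cd by (intro LBINT_Icc_combine
          set_integrable_Icc_subset[OF has_L2_derivative_square_integrable[OF v]]) auto
      moreover have "0 \<le> (LBINT x:{0..c}. (v x)\<^sup>2)" "0 \<le> (LBINT x:{d..X}. (v x)\<^sup>2)"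
        by (rule LBINT_nonneg; simp)+
      ultimately show "(LBINT x:{c..d}. (v x)\<^sup>2) \<le> (LBINT x:{0..X}. (v x)\<^sup>2)" by linarith
    qed (use cd \<open>0 < X\<close> in \<open>auto intro: LBINT_nonneg\<close>)
    finally show ?thesis .
  qed
  obtain n :: int where "x + of_int n * X \<in> {0..0 + X}"
    using periodic_representative[OF \<open>0 < X\<close>] by blast
  then show ?thesis
    using on[of "x + of_int n * X"] periodic_int_shift[of u X x n] H1_periodic[OF H1_zero_mean_H1[OF u]] by simp
qed

text \<open>The embedding that converts smallness in \<open>H1_norm\<close> into the pointwise
  smallness required for positivity of \<open>hbar + u\<close> and for Taylor expansion.\<close>

lemma zero_mean_sup_le_H1_norm:
  assumes u: "u \<in> H1_zero_mean X" and "0 < X"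
  shows "\<bar>u x\<bar> \<le> sqrt X * H1_norm X u"
proof -
  note v = H1_deriv_has_L2_derivative[OF H1_zero_mean_H1[OF u]]
  have "(u x)\<^sup>2 \<le> X * (H1_norm X u)\<^sup>2"
    unfolding H1_norm_square[OF v \<open>0 < X\<close>]
    using zero_mean_sup_bound[OF u v \<open>0 < X\<close>, of x] LBINT_nonneg[of "{0..X}" "\<lambda>x. (u x)\<^sup>2"] \<open>0 < X\<close>
    by (simp add: distrib_left add_increasing)
  also have "\<dots> = (sqrt X * H1_norm X u)\<^sup>2" using \<open>0 < X\<close> by (simp add: power_mult_distrib)
  finally show ?thesis
    using abs_le_square_iff[of "u x" "sqrt X * H1_norm X u"] \<open>0 < X\<close>
    by (simp add: H1_norm_def LBINT_nonneg abs_mult)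
qed

section \<open>The first Fourier mode and the eigenvalue \<open>tau1\<close>\<close>

lemma LBINT_periodic_derivative:
  assumes "\<And>x. (F has_real_derivative f x) (at x)" "continuous_on UNIV f" "F X = F 0" "0 < X"
  shows "(LBINT x:{0..X}. f x) = 0"
proof -
  have "primitive_on 0 X F f"
    by (rule primitive_on_C1) (use assms in \<open>auto intro: DERIV_subset continuous_on_subset\<close>)
  from primitive_onD[OF this, of X] assms show ?thesis by simp
qed

definition first_mode :: "real \<Rightarrow> real \<Rightarrow> real \<Rightarrow> real \<Rightarrow> real" where
  "first_mode X a b x = a * sin (2 * pi / X * x) + b * cos (2 * pi / X * x)"

definition first_mode_deriv :: "real \<Rightarrow> real \<Rightarrow> real \<Rightarrow> real \<Rightarrow> real" where
  "first_mode_deriv X a b x = (2 * pi / X) * (a * cos (2 * pi / X * x) - b * sin (2 * pi / X * x))"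

lemma first_mode_has_derivative:
  "(first_mode X a b has_real_derivative first_mode_deriv X a b x) (at x)"
proof -
  define k where "k = 2 * pi / X"
  show ?thesis
    unfolding first_mode_def first_mode_deriv_def k_def[symmetric]
    by (auto intro!: derivative_eq_intros simp: algebra_simps)
qed

lemma first_mode_deriv_has_derivative:
  "(first_mode_deriv X a b has_real_derivative - (2 * pi / X)\<^sup>2 * first_mode X a b x) (at x)"
proof -
  define k where "k = 2 * pi / X"
  show ?thesis
    unfolding first_mode_def first_mode_deriv_def k_def[symmetric]
    by (auto intro!: derivative_eq_intros simp: algebra_simps power2_eq_square)
qed

lemma continuous_first_mode:
  "continuous_on S (first_mode X a b)" "continuous_on S (first_mode_deriv X a b)"
  unfolding first_mode_def first_mode_deriv_def by (intro continuous_intros)+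

lemma first_mode_has_L2_derivative:
  "has_L2_derivative X (first_mode X a b) (first_mode_deriv X a b)"
  by (rule has_L2_derivative_C1) (rule first_mode_has_derivative continuous_first_mode)+

lemma first_mode_X:
  "0 < X \<Longrightarrow> first_mode X a b X = first_mode X a b 0"
  "0 < X \<Longrightarrow> first_mode_deriv X a b X = first_mode_deriv X a b 0"
  by (simp_all add: first_mode_def first_mode_deriv_def)

lemma first_mode_zero_mean:
  assumes "0 < X"
  shows "first_mode X a b \<in> H1_zero_mean X"
proof -
  have "first_mode X a b (x + X) = first_mode X a b x" for x
  proof -
    have e: "2 * pi / X * (x + X) = 2 * pi / X * x + 2 * pi" using assms by (simp add: field_simps)
    show ?thesis unfolding first_mode_def e by simp
  qed
  \<comment> \<open>The integrand is the second derivative of the mode, so its integral over a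
    period is zero; the nonzero factor is then cancelled.\<close>
  moreover have "(LBINT x:{0..X}. - (2 * pi / X)\<^sup>2 * first_mode X a b x) = 0"
    by (rule LBINT_periodic_derivative[OF first_mode_deriv_has_derivative])
       (auto intro!: continuous_intros continuous_first_mode first_mode_X assms)
  then have "(LBINT x:{0..X}. first_mode X a b x) = 0"
    unfolding set_integral_mult_right using assms by simp
  ultimately show ?thesis
    unfolding H1_zero_mean_def H1_def using first_mode_has_L2_derivative by blast
qed

text \<open>The difference of the two integrands is the derivative of the periodic function
  \<open>u * u'\<close>.\<close>

lemma first_mode_square:
  assumes "0 < X"
  shows "(LBINT x:{0..X}. (first_mode_deriv X a b x)\<^sup>2) =
    (2 * pi / X)\<^sup>2 * (LBINT x:{0..X}. (first_mode X a b x)\<^sup>2)"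
proof -
  let ?u = "first_mode X a b" and ?v = "first_mode_deriv X a b" and ?k = "2 * pi / X"
  have "(LBINT x:{0..X}. (?v x)\<^sup>2 - ?k\<^sup>2 * (?u x)\<^sup>2) = 0"
  proof (rule LBINT_periodic_derivative)
    show "((\<lambda>x. ?u x * ?v x) has_real_derivative (?v x)\<^sup>2 - ?k\<^sup>2 * (?u x)\<^sup>2) (at x)" for x
      by (rule derivative_eq_intros first_mode_has_derivative first_mode_deriv_has_derivative)+
         (simp add: power2_eq_square algebra_simps)
  qed (auto intro!: continuous_intros continuous_first_mode simp: first_mode_X assms)
  moreover have "set_integrable lborel {0..X} (\<lambda>x. (?v x)\<^sup>2)" "set_integrable lborel {0..X} (\<lambda>x. (?u x)\<^sup>2)"
    by (intro borel_integrable_atLeastAtMost' continuous_intros continuous_first_mode)+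
  ultimately show ?thesis by simp
qed

text \<open>Since \<open>(u')\<^sup>2 + k\<^sup>2 u\<^sup>2\<close> is constant and \<open>u'' = - k\<^sup>2 u\<close>, the cube of the first mode is a
  combination of the derivatives of \<open>u'\<close> and \<open>(u') ^ 3\<close>.\<close>

lemma first_mode_cube:
  assumes "0 < X"
  shows "(LBINT x:{0..X}. (first_mode X a b x) ^ 3) = 0"
proof -
  let ?u = "first_mode X a b" and ?v = "first_mode_deriv X a b"
  define k where "k = 2 * pi / X"
  have k: "k \<noteq> 0" using assms by (simp add: k_def)
  define c where "c = a\<^sup>2 + b\<^sup>2"
  have energy: "(?v x)\<^sup>2 = k\<^sup>2 * (c - (?u x)\<^sup>2)" for x
  proof -
    define S where "S = sin (k * x)"
    define C where "C = cos (k * x)"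
    have "(?v x)\<^sup>2 = k\<^sup>2 * (c * (S\<^sup>2 + C\<^sup>2) - (?u x)\<^sup>2)"
      unfolding first_mode_def first_mode_deriv_def k_def[symmetric] c_def S_def[symmetric] C_def[symmetric]
      by (simp add: power2_eq_square algebra_simps)
    moreover have "S\<^sup>2 + C\<^sup>2 = 1" unfolding S_def C_def by (rule sin_cos_squared_add)
    ultimately show ?thesis by simp
  qed
  show ?thesis
  proof (rule LBINT_periodic_derivative)
    fix x
    \<comment> \<open>The first summand contributes \<open>c * u\<close>. Replacing
      \<open>(u') ^ 2\<close> by \<open>k ^ 2 * (c - u ^ 2)\<close>, the second contributes
      \<open>u ^ 3 - c * u\<close>, which explains the coefficients.\<close>
    have "((\<lambda>x. - (c / k\<^sup>2) * ?v x + (1 / (3 * k ^ 4)) * (?v x) ^ 3) has_real_derivative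
        - (c / k\<^sup>2) * (- k\<^sup>2 * ?u x) + (1 / (3 * k ^ 4)) * (3 * (?v x)\<^sup>2 * (- k\<^sup>2 * ?u x))) (at x)"
      using first_mode_deriv_has_derivative[of X a b x, folded k_def]
      by (intro DERIV_add DERIV_cmult) (auto intro!: derivative_eq_intros)
    also have "- (c / k\<^sup>2) * (- k\<^sup>2 * ?u x) + (1 / (3 * k ^ 4)) * (3 * (?v x)\<^sup>2 * (- k\<^sup>2 * ?u x)) = (?u x) ^ 3"
      unfolding energy using k by (simp add: field_simps power2_eq_square power3_eq_cube power4_eq_xxxx)
    finally show "((\<lambda>x. - (c / k\<^sup>2) * ?v x + (1 / (3 * k ^ 4)) * (?v x) ^ 3) has_real_derivative (?u x) ^ 3) (at x)" .
  qed (auto intro!: continuous_intros continuous_first_mode simp: first_mode_X assms)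
qed

lemma first_mode_nonzero:
  assumes "0 < X" "a \<noteq> 0 \<or> b \<noteq> 0"
  shows "first_mode X a b \<noteq> (\<lambda>x. 0)"
proof
  assume z: "first_mode X a b = (\<lambda>x. 0)"
  have "first_mode X a b 0 = b" "first_mode X a b (X / 4) = a"
    using assms(1) by (simp_all add: first_mode_def)
  then show False using z assms(2) by auto
qed

text \<open>At a constant state the term with \<open>r\<close> merely shifts the Rayleigh quotient
  by \<open>- r hbar\<close>, so the value and the minimizers are those of Wirtinger's
  inequality.\<close>

lemma
  fixes r :: "real \<Rightarrow> real" and hbar X :: real
  assumes "0 < X"
  shows tau1_constant: "tau1 r X (\<lambda>x. hbar) = (2 * pi / X)\<^sup>2 - r hbar"
    and tau1_eigenspace_constant: "tau1_eigenspace r X (\<lambda>x. hbar) = {u. \<exists>a b. u = first_mode X a b}"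
proof -
  let ?R = "rayleigh r X (\<lambda>x. hbar)" and ?S = "H1_zero_mean X - {\<lambda>x. 0}"
  let ?k = "2 * pi / X"
  have R: "?R u = (LBINT x:{0..X}. (v x)\<^sup>2) / (LBINT x:{0..X}. (u x)\<^sup>2) - r hbar"
    if "u \<in> ?S" "has_L2_derivative X u v" for u v
  proof -
    have "u \<in> H1 X" using that by (auto intro: H1_zero_mean_H1)
    then have "(LBINT x:{0..X}. (H1_deriv X u x)\<^sup>2 - r hbar * (u x)\<^sup>2) =
        (LBINT x:{0..X}. (v x)\<^sup>2) - r hbar * (LBINT x:{0..X}. (u x)\<^sup>2)"
      using has_L2_derivative_deriv_integrable[OF that(2)] H1_power_integrable[of u X 2]
        LBINT_H1_deriv[OF that(2) \<open>0 < X\<close>] by simp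
    moreover have "0 < (LBINT x:{0..X}. (u x)\<^sup>2)"
      using LBINT_power_pos[of u X 2] \<open>u \<in> H1 X\<close> that assms by simp
    ultimately show ?thesis by (simp add: rayleigh_def diff_divide_distrib)
  qed
  have ge: "?k\<^sup>2 - r hbar \<le> ?R u"
    and eq: "?R u \<le> ?k\<^sup>2 - r hbar \<Longrightarrow> \<exists>a b. u = first_mode X a b" if u: "u \<in> ?S" for u
  proof -
    have uz: "u \<in> H1_zero_mean X" using u by simp
    note v = H1_deriv_has_L2_derivative[OF H1_zero_mean_H1[OF uz]]
    have pos: "0 < (LBINT x:{0..X}. (u x)\<^sup>2)"
      using LBINT_power_pos[of u X 2] H1_zero_mean_H1[OF uz] u assms by simp
    show "?k\<^sup>2 - r hbar \<le> ?R u"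
      unfolding R[OF u v] using wirtinger_inequality[OF uz v assms] pos by (simp add: field_simps)
    assume "?R u \<le> ?k\<^sup>2 - r hbar"
    then have "(LBINT x:{0..X}. (H1_deriv X u x)\<^sup>2) / (LBINT x:{0..X}. (u x)\<^sup>2) \<le> ?k\<^sup>2"
      unfolding R[OF u v] by simp
    then have "(LBINT x:{0..X}. (H1_deriv X u x)\<^sup>2) \<le> ?k\<^sup>2 * (LBINT x:{0..X}. (u x)\<^sup>2)"
      using pos by (simp only: pos_divide_le_eq)
    from wirtinger_equality[OF uz v assms this] show "\<exists>a b. u = first_mode X a b"
      unfolding first_mode_def times_divide_eq_left .
  qed
  have mode: "first_mode X a b \<in> ?S" "?R (first_mode X a b) = ?k\<^sup>2 - r hbar"
    if "a \<noteq> 0 \<or> b \<noteq> 0" for a b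
  proof -
    show S: "first_mode X a b \<in> ?S"
      using first_mode_zero_mean[OF assms] first_mode_nonzero[OF assms that] by simp
    have "0 < (LBINT x:{0..X}. (first_mode X a b x)\<^sup>2)"
      using LBINT_power_pos[of "first_mode X a b" X 2] S assms by (simp add: H1_zero_mean_H1)
    then show "?R (first_mode X a b) = ?k\<^sup>2 - r hbar"
      unfolding R[OF S first_mode_has_L2_derivative] first_mode_square[OF assms] by simp
  qed
  show "tau1 r X (\<lambda>x. hbar) = ?k\<^sup>2 - r hbar"
    unfolding tau1_def
  proof (rule Least_equality)
    show "?k\<^sup>2 - r hbar \<in> ?R ` ?S"
      \<comment> \<open>The sine mode attains the bound; \<open>LEAST\<close> over a set of reals
        has its meaning only because of this.\<close>
      using mode[of 1 0] by (metis image_eqI one_neq_zero)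
    show "?k\<^sup>2 - r hbar \<le> y" if "y \<in> ?R ` ?S" for y using ge that by auto
  qed
  show "tau1_eigenspace r X (\<lambda>x. hbar) = {u. \<exists>a b. u = first_mode X a b}" (is "?E = ?M")
  proof (intro set_eqI iffI)
    fix u assume "u \<in> ?E"
    then consider "u = (\<lambda>x. 0)" | "is_arg_min ?R (\<lambda>u. u \<in> ?S) u"
      unfolding tau1_eigenspace_def by blast
    then show "u \<in> ?M"
    proof cases
      case 1
      then have "u = first_mode X 0 0" by (simp add: first_mode_def fun_eq_iff)
      then show ?thesis by blast
    next
      case 2
      \<comment> \<open>The sine mode does not beat a minimizer, so the quotient of \<open>u\<close>
        is at most the lower bound and the case of equality applies.\<close>
      then have "u \<in> ?S" "?R u \<le> ?k\<^sup>2 - r hbar"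
        using mode[of 1 0] unfolding is_arg_min_def by (auto simp: not_less)
      then show ?thesis using eq by blast
    qed
  next
    fix u assume "u \<in> ?M"
    then obtain a b where u: "u = first_mode X a b" by blast
    show "u \<in> ?E"
    proof (cases "a \<noteq> 0 \<or> b \<noteq> 0")
      case True
      then have "is_arg_min ?R (\<lambda>u. u \<in> ?S) u"
        unfolding is_arg_min_def using mode[OF True] ge u by (auto simp: not_less)
      then show ?thesis by (simp add: tau1_eigenspace_def)
    next
      case False
      then have "u = (\<lambda>x. 0)" using u by (simp add: first_mode_def fun_eq_iff)
      then show ?thesis by (simp add: tau1_eigenspace_def)
    qed
  qed
qed

section \<open>Taylor estimates with Peano remainder\<close>

lemma derivative_remainder_bound:
  fixes f :: "real \<Rightarrow> real"
  assumes "(f has_real_derivative D) (at a)" "0 < \<eta>"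
  shows "\<exists>\<rho>>0. \<forall>y. \<bar>y\<bar> \<le> \<rho> \<longrightarrow> \<bar>f (a + y) - f a - D * y\<bar> \<le> \<eta> * \<bar>y\<bar>"
proof -
  obtain d where d: "d > 0" "\<And>y. norm (y - a) < d \<Longrightarrow> norm (f y - f a - D * (y - a)) \<le> \<eta> * norm (y - a)"
    using assms unfolding has_field_derivative_def has_derivative_at_alt by blast
  \<comment> \<open>Halving \<open>d\<close> turns the open neighbourhood into a closed one.\<close>
  show ?thesis
  proof (intro exI[of _ "d / 2"] conjI allI impI)
    fix y :: real assume "\<bar>y\<bar> \<le> d / 2"
    then show "\<bar>f (a + y) - f a - D * y\<bar> \<le> \<eta> * \<bar>y\<bar>" using d(2)[of "a + y"] d(1) by simp
  qed (use d in simp)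
qed

text \<open>Integrates a remainder estimate once by the mean value inequality. The factor
  \<open>1 / Suc n\<close> is given up, which is harmless because \<eta> is arbitrary; iteration
  lifts a bound on a derivative to the function itself.\<close>

lemma integrate_power_bound:
  fixes F F' :: "real \<Rightarrow> real"
  assumes d: "\<And>y. \<bar>y\<bar> \<le> \<rho> \<Longrightarrow> (F has_real_derivative F' y) (at y)"
    and b: "\<And>y. \<bar>y\<bar> \<le> \<rho> \<Longrightarrow> \<bar>F' y\<bar> \<le> \<eta> * \<bar>y\<bar> ^ n"
    and F0: "F 0 = 0" and \<eta>: "0 \<le> \<eta>" and y: "\<bar>y\<bar> \<le> \<rho>"
  shows "\<bar>F y\<bar> \<le> \<eta> * \<bar>y\<bar> ^ Suc n"
proof -
  have "norm (F y - F 0) \<le> (\<eta> * \<bar>y\<bar> ^ n) * norm (y - 0)"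
  proof (rule field_differentiable_bound)
    show "convex {- \<bar>y\<bar>..\<bar>y\<bar>}" by simp
    show "(F has_real_derivative F' z) (at z within {- \<bar>y\<bar>..\<bar>y\<bar>})" if "z \<in> {- \<bar>y\<bar>..\<bar>y\<bar>}" for z
      using that y by (intro has_field_derivative_at_within[OF d]) auto
    show "norm (F' z) \<le> \<eta> * \<bar>y\<bar> ^ n" if z: "z \<in> {- \<bar>y\<bar>..\<bar>y\<bar>}" for z
    proof -
      have "norm (F' z) \<le> \<eta> * \<bar>z\<bar> ^ n" using z y b[of z] by auto
      also have "\<dots> \<le> \<eta> * \<bar>y\<bar> ^ n"
        using z \<eta> by (intro mult_left_mono power_mono) auto
      finally show ?thesis .
    qed
  qed auto
  then show ?thesis by (simp add: F0 mult_ac)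
qed

lemma abs_LBINT_le:
  fixes f g :: "real \<Rightarrow> real"
  assumes "set_integrable lborel S f" "set_integrable lborel S g" "\<And>x. x \<in> S \<Longrightarrow> \<bar>f x\<bar> \<le> g x"
  shows "\<bar>LBINT x:S. f x\<bar> \<le> (LBINT x:S. g x)"
proof -
  have "(LBINT x:S. f x) \<le> (LBINT x:S. g x)" "(LBINT x:S. - g x) \<le> (LBINT x:S. f x)"
    by (intro set_integral_mono assms; use assms in \<open>auto simp: abs_le_iff set_integrable_def\<close>; fastforce)+
  then show ?thesis using set_integral_uminus[OF assms(2)] by simp
qed

lemma has_real_derivative_shift:
  "(f has_real_derivative D) (at (a + y)) \<Longrightarrow> ((\<lambda>y. f (a + y)) has_real_derivative D) (at y)"
  using DERIV_shift[of f D y a] by (simp add: add.commute)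

section \<open>Expansion of the energy about the constant state\<close>

locale constant_state =
  fixes H H' r :: "real \<Rightarrow> real" and hbar X :: real
  assumes H: "\<And>y. y > 0 \<Longrightarrow> (H has_real_derivative H' y) (at y)"
    and H': "\<And>y. y > 0 \<Longrightarrow> (H' has_real_derivative r y) (at y)"
    and hbar: "hbar > 0" and X: "X > 0"
begin

text \<open>The affine part of \<open>H\<close> at \<open>hbar\<close> is removed: its constant
  cancels against the energy of the constant state and its linear term integrates to zero over
  mean-zero perturbations.\<close>

definition G :: "real \<Rightarrow> real" where "G y = H (hbar + y) - H hbar - H' hbar * y"

text \<open>The numerator of the Rayleigh quotient, that is, the second variation of the energy;
  half of it is the coefficient of \<open>\<epsilon> ^ 2\<close>.\<close>

definition quad :: "(real \<Rightarrow> real) \<Rightarrow> real" where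
  "quad u = (LBINT x:{0..X}. (H1_deriv X u x)\<^sup>2) - r hbar * (LBINT x:{0..X}. (u x)\<^sup>2)"

lemma shifted_derivatives:
  assumes "\<bar>y\<bar> < hbar"
  shows "(G has_real_derivative H' (hbar + y) - H' hbar) (at y)"
    "((\<lambda>y. H' (hbar + y) - H' hbar) has_real_derivative r (hbar + y)) (at y)"
proof -
  have pos: "0 < hbar + y" using assms by simp
  show "(G has_real_derivative H' (hbar + y) - H' hbar) (at y)"
    unfolding G_def using has_real_derivative_shift[OF H[OF pos]]
    by (auto intro!: derivative_eq_intros)
  show "((\<lambda>y. H' (hbar + y) - H' hbar) has_real_derivative r (hbar + y)) (at y)"
    using has_real_derivative_shift[OF H'[OF pos]]
    by (auto intro!: derivative_eq_intros)
qed

lemma G_quadratic: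
  assumes "0 < \<eta>"
  shows "\<exists>\<rho>>0. \<rho> < hbar \<and> (\<forall>y. \<bar>y\<bar> \<le> \<rho> \<longrightarrow> \<bar>G y - r hbar / 2 * y\<^sup>2\<bar> \<le> \<eta> * y\<^sup>2)"
proof -
  obtain \<rho>0 where \<rho>0: "\<rho>0 > 0"
    "\<And>y. \<bar>y\<bar> \<le> \<rho>0 \<Longrightarrow> \<bar>H' (hbar + y) - H' hbar - r hbar * y\<bar> \<le> \<eta> * \<bar>y\<bar>"
    using derivative_remainder_bound[OF H'[OF hbar] assms] by blast
  \<comment> \<open>The bound \<open>hbar / 2\<close> keeps \<open>hbar + y\<close> inside the half
    line where \<open>H\<close> is differentiable.\<close>
  define \<rho> where "\<rho> = min \<rho>0 (hbar / 2)"
  have \<rho>: "0 < \<rho>" "\<rho> < hbar" "\<rho> \<le> \<rho>0" using \<rho>0(1) hbar by (auto simp: \<rho>_def)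
  have "\<bar>G y - r hbar / 2 * y\<^sup>2\<bar> \<le> \<eta> * \<bar>y\<bar> ^ Suc 1" if y: "\<bar>y\<bar> \<le> \<rho>" for y
  proof (rule integrate_power_bound[OF _ _ _ _ y])
    show "((\<lambda>y. G y - r hbar / 2 * y\<^sup>2) has_real_derivative H' (hbar + z) - H' hbar - r hbar * z) (at z)"
      if "\<bar>z\<bar> \<le> \<rho>" for z
      using shifted_derivatives(1)[of z] that \<rho> by (auto intro!: derivative_eq_intros)
    show "\<bar>H' (hbar + z) - H' hbar - r hbar * z\<bar> \<le> \<eta> * \<bar>z\<bar> ^ 1" if "\<bar>z\<bar> \<le> \<rho>" for z
      using \<rho>0(2)[of z] that \<rho> by simp
  qed (use assms in \<open>auto simp: G_def\<close>)
  then show ?thesis using \<rho> by (intro exI[of _ \<rho>]) (auto simp: power2_eq_square)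
qed

text \<open>Differentiability of \<open>r1\<close> at the single point \<open>hbar\<close> gives a
  first-order Peano estimate, which is integrated three times, passing through \<open>r\<close> and
  \<open>H'\<close> to \<open>G\<close>. The constant \<eta> is carried along unchanged.\<close>

lemma G_quartic:
  assumes r1: "\<And>y. y > 0 \<Longrightarrow> (r has_real_derivative r1 y) (at y)"
    and r2: "(r1 has_real_derivative r2) (at hbar)" and "0 < \<eta>"
  shows "\<exists>\<rho>>0. \<rho> < hbar \<and> (\<forall>y. \<bar>y\<bar> \<le> \<rho> \<longrightarrow>
    \<bar>G y - (r hbar / 2 * y\<^sup>2 + r1 hbar / 6 * y ^ 3 + r2 / 24 * y ^ 4)\<bar> \<le> \<eta> * y ^ 4)"
proof -
  obtain \<rho>0 where \<rho>0: "\<rho>0 > 0"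
    "\<And>y. \<bar>y\<bar> \<le> \<rho>0 \<Longrightarrow> \<bar>r1 (hbar + y) - r1 hbar - r2 * y\<bar> \<le> \<eta> * \<bar>y\<bar>"
    using derivative_remainder_bound[OF r2 assms(3)] by blast
  define \<rho> where "\<rho> = min \<rho>0 (hbar / 2)"
  have \<rho>: "0 < \<rho>" "\<rho> < hbar" "\<rho> \<le> \<rho>0" using \<rho>0(1) hbar by (auto simp: \<rho>_def)
  have F1: "\<bar>r (hbar + y) - r hbar - (r1 hbar * y + r2 / 2 * y\<^sup>2)\<bar> \<le> \<eta> * \<bar>y\<bar> ^ Suc 1"
    if y: "\<bar>y\<bar> \<le> \<rho>" for y
  proof (rule integrate_power_bound[OF _ _ _ _ y])
    fix z assume z: "\<bar>z\<bar> \<le> \<rho>"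
    then have "0 < hbar + z" using \<rho> by linarith
    then show "((\<lambda>y. r (hbar + y) - r hbar - (r1 hbar * y + r2 / 2 * y\<^sup>2)) has_real_derivative
        r1 (hbar + z) - r1 hbar - r2 * z) (at z)"
      using has_real_derivative_shift[OF r1]
      by (auto intro!: derivative_eq_intros)
    show "\<bar>r1 (hbar + z) - r1 hbar - r2 * z\<bar> \<le> \<eta> * \<bar>z\<bar> ^ 1" using \<rho>0(2)[of z] z \<rho> by simp
  qed (use assms in auto)
  have F2: "\<bar>H' (hbar + y) - H' hbar - (r hbar * y + r1 hbar / 2 * y\<^sup>2 + r2 / 6 * y ^ 3)\<bar> \<le> \<eta> * \<bar>y\<bar> ^ Suc (Suc 1)"
    if y: "\<bar>y\<bar> \<le> \<rho>" for y
  proof (rule integrate_power_bound[OF _ F1 _ _ y])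
    fix z assume z: "\<bar>z\<bar> \<le> \<rho>"
    then show "((\<lambda>y. H' (hbar + y) - H' hbar - (r hbar * y + r1 hbar / 2 * y\<^sup>2 + r2 / 6 * y ^ 3)) has_real_derivative
        r (hbar + z) - r hbar - (r1 hbar * z + r2 / 2 * z\<^sup>2)) (at z)"
      using has_real_derivative_shift[OF H', of hbar z] \<rho>
      by (auto intro!: derivative_eq_intros simp: power2_eq_square)
  qed (use assms in auto)
  have F3: "\<bar>G y - (r hbar / 2 * y\<^sup>2 + r1 hbar / 6 * y ^ 3 + r2 / 24 * y ^ 4)\<bar> \<le> \<eta> * \<bar>y\<bar> ^ Suc (Suc (Suc 1))"
    if y: "\<bar>y\<bar> \<le> \<rho>" for y
  proof (rule integrate_power_bound[OF _ F2 _ _ y])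
    fix z assume z: "\<bar>z\<bar> \<le> \<rho>"
    then show "((\<lambda>y. G y - (r hbar / 2 * y\<^sup>2 + r1 hbar / 6 * y ^ 3 + r2 / 24 * y ^ 4)) has_real_derivative
        H' (hbar + z) - H' hbar - (r hbar * z + r1 hbar / 2 * z\<^sup>2 + r2 / 6 * z ^ 3)) (at z)"
      using shifted_derivatives(1)[of z] \<rho> by (auto intro!: derivative_eq_intros simp: field_simps)
  qed (use assms in \<open>auto simp: G_def\<close>)
  have "\<bar>y\<bar> ^ Suc (Suc (Suc 1)) = y ^ 4" for y :: real by (simp add: power4_eq_xxxx)
  then show ?thesis using \<rho> F3 by (intro exI[of _ \<rho>]) auto
qed

lemma continuous_H: "continuous_on {0<..} H"
  using H by (meson DERIV_isCont continuous_at_imp_continuous_on greaterThan_iff)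

lemma energy_constant: "energy H X (\<lambda>x. hbar) = - (X * H hbar)"
proof -
  have v: "has_L2_derivative X (\<lambda>x. hbar) (\<lambda>x. 0)"
    by (rule has_L2_derivative_C1) auto
  have "(LBINT x:{0..X}. 1 / 2 * (H1_deriv X (\<lambda>x. hbar) x)\<^sup>2 - H hbar) =
    1 / 2 * (LBINT x:{0..X}. (H1_deriv X (\<lambda>x. hbar) x)\<^sup>2) - (LBINT x:{0..X}. H hbar)"
    unfolding set_integral_mult_right[symmetric]
    by (intro set_integral_diff(2) set_integrable_mult_right has_L2_derivative_deriv_integrable[OF v]
        borel_integrable_atLeastAtMost' continuous_on_const)
  then show ?thesis
    unfolding energy_def LBINT_H1_deriv[OF v X] using X by (simp add: LBINT_const)
qed

lemma energy_eq:
  assumes u: "u \<in> H1 X" and v: "has_L2_derivative X u v"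
    and pos: "\<And>x. x \<in> {0..X} \<Longrightarrow> 0 < u x"
  shows "energy H X u = 1 / 2 * (LBINT x:{0..X}. (v x)\<^sup>2) - (LBINT x:{0..X}. H (u x))"
proof -
  have "continuous_on {0..X} (\<lambda>x. H (u x))"
    by (rule continuous_on_compose2[OF continuous_H H1_continuous_Icc[OF u]]) (use pos in auto)
  then show ?thesis
    unfolding energy_def LBINT_H1_deriv[OF v X, symmetric] set_integral_mult_right[symmetric]
    by (intro set_integral_diff(2) set_integrable_mult_right has_L2_derivative_deriv_integrable[OF v]
        borel_integrable_atLeastAtMost')
qed

lemma energy_difference:
  assumes u: "u \<in> H1_zero_mean X" and pos: "\<And>x. 0 < hbar + \<epsilon> * u x"
  shows "energy H X (\<lambda>x. hbar + \<epsilon> * u x) - energy H X (\<lambda>x. hbar) =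
    \<epsilon>\<^sup>2 / 2 * (LBINT x:{0..X}. (H1_deriv X u x)\<^sup>2) - (LBINT x:{0..X}. G (\<epsilon> * u x))"
    and "set_integrable lborel {0..X} (\<lambda>x. G (\<epsilon> * u x))"
proof -
  note uH = H1_zero_mean_H1[OF u]
  note v = H1_deriv_has_L2_derivative[OF uH]
  note cu = H1_continuous_Icc[OF uH]
  have "(\<lambda>x. hbar + \<epsilon> * u x) \<in> H1 X"
    unfolding H1_def using H1_periodic[OF uH] has_L2_derivative_affine[OF v] by auto
  then have E: "energy H X (\<lambda>x. hbar + \<epsilon> * u x) =
      1 / 2 * (LBINT x:{0..X}. (\<epsilon> * H1_deriv X u x)\<^sup>2) - (LBINT x:{0..X}. H (hbar + \<epsilon> * u x))"
    by (rule energy_eq[OF _ has_L2_derivative_affine[OF v]]) (rule pos)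
  have cH: "continuous_on {0..X} (\<lambda>x. H (hbar + \<epsilon> * u x))"
    by (rule continuous_on_compose2[OF continuous_H]) (use pos cu in \<open>auto intro!: continuous_intros\<close>)
  then show "set_integrable lborel {0..X} (\<lambda>x. G (\<epsilon> * u x))"
    unfolding G_def by (intro borel_integrable_atLeastAtMost' continuous_intros cu)
  have "(LBINT x:{0..X}. G (\<epsilon> * u x)) =
      (LBINT x:{0..X}. H (hbar + \<epsilon> * u x) - H hbar - H' hbar * \<epsilon> * u x)"
    by (simp add: G_def mult.assoc)
  also have "\<dots> = (LBINT x:{0..X}. H (hbar + \<epsilon> * u x)) - X * H hbar"
    using borel_integrable_atLeastAtMost'[OF cH] borel_integrable_atLeastAtMost'[OF cu]
      borel_integrable_atLeastAtMost'[of 0 X "\<lambda>x. H hbar"] u X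
    by (simp add: LBINT_const H1_zero_mean_def)
  finally show "energy H X (\<lambda>x. hbar + \<epsilon> * u x) - energy H X (\<lambda>x. hbar) =
    \<epsilon>\<^sup>2 / 2 * (LBINT x:{0..X}. (H1_deriv X u x)\<^sup>2) - (LBINT x:{0..X}. G (\<epsilon> * u x))"
    unfolding E energy_constant by (simp add: power_mult_distrib)
qed

text \<open>Smallness is measured pointwise, and \<rho> is uniform in both \<epsilon> and
  \<open>u\<close>. This covers a fixed direction with \<epsilon> tending to zero as well as all
  small perturbations at once with \<open>\<epsilon> = 1\<close>.\<close>

lemma energy_quadratic:
  assumes "0 < \<eta>"
  shows "\<exists>\<rho>>0. \<forall>\<epsilon>. \<forall>u\<in>H1_zero_mean X. (\<forall>x. \<bar>\<epsilon> * u x\<bar> \<le> \<rho>) \<longrightarrow>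
    (\<forall>x. 0 < hbar + \<epsilon> * u x) \<and>
    \<bar>energy H X (\<lambda>x. hbar + \<epsilon> * u x) - energy H X (\<lambda>x. hbar) - \<epsilon>\<^sup>2 * (quad u / 2)\<bar>
      \<le> \<eta> * \<epsilon>\<^sup>2 * (LBINT x:{0..X}. (u x)\<^sup>2)"
proof -
  obtain \<rho> where \<rho>: "\<rho> > 0" "\<rho> < hbar"
    "\<And>y. \<bar>y\<bar> \<le> \<rho> \<Longrightarrow> \<bar>G y - r hbar / 2 * y\<^sup>2\<bar> \<le> \<eta> * y\<^sup>2"
    using G_quadratic[OF assms] by blast
  have "(\<forall>x. 0 < hbar + \<epsilon> * u x) \<and>
    \<bar>energy H X (\<lambda>x. hbar + \<epsilon> * u x) - energy H X (\<lambda>x. hbar) - \<epsilon>\<^sup>2 * (quad u / 2)\<bar>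
      \<le> \<eta> * \<epsilon>\<^sup>2 * (LBINT x:{0..X}. (u x)\<^sup>2)"
    if u: "u \<in> H1_zero_mean X" and small: "\<And>x. \<bar>\<epsilon> * u x\<bar> \<le> \<rho>" for \<epsilon> u
  proof
    have pos: "0 < hbar + \<epsilon> * u x" for x using small[of x] \<rho>(2) by linarith
    then show "\<forall>x. 0 < hbar + \<epsilon> * u x" by blast
    note D = energy_difference[OF u pos]
    have i: "set_integrable lborel {0..X} (\<lambda>x. (u x)\<^sup>2)"
      by (rule H1_power_integrable[OF H1_zero_mean_H1[OF u]])
    have "\<bar>(LBINT x:{0..X}. G (\<epsilon> * u x) - r hbar / 2 * \<epsilon>\<^sup>2 * (u x)\<^sup>2)\<bar> \<le> (LBINT x:{0..X}. \<eta> * \<epsilon>\<^sup>2 * (u x)\<^sup>2)"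
    proof (rule abs_LBINT_le)
      show "\<bar>G (\<epsilon> * u x) - r hbar / 2 * \<epsilon>\<^sup>2 * (u x)\<^sup>2\<bar> \<le> \<eta> * \<epsilon>\<^sup>2 * (u x)\<^sup>2" for x
        using \<rho>(3)[OF small[of x]] by (simp add: power_mult_distrib mult.assoc)
    qed (use D(2) i in auto)
    then have "\<bar>(LBINT x:{0..X}. G (\<epsilon> * u x)) - r hbar / 2 * \<epsilon>\<^sup>2 * (LBINT x:{0..X}. (u x)\<^sup>2)\<bar>
        \<le> \<eta> * \<epsilon>\<^sup>2 * (LBINT x:{0..X}. (u x)\<^sup>2)"
      using D(2) i by simp
    moreover have "energy H X (\<lambda>x. hbar + \<epsilon> * u x) - energy H X (\<lambda>x. hbar) - \<epsilon>\<^sup>2 * (quad u / 2) =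
        - ((LBINT x:{0..X}. G (\<epsilon> * u x)) - r hbar / 2 * \<epsilon>\<^sup>2 * (LBINT x:{0..X}. (u x)\<^sup>2))"
      unfolding D(1) quad_def by (simp add: field_simps)
    ultimately show "\<bar>energy H X (\<lambda>x. hbar + \<epsilon> * u x) - energy H X (\<lambda>x. hbar) - \<epsilon>\<^sup>2 * (quad u / 2)\<bar>
      \<le> \<eta> * \<epsilon>\<^sup>2 * (LBINT x:{0..X}. (u x)\<^sup>2)"
      by simp
  qed
  then show ?thesis using \<rho>(1) by blast
qed

text \<open>In a direction with vanishing second variation and vanishing cube, the quadratic and
  cubic terms of the expansion disappear after integration, and order four is the first to
  survive.\<close>

lemma energy_quartic:
  assumes r1: "\<And>y. y > 0 \<Longrightarrow> (r has_real_derivative r1 y) (at y)"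
    and r2: "(r1 has_real_derivative r2) (at hbar)" and "0 < \<eta>"
    and u: "u \<in> H1_zero_mean X" and q: "quad u = 0" and cube: "(LBINT x:{0..X}. (u x) ^ 3) = 0"
  shows "\<exists>\<rho>>0. \<forall>\<epsilon>. (\<forall>x. \<bar>\<epsilon> * u x\<bar> \<le> \<rho>) \<longrightarrow>
    (\<forall>x. 0 < hbar + \<epsilon> * u x) \<and>
    \<bar>energy H X (\<lambda>x. hbar + \<epsilon> * u x) - energy H X (\<lambda>x. hbar) - \<epsilon> ^ 4 * (- r2 / 24 * (LBINT x:{0..X}. (u x) ^ 4))\<bar>
      \<le> \<eta> * \<epsilon> ^ 4 * (LBINT x:{0..X}. (u x) ^ 4)"
proof -
  obtain \<rho> where \<rho>: "\<rho> > 0" "\<rho> < hbar"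
    "\<And>y. \<bar>y\<bar> \<le> \<rho> \<Longrightarrow> \<bar>G y - (r hbar / 2 * y\<^sup>2 + r1 hbar / 6 * y ^ 3 + r2 / 24 * y ^ 4)\<bar> \<le> \<eta> * y ^ 4"
    using G_quartic[OF r1 r2 assms(3)] by blast
  have "(\<forall>x. 0 < hbar + \<epsilon> * u x) \<and>
    \<bar>energy H X (\<lambda>x. hbar + \<epsilon> * u x) - energy H X (\<lambda>x. hbar) - \<epsilon> ^ 4 * (- r2 / 24 * (LBINT x:{0..X}. (u x) ^ 4))\<bar>
      \<le> \<eta> * \<epsilon> ^ 4 * (LBINT x:{0..X}. (u x) ^ 4)"
    if small: "\<And>x. \<bar>\<epsilon> * u x\<bar> \<le> \<rho>" for \<epsilon>
  proof
    have pos: "0 < hbar + \<epsilon> * u x" for x using small[of x] \<rho>(2) by linarith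
    then show "\<forall>x. 0 < hbar + \<epsilon> * u x" by blast
    note D = energy_difference[OF u pos]
    have i: "set_integrable lborel {0..X} (\<lambda>x. (u x) ^ n)" for n
      by (rule H1_power_integrable[OF H1_zero_mean_H1[OF u]])
    define P where "P x = r hbar / 2 * \<epsilon>\<^sup>2 * (u x)\<^sup>2 + r1 hbar / 6 * \<epsilon> ^ 3 * (u x) ^ 3 + r2 / 24 * \<epsilon> ^ 4 * (u x) ^ 4" for x
    have iP: "set_integrable lborel {0..X} P"
      unfolding P_def by (intro set_integral_add(1) set_integrable_mult_right i)
    have LP: "(LBINT x:{0..X}. P x) = r hbar / 2 * \<epsilon>\<^sup>2 * (LBINT x:{0..X}. (u x)\<^sup>2) + r2 / 24 * \<epsilon> ^ 4 * (LBINT x:{0..X}. (u x) ^ 4)"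
      unfolding P_def using i[of 2] i[of 3] i[of 4] cube by simp
    have "\<bar>(LBINT x:{0..X}. G (\<epsilon> * u x) - P x)\<bar> \<le> (LBINT x:{0..X}. \<eta> * \<epsilon> ^ 4 * (u x) ^ 4)"
    proof (rule abs_LBINT_le)
      show "\<bar>G (\<epsilon> * u x) - P x\<bar> \<le> \<eta> * \<epsilon> ^ 4 * (u x) ^ 4" for x
        using \<rho>(3)[OF small[of x]] unfolding P_def by (simp add: power_mult_distrib mult.assoc)
    qed (use D(2) iP i in auto)
    then have "\<bar>(LBINT x:{0..X}. G (\<epsilon> * u x)) - (LBINT x:{0..X}. P x)\<bar>
        \<le> \<eta> * \<epsilon> ^ 4 * (LBINT x:{0..X}. (u x) ^ 4)"
      using D(2) iP by simp
    moreover have "energy H X (\<lambda>x. hbar + \<epsilon> * u x) - energy H X (\<lambda>x. hbar) - \<epsilon> ^ 4 * (- r2 / 24 * (LBINT x:{0..X}. (u x) ^ 4)) =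
        - ((LBINT x:{0..X}. G (\<epsilon> * u x)) - (LBINT x:{0..X}. P x))"
      unfolding D(1) LP using q unfolding quad_def by (simp add: algebra_simps)
    ultimately show "\<bar>energy H X (\<lambda>x. hbar + \<epsilon> * u x) - energy H X (\<lambda>x. hbar) - \<epsilon> ^ 4 * (- r2 / 24 * (LBINT x:{0..X}. (u x) ^ 4))\<bar>
      \<le> \<eta> * \<epsilon> ^ 4 * (LBINT x:{0..X}. (u x) ^ 4)"
      by simp
  qed
  then show ?thesis using \<rho>(1) by blast
qed

section \<open>Sign of the energy change along a direction\<close>

lemma eventually_small:
  assumes u: "u \<in> H1_zero_mean X" and "0 < \<rho>"
  shows "\<forall>\<^sub>F \<epsilon> in at_right 0. 0 < \<epsilon> \<and> (\<forall>x. \<bar>\<epsilon> * u x\<bar> \<le> \<rho>)"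
proof -
  \<comment> \<open>The summand 1 makes \<open>M\<close> positive whatever the norm, so that
    \<open>\<rho> / M\<close> is a positive threshold.\<close>
  define M where "M = sqrt X * H1_norm X u + 1"
  have M: "\<bar>u x\<bar> \<le> M" for x
    using zero_mean_sup_le_H1_norm[OF u X, of x] by (simp add: M_def)
  have "M > 0" unfolding M_def using X by (simp add: H1_norm_def LBINT_nonneg add_nonneg_pos)
  show ?thesis
    unfolding eventually_at_right_field
  proof (intro exI[of _ "\<rho> / M"] conjI allI impI)
    fix \<epsilon> x assume \<epsilon>: "0 < \<epsilon>" "\<epsilon> < \<rho> / M"
    then have "\<bar>\<epsilon> * u x\<bar> \<le> (\<rho> / M) * M"
      unfolding abs_mult using M[of x] by (intro mult_mono) auto
    then show "\<bar>\<epsilon> * u x\<bar> \<le> \<rho>" using \<open>M > 0\<close> by simp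
  qed (use \<open>M > 0\<close> \<open>0 < \<rho>\<close> in auto)
qed

text \<open>The tolerance \<open>\<bar>A\<bar> / (2 * B)\<close> is chosen so that the error is at
  most half the leading term and cannot change its sign. The exponent \<open>n\<close> is 2 for
  nonzero second variation and 4 in the degenerate case; \<open>P\<close> carries positivity
  along.\<close>

lemma leading_term_sign:
  fixes A B E0 :: real and E :: "real \<Rightarrow> real"
  assumes ev: "\<forall>\<^sub>F \<epsilon> in at_right 0. 0 < \<epsilon> \<and> P \<epsilon> \<and>
      \<bar>E \<epsilon> - E0 - \<epsilon> ^ n * A\<bar> \<le> (\<bar>A\<bar> / (2 * B)) * \<epsilon> ^ n * B"
    and "0 < B"
  shows "A > 0 \<Longrightarrow> \<forall>\<^sub>F \<epsilon> in at_right 0. P \<epsilon> \<and> E \<epsilon> > E0"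
    and "A < 0 \<Longrightarrow> \<forall>\<^sub>F \<epsilon> in at_right 0. P \<epsilon> \<and> E \<epsilon> < E0"
proof -
  have *: "(A > 0 \<longrightarrow> E \<epsilon> > E0) \<and> (A < 0 \<longrightarrow> E \<epsilon> < E0)"
    if "0 < \<epsilon>" "\<bar>E \<epsilon> - E0 - \<epsilon> ^ n * A\<bar> \<le> (\<bar>A\<bar> / (2 * B)) * \<epsilon> ^ n * B" for \<epsilon>
  proof -
    define p where "p = \<epsilon> ^ n * A"
    have "(\<bar>A\<bar> / (2 * B)) * \<epsilon> ^ n * B = \<bar>p\<bar> / 2"
      using that(1) \<open>0 < B\<close> by (simp add: p_def abs_mult)
    then have "\<bar>E \<epsilon> - E0 - p\<bar> \<le> \<bar>p\<bar> / 2" using that(2) by (simp add: p_def)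
    moreover have "A > 0 \<longrightarrow> p > 0" "A < 0 \<longrightarrow> p < 0"
      using that(1) by (auto simp: p_def mult_pos_neg)
    ultimately show ?thesis by linarith
  qed
  show "\<forall>\<^sub>F \<epsilon> in at_right 0. P \<epsilon> \<and> E \<epsilon> > E0" if "A > 0"
    using ev by (rule eventually_mono) (use * that in blast)
  show "\<forall>\<^sub>F \<epsilon> in at_right 0. P \<epsilon> \<and> E \<epsilon> < E0" if "A < 0"
    using ev by (rule eventually_mono) (use * that in blast)
qed

lemma quad_sign:
  assumes u: "u \<in> H1_zero_mean X" "u \<noteq> (\<lambda>x. 0)"
  shows "quad u > 0 \<Longrightarrow> \<forall>\<^sub>F \<epsilon> in at_right 0. (\<forall>x. 0 < hbar + \<epsilon> * u x) \<and>
      energy H X (\<lambda>x. hbar + \<epsilon> * u x) > energy H X (\<lambda>x. hbar)"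
    and "quad u < 0 \<Longrightarrow> \<forall>\<^sub>F \<epsilon> in at_right 0. (\<forall>x. 0 < hbar + \<epsilon> * u x) \<and>
      energy H X (\<lambda>x. hbar + \<epsilon> * u x) < energy H X (\<lambda>x. hbar)"
proof -
  define B where "B = (LBINT x:{0..X}. (u x)\<^sup>2)"
  define A where "A = quad u / 2"
  have B: "B > 0" unfolding B_def by (rule LBINT_power_pos) (use u X in \<open>auto intro: H1_zero_mean_H1\<close>)
  have "\<forall>\<^sub>F \<epsilon> in at_right 0. 0 < \<epsilon> \<and> (\<forall>x. 0 < hbar + \<epsilon> * u x) \<and>
     \<bar>energy H X (\<lambda>x. hbar + \<epsilon> * u x) - energy H X (\<lambda>x. hbar) - \<epsilon>\<^sup>2 * A\<bar> \<le> (\<bar>A\<bar> / (2 * B)) * \<epsilon>\<^sup>2 * B"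
    if "A \<noteq> 0"
  proof -
    have "\<bar>A\<bar> / (2 * B) > 0" using that B by simp
    from energy_quadratic[OF this] obtain \<rho> where "\<rho> > 0"
      "\<And>\<epsilon>. (\<forall>x. \<bar>\<epsilon> * u x\<bar> \<le> \<rho>) \<Longrightarrow> (\<forall>x. 0 < hbar + \<epsilon> * u x) \<and>
        \<bar>energy H X (\<lambda>x. hbar + \<epsilon> * u x) - energy H X (\<lambda>x. hbar) - \<epsilon>\<^sup>2 * A\<bar> \<le> (\<bar>A\<bar> / (2 * B)) * \<epsilon>\<^sup>2 * B"
      using u(1) unfolding A_def B_def by blast
    then show ?thesis
      using eventually_small[OF u(1) \<open>\<rho> > 0\<close>] by (elim eventually_mono) blast
  qed
  note ev = this
  show "\<forall>\<^sub>F \<epsilon> in at_right 0. (\<forall>x. 0 < hbar + \<epsilon> * u x) \<and>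
      energy H X (\<lambda>x. hbar + \<epsilon> * u x) > energy H X (\<lambda>x. hbar)" if "quad u > 0"
  proof -
    have "A > 0" using that by (simp add: A_def)
    with ev show ?thesis by (intro leading_term_sign(1)[OF _ B]) auto
  qed
  show "\<forall>\<^sub>F \<epsilon> in at_right 0. (\<forall>x. 0 < hbar + \<epsilon> * u x) \<and>
      energy H X (\<lambda>x. hbar + \<epsilon> * u x) < energy H X (\<lambda>x. hbar)" if "quad u < 0"
  proof -
    have "A < 0" using that by (simp add: A_def)
    with ev show ?thesis by (intro leading_term_sign(2)[OF _ B]) auto
  qed
qed

lemma quartic_sign:
  assumes r1: "\<And>y. y > 0 \<Longrightarrow> (r has_real_derivative r1 y) (at y)"
    and r2: "(r1 has_real_derivative r2) (at hbar)"
    and u: "u \<in> H1_zero_mean X" "u \<noteq> (\<lambda>x. 0)"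
    and q: "quad u = 0" and cube: "(LBINT x:{0..X}. (u x) ^ 3) = 0"
  shows "r2 < 0 \<Longrightarrow> \<forall>\<^sub>F \<epsilon> in at_right 0. (\<forall>x. 0 < hbar + \<epsilon> * u x) \<and>
      energy H X (\<lambda>x. hbar + \<epsilon> * u x) > energy H X (\<lambda>x. hbar)"
    and "r2 > 0 \<Longrightarrow> \<forall>\<^sub>F \<epsilon> in at_right 0. (\<forall>x. 0 < hbar + \<epsilon> * u x) \<and>
      energy H X (\<lambda>x. hbar + \<epsilon> * u x) < energy H X (\<lambda>x. hbar)"
proof -
  define B where "B = (LBINT x:{0..X}. (u x) ^ 4)"
  define A where "A = - r2 / 24 * B"
  have B: "B > 0" unfolding B_def by (rule LBINT_power_pos) (use u X in \<open>auto intro: H1_zero_mean_H1\<close>)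
  have "\<forall>\<^sub>F \<epsilon> in at_right 0. 0 < \<epsilon> \<and> (\<forall>x. 0 < hbar + \<epsilon> * u x) \<and>
     \<bar>energy H X (\<lambda>x. hbar + \<epsilon> * u x) - energy H X (\<lambda>x. hbar) - \<epsilon> ^ 4 * A\<bar> \<le> (\<bar>A\<bar> / (2 * B)) * \<epsilon> ^ 4 * B"
    if "A \<noteq> 0"
  proof -
    have "\<bar>A\<bar> / (2 * B) > 0" using that B by simp
    from energy_quartic[OF r1 r2 this u(1) q cube] obtain \<rho> where "\<rho> > 0"
      "\<And>\<epsilon>. (\<forall>x. \<bar>\<epsilon> * u x\<bar> \<le> \<rho>) \<Longrightarrow> (\<forall>x. 0 < hbar + \<epsilon> * u x) \<and>
        \<bar>energy H X (\<lambda>x. hbar + \<epsilon> * u x) - energy H X (\<lambda>x. hbar) - \<epsilon> ^ 4 * A\<bar> \<le> (\<bar>A\<bar> / (2 * B)) * \<epsilon> ^ 4 * B"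
      unfolding A_def B_def by blast
    then show ?thesis
      using eventually_small[OF u(1) \<open>\<rho> > 0\<close>] by (elim eventually_mono) blast
  qed
  note ev = this
  show "\<forall>\<^sub>F \<epsilon> in at_right 0. (\<forall>x. 0 < hbar + \<epsilon> * u x) \<and>
      energy H X (\<lambda>x. hbar + \<epsilon> * u x) > energy H X (\<lambda>x. hbar)" if "r2 < 0"
  proof -
    have "A > 0" using that B by (simp add: A_def mult_neg_pos)
    with ev show ?thesis by (intro leading_term_sign(1)[OF _ B]) auto
  qed
  show "\<forall>\<^sub>F \<epsilon> in at_right 0. (\<forall>x. 0 < hbar + \<epsilon> * u x) \<and>
      energy H X (\<lambda>x. hbar + \<epsilon> * u x) < energy H X (\<lambda>x. hbar)" if "r2 > 0"
  proof -
    have "A < 0" using that B by (simp add: A_def)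
    with ev show ?thesis by (intro leading_term_sign(2)[OF _ B]) auto
  qed
qed

lemma quad_first_mode:
  "quad (first_mode X a b) = ((2 * pi / X)\<^sup>2 - r hbar) * (LBINT x:{0..X}. (first_mode X a b x)\<^sup>2)"
  unfolding quad_def LBINT_H1_deriv[OF first_mode_has_L2_derivative X] first_mode_square[OF X]
  by (simp add: algebra_simps)

text \<open>If \<open>quad u\<close> is not positive, the chain from the integral of
  \<open>(u') ^ 2\<close> through \<open>r hbar\<close> and \<open>(2 * pi / X) ^ 2\<close> times
  that of \<open>u ^ 2\<close> closes up on itself. All its inequalities are then equalities,
  including Wirtinger's.\<close>

lemma quad_nonneg:
  assumes u: "u \<in> H1_zero_mean X" "u \<noteq> (\<lambda>x. 0)" and r: "r hbar \<le> (2 * pi / X)\<^sup>2"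
  shows "0 < quad u \<or> (r hbar = (2 * pi / X)\<^sup>2 \<and> quad u = 0 \<and> (\<exists>a b. u = first_mode X a b))"
proof -
  note v = H1_deriv_has_L2_derivative[OF H1_zero_mean_H1[OF u(1)]]
  let ?k = "(2 * pi / X)\<^sup>2" and ?u2 = "LBINT x:{0..X}. (u x)\<^sup>2" and ?v2 = "LBINT x:{0..X}. (H1_deriv X u x)\<^sup>2"
  have pos: "?u2 > 0" by (rule LBINT_power_pos) (use u X in \<open>auto intro: H1_zero_mean_H1\<close>)
  have W: "?k * ?u2 \<le> ?v2" by (rule wirtinger_inequality[OF u(1) v X])
  have le: "r hbar * ?u2 \<le> ?k * ?u2" using r pos by simp
  show ?thesis
  proof (cases "quad u > 0")
    case False
    then have "?v2 \<le> r hbar * ?u2" by (simp add: quad_def)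
    then have "?v2 \<le> ?k * ?u2" "r hbar * ?u2 = ?k * ?u2" "quad u = 0"
      using W le unfolding quad_def by linarith+
    moreover from this have "r hbar = ?k" using pos by (metis less_irrefl mult_right_cancel)
    ultimately show ?thesis
      using wirtinger_equality[OF u(1) v X] unfolding first_mode_def times_divide_eq_left by blast
  qed simp
qed

text \<open>Below the critical period Wirtinger's inequality leaves a spectral gap. Part of it
  absorbs the Taylor remainder, the rest is shared between the function and its derivative to
  recover the full \<open>H1_norm\<close>.\<close>

lemma energy_coercive:
  assumes r: "r hbar < (2 * pi / X)\<^sup>2"
  shows "\<exists>c>0. \<exists>K>0. \<exists>\<rho>>0. \<forall>u\<in>H1_zero_mean X. H1_norm X u \<le> \<rho> \<longrightarrow>
    (\<forall>x. 0 < hbar + u x) \<and>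
    c * (H1_norm X u)\<^sup>2 \<le> energy H X (\<lambda>x. hbar + u x) - energy H X (\<lambda>x. hbar) \<and>
    energy H X (\<lambda>x. hbar + u x) - energy H X (\<lambda>x. hbar) \<le> K * (H1_norm X u)\<^sup>2"
proof -
  define k where "k = (2 * pi / X)\<^sup>2"
  \<comment> \<open>\<open>s\<close> lies strictly below \<open>k\<close> and at or above
    \<open>r hbar + 2 * \<eta>\<close>, so it bounds the potential including the remainder. Cutting
    off at 0 ensures \<open>c \<le> 1 / 2\<close> below when \<open>r hbar\<close> is very
    negative.\<close>
  define s where "s = max 0 ((r hbar + k) / 2)"
  define \<eta> where "\<eta> = (k - r hbar) / 4"
  have k: "k > 0" using X by (simp add: k_def)
  have s: "0 \<le> s" "s < k" "r hbar + 2 * \<eta> \<le> s" using k r[folded k_def] by (auto simp: s_def \<eta>_def max_def field_simps)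
  have \<eta>: "\<eta> > 0" using r by (simp add: \<eta>_def k_def)
  \<comment> \<open>Of the coefficient \<open>1 / 2\<close> of \<open>V\<close>, the part
    \<open>c\<close> is kept and the rest is turned into \<open>U\<close> by Wirtinger;
    \<open>c\<close> solves the equation that makes the resulting coefficients of \<open>U\<close>
    and \<open>V\<close> equal.\<close>
  define c where "c = (k - s) / (2 * (1 + k))"
  have c: "c > 0" "c \<le> 1 / 2" "c * (1 + k) = (k - s) / 2"
    using k s by (auto simp: c_def field_simps)
  define K where "K = 1 / 2 + \<bar>r hbar\<bar> / 2 + \<eta>"
  have K: "K > 0" using \<eta> by (simp add: K_def)
  obtain \<rho> where \<rho>: "\<rho> > 0" and q: "\<And>u. u \<in> H1_zero_mean X \<Longrightarrow> (\<And>x. \<bar>u x\<bar> \<le> \<rho>) \<Longrightarrow>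
    (\<forall>x. 0 < hbar + u x) \<and>
    \<bar>energy H X (\<lambda>x. hbar + u x) - energy H X (\<lambda>x. hbar) - quad u / 2\<bar> \<le> \<eta> * (LBINT x:{0..X}. (u x)\<^sup>2)"
  proof -
    obtain \<rho> where \<rho>: "\<rho> > 0" and q: "\<And>\<epsilon> u. u \<in> H1_zero_mean X \<Longrightarrow> (\<And>x. \<bar>\<epsilon> * u x\<bar> \<le> \<rho>) \<Longrightarrow>
      (\<forall>x. 0 < hbar + \<epsilon> * u x) \<and>
      \<bar>energy H X (\<lambda>x. hbar + \<epsilon> * u x) - energy H X (\<lambda>x. hbar) - \<epsilon>\<^sup>2 * (quad u / 2)\<bar>
        \<le> \<eta> * \<epsilon>\<^sup>2 * (LBINT x:{0..X}. (u x)\<^sup>2)"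
      using energy_quadratic[OF \<eta>] by blast
    show ?thesis by (rule that[OF \<rho>]) (use q[of _ 1] in simp)
  qed
  define \<rho>' where "\<rho>' = \<rho> / sqrt X"
  have \<rho>': "\<rho>' > 0" using \<rho> X by (simp add: \<rho>'_def)
  have "(\<forall>x. 0 < hbar + u x) \<and>
    c * (H1_norm X u)\<^sup>2 \<le> energy H X (\<lambda>x. hbar + u x) - energy H X (\<lambda>x. hbar) \<and>
    energy H X (\<lambda>x. hbar + u x) - energy H X (\<lambda>x. hbar) \<le> K * (H1_norm X u)\<^sup>2"
    if u: "u \<in> H1_zero_mean X" and n: "H1_norm X u \<le> \<rho>'" for u
  proof -
    note v = H1_deriv_has_L2_derivative[OF H1_zero_mean_H1[OF u]]
    define U where "U = (LBINT x:{0..X}. (u x)\<^sup>2)"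
    define V where "V = (LBINT x:{0..X}. (H1_deriv X u x)\<^sup>2)"
    define E where "E = energy H X (\<lambda>x. hbar + u x) - energy H X (\<lambda>x. hbar)"
    have UV: "0 \<le> U" "0 \<le> V" by (simp_all add: U_def V_def LBINT_nonneg)
    have W: "k * U \<le> V" unfolding U_def V_def k_def by (rule wirtinger_inequality[OF u v X])
    have "\<bar>u x\<bar> \<le> \<rho>" for x
    proof -
      have "\<bar>u x\<bar> \<le> sqrt X * H1_norm X u" by (rule zero_mean_sup_le_H1_norm[OF u X])
      also have "\<dots> \<le> sqrt X * \<rho>'" using n X by (intro mult_left_mono) auto
      finally show ?thesis using X by (simp add: \<rho>'_def)
    qed
    from q[OF u this] have pos: "\<forall>x. 0 < hbar + u x" and E: "\<bar>E - (V - r hbar * U) / 2\<bar> \<le> \<eta> * U"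
      by (auto simp: E_def U_def V_def quad_def)
    have "(r hbar + 2 * \<eta>) * U \<le> s * U" using s UV by (intro mult_right_mono) auto
    then have "V / 2 - s / 2 * U \<le> E" using E by (simp add: algebra_simps abs_le_iff)
    moreover have "(1 / 2 - c) * (k * U) \<le> (1 / 2 - c) * V" using W c by (intro mult_left_mono) auto
    moreover have "c * (1 + k) * U = (k - s) / 2 * U" unfolding c(3) ..
    ultimately have "c * (U + V) \<le> E" by (simp add: algebra_simps)
    moreover have "E \<le> K * (U + V)"
    proof -
      have "- r hbar * U \<le> \<bar>r hbar\<bar> * U" using UV by (intro mult_right_mono) auto
      moreover have "0 \<le> \<bar>r hbar\<bar> / 2 * V" "0 \<le> \<eta> * V" "0 \<le> 1 / 2 * U" using UV \<eta> by auto
      ultimately show ?thesis using E unfolding K_def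
        by (simp add: algebra_simps add_divide_distrib diff_divide_distrib abs_le_iff)
    qed
    ultimately show ?thesis
      using pos unfolding H1_norm_square[OF v X] E_def U_def V_def by blast
  qed
  then show ?thesis using c(1) K \<rho>' by blast
qed

lemma strict_local_min:
  assumes "r hbar < (2 * pi / X)\<^sup>2"
  shows "strict_local_energy_min H X (\<lambda>x. hbar)"
proof -
  obtain c K \<rho> where "c > 0" "\<rho> > 0" and b: "\<And>u. u \<in> H1_zero_mean X \<Longrightarrow> H1_norm X u \<le> \<rho> \<Longrightarrow>
    (\<forall>x. 0 < hbar + u x) \<and> c * (H1_norm X u)\<^sup>2 \<le> energy H X (\<lambda>x. hbar + u x) - energy H X (\<lambda>x. hbar)"
    using energy_coercive[OF assms] by meson
  show ?thesis
    unfolding strict_local_energy_min_def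
  proof (intro exI[of _ \<rho>] conjI ballI impI \<open>\<rho> > 0\<close>)
    fix u assume u: "u \<in> H1_zero_mean X" and n: "0 < H1_norm X u \<and> H1_norm X u \<le> \<rho>"
    show "\<forall>x. 0 < hbar + u x" using b u n by blast
    have "0 < c * (H1_norm X u)\<^sup>2" using n \<open>c > 0\<close> by simp
    also have "\<dots> \<le> energy H X (\<lambda>x. hbar + u x) - energy H X (\<lambda>x. hbar)" using b[OF u] n by blast
    finally show "energy H X (\<lambda>x. hbar) < energy H X (\<lambda>x. hbar + u x)" by simp
  qed
qed

end

section \<open>Conservation of mass and dissipation of energy\<close>

text \<open>With the family \<open>D\<close> fixed, mixed derivatives commute by construction:
  \<open>D 1 1\<close> is both the x-derivative of \<open>D 0 1\<close> and the t-derivative of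
  \<open>D 1 0\<close>.\<close>

locale evolution = constant_state +
  fixes f g f' g' :: "real \<Rightarrow> real" and T :: real and h :: "real \<Rightarrow> real \<Rightarrow> real"
    and D :: "nat \<Rightarrow> nat \<Rightarrow> real \<Rightarrow> real \<Rightarrow> real"
  assumes f: "\<And>y. y > 0 \<Longrightarrow> (f has_real_derivative f' y) (at y)"
    and g: "\<And>y. y > 0 \<Longrightarrow> (g has_real_derivative g' y) (at y)"
    and f_pos: "\<And>y. y > 0 \<Longrightarrow> f y > 0"
    and r_eq: "r = (\<lambda>y. g y / f y)"
    and T: "T > 0"
    and D00: "\<And>x t. t \<in> {0..T} \<Longrightarrow> D 0 0 x t = h x t"
    and D_continuous: "\<And>i j. continuous_on (UNIV \<times> {0..T}) (\<lambda>(x, t). D i j x t)"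
    and Dx: "\<And>i j x t. t \<in> {0..T} \<Longrightarrow> ((\<lambda>y. D i j y t) has_real_derivative D (Suc i) j x t) (at x)"
    and Dt: "\<And>i j x t. t \<in> {0..T} \<Longrightarrow> ((\<lambda>s. D i j x s) has_real_derivative D i (Suc j) x t) (at t within {0..T})"
    and solution: "\<And>x t. t \<in> {0..T} \<Longrightarrow> h (x + X) t = h x t \<and> h x t > 0 \<and>
        ((\<lambda>s. h x s) has_real_derivative
           - deriv (\<lambda>y. f (h y t) * (deriv ^^ 3) (\<lambda>z. h z t) y) x
           - deriv (\<lambda>y. g (h y t) * deriv (\<lambda>z. h z t) y) x) (at t within {0..T})"
begin

lemma D_periodic:
  assumes t: "t \<in> {0..T}"
  shows "D i 0 (x + X) t = D i 0 x t"
proof (induction i arbitrary: x)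
  case 0
  then show ?case using D00[OF t] solution[OF t] by simp
next
  case (Suc i)
  have "((\<lambda>y. D i 0 (X + y) t) has_real_derivative D (Suc i) 0 (X + x) t) (at x)"
    by (rule has_real_derivative_shift[OF Dx[OF t]])
  moreover have "(\<lambda>y. D i 0 (X + y) t) = (\<lambda>y. D i 0 y t)" using Suc by (simp add: add.commute)
  ultimately have "((\<lambda>y. D i 0 y t) has_real_derivative D (Suc i) 0 (X + x) t) (at x)" by simp
  from DERIV_unique[OF this Dx[OF t]] show ?case by (simp add: add.commute)
qed

lemma D00_pos: "t \<in> {0..T} \<Longrightarrow> D 0 0 x t > 0"
  using D00 solution by simp

definition flux :: "real \<Rightarrow> real \<Rightarrow> real" where
  "flux x t = f (D 0 0 x t) * D 3 0 x t + g (D 0 0 x t) * D 1 0 x t"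

lemma time_derivative_unique:
  assumes "(F has_real_derivative a) (at t within {0..T})" "(F has_real_derivative b) (at t within {0..T})"
    and "t \<in> {0..T}"
  shows "a = b"
  using vector_derivative_unique_within_closed_interval[of 0 T t F a b] T assms
  by (simp add: has_real_derivative_iff_has_vector_derivative)

text \<open>\<open>deriv\<close> is informative only where a derivative exists, so both products are
  first shown to be differentiable. Uniqueness of derivatives within the time interval, also at its
  ends, then identifies \<open>D 0 1\<close> with the right side of the equation.\<close>

lemma flux_derivative:
  assumes t: "t \<in> {0..T}"
  shows "((\<lambda>x. flux x t) has_real_derivative - D 0 1 x t) (at x)"
proof -
  have h: "(\<lambda>z. h z t) = (\<lambda>z. D 0 0 z t)" using D00[OF t] by simp
  have deriv_D: "deriv (\<lambda>z. D i 0 z t) = (\<lambda>z. D (Suc i) 0 z t)" for i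
    using DERIV_imp_deriv[OF Dx[OF t]] by auto
  have h3: "(deriv ^^ 3) (\<lambda>z. h z t) = (\<lambda>z. D 3 0 z t)"
    unfolding h by (simp add: numeral_3_eq_3 deriv_D)
  have h1: "deriv (\<lambda>z. h z t) = (\<lambda>z. D 1 0 z t)"
    unfolding h deriv_D by simp
  define p where "p = (\<lambda>y. f (D 0 0 y t) * D 3 0 y t)"
  define q where "q = (\<lambda>y. g (D 0 0 y t) * D 1 0 y t)"
  have "((\<lambda>y. f (D 0 0 y t)) has_real_derivative f' (D 0 0 x t) * D (Suc 0) 0 x t) (at x)"
    by (rule DERIV_chain2[OF f[OF D00_pos[OF t]] Dx[OF t]])
  from DERIV_mult[OF this Dx[OF t]]
  have p: "(p has_real_derivative deriv p x) (at x)" unfolding p_def by (metis DERIV_imp_deriv)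
  have "((\<lambda>y. g (D 0 0 y t)) has_real_derivative g' (D 0 0 x t) * D (Suc 0) 0 x t) (at x)"
    by (rule DERIV_chain2[OF g[OF D00_pos[OF t]] Dx[OF t]])
  from DERIV_mult[OF this Dx[OF t]]
  have q: "(q has_real_derivative deriv q x) (at x)" unfolding q_def by (metis DERIV_imp_deriv)
  have "((\<lambda>s. h x s) has_real_derivative - deriv p x - deriv q x) (at t within {0..T})"
    using solution[OF t, of x] D00[OF t] unfolding h3 h1 p_def q_def by simp
  moreover have "((\<lambda>s. h x s) has_real_derivative D 0 1 x t) (at t within {0..T})"
    by (rule has_field_derivative_transform_within[where f="\<lambda>s. D 0 0 x s" and d=1, OF _ _ t])
       (use Dt[OF t, of 0 0 x] D00 in auto)
  ultimately have "- deriv p x - deriv q x = D 0 1 x t"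
    using time_derivative_unique t by blast
  then have "deriv p x + deriv q x = - D 0 1 x t" by linarith
  with DERIV_add[OF p q] show ?thesis by (simp only: p_def q_def flux_def)
qed

lemma flux_periodic: "t \<in> {0..T} \<Longrightarrow> flux (x + X) t = flux x t"
  by (simp add: flux_def D_periodic)

text \<open>The time derivative inherits periodicity through the equation, as minus the derivative
  of a periodic flux.\<close>

lemma D01_periodic:
  assumes t: "t \<in> {0..T}"
  shows "D 0 1 (x + X) t = D 0 1 x t"
proof -
  have "((\<lambda>y. flux (X + y) t) has_real_derivative - D 0 1 (X + x) t) (at x)"
    by (rule has_real_derivative_shift[OF flux_derivative[OF t]])
  moreover have "(\<lambda>y. flux (X + y) t) = (\<lambda>y. flux y t)"
    using flux_periodic[OF t] by (simp add: add.commute)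
  ultimately have "((\<lambda>y. flux y t) has_real_derivative - D 0 1 (X + x) t) (at x)" by simp
  from DERIV_unique[OF this flux_derivative[OF t]] show ?thesis by (simp add: add.commute)
qed

lemma D_continuous_param:
  assumes "continuous_on S p" "continuous_on S q" "q ` S \<subseteq> {0..T}"
  shows "continuous_on S (\<lambda>z. D i j (p z) (q z))"
  using continuous_on_compose2[OF D_continuous, of S "\<lambda>z. (p z, q z)" i j] assms
  by (auto intro!: continuous_intros)

lemma continuous_H': "continuous_on {0<..} H'"
  using H' by (meson DERIV_isCont continuous_at_imp_continuous_on greaterThan_iff)

lemma continuous_H_D00:
  assumes "continuous_on S p" "continuous_on S q" "q ` S \<subseteq> {0..T}"
  shows "continuous_on S (\<lambda>z. H (D 0 0 (p z) (q z)))" "continuous_on S (\<lambda>z. H' (D 0 0 (p z) (q z)))"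
  using D00_pos assms
  by (auto intro!: continuous_on_compose2[OF continuous_H D_continuous_param[OF assms]]
      continuous_on_compose2[OF continuous_H' D_continuous_param[OF assms]])

text \<open>Written with \<open>D\<close> and \<open>integral\<close> so that differentiation under
  the integral sign applies; \<open>slice_energy\<close> identifies it with
  \<open>energy\<close>.\<close>

definition E :: "real \<Rightarrow> real" where
  "E t = integral {0..X} (\<lambda>x. 1 / 2 * (D 1 0 x t)\<^sup>2 - H (D 0 0 x t))"

definition E' :: "real \<Rightarrow> real" where
  "E' t = integral {0..X} (\<lambda>x. D 1 0 x t * D 1 1 x t - H' (D 0 0 x t) * D 0 1 x t)"

lemma E_derivative:
  assumes t: "t \<in> {0..T}"
  shows "(E has_real_derivative E' t) (at t within {0..T})"
proof -
  have "((\<lambda>t. integral (cbox 0 X) (\<lambda>x. 1 / 2 * (D 1 0 x t)\<^sup>2 - H (D 0 0 x t))) has_real_derivative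
    integral (cbox 0 X) (\<lambda>x. D 1 0 x t * D 1 1 x t - H' (D 0 0 x t) * D 0 1 x t)) (at t within {0..T})"
  proof (rule leibniz_rule_field_derivative[OF _ _ _ t])
    fix s x :: real assume s: "s \<in> {0..T}"
    have "((\<lambda>s. H (D 0 0 x s)) has_real_derivative H' (D 0 0 x s) * D 0 1 x s) (at s within {0..T})"
      using DERIV_chain2[OF H[OF D00_pos[OF s]] Dt[OF s]] by simp
    then show "((\<lambda>t. 1 / 2 * (D 1 0 x t)\<^sup>2 - H (D 0 0 x t)) has_real_derivative
        D 1 0 x s * D 1 1 x s - H' (D 0 0 x s) * D 0 1 x s) (at s within {0..T})"
      using Dt[OF s, of 1 0 x] by (auto intro!: derivative_eq_intros)
  next
    fix s :: real assume s: "s \<in> {0..T}"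
    show "(\<lambda>x. 1 / 2 * (D 1 0 x s)\<^sup>2 - H (D 0 0 x s)) integrable_on cbox 0 X"
      by (intro integrable_continuous continuous_intros D_continuous_param continuous_H_D00) (use s in auto)
  next
    show "continuous_on ({0..T} \<times> cbox 0 X) (\<lambda>(t, x). D 1 0 x t * D 1 1 x t - H' (D 0 0 x t) * D 0 1 x t)"
      unfolding split_beta
      by (intro continuous_intros D_continuous_param continuous_H_D00) auto
  qed simp
  then show ?thesis unfolding E_def E'_def by simp
qed

text \<open>With \<open>J = f (h) (h\<^sub>x\<^sub>x\<^sub>x + r (h) h\<^sub>x)\<close> and \<open>h\<^sub>t = - J\<^sub>x\<close>, integration by parts turns the
  energy production into \<open>- \<integral> f (h) (h\<^sub>x\<^sub>x\<^sub>x + r (h) h\<^sub>x)\<^sup>2\<close>.\<close>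

lemma E'_nonpos:
  assumes t: "t \<in> {0..T}"
  shows "E' t \<le> 0"
proof -
  define e where "e x = D 1 0 x t * D 1 1 x t - H' (D 0 0 x t) * D 0 1 x t" for x
  \<comment> \<open>\<open>W\<close> collects the boundary terms of both integrations by parts. Its
    derivative \<open>w\<close> is the integrand \<open>e\<close> of the energy production plus the
    dissipation; since \<open>W\<close> is periodic, \<open>w\<close> has integral zero.\<close>
  define W where "W x = D 1 0 x t * D 0 1 x t + (D 2 0 x t + H' (D 0 0 x t)) * flux x t" for x
  define w where "w x = e x + f (D 0 0 x t) * (D 3 0 x t + r (D 0 0 x t) * D 1 0 x t)\<^sup>2" for x
  have "(W has_real_derivative w x) (at x)" for x
  proof -
    have "((\<lambda>x. H' (D 0 0 x t)) has_real_derivative r (D 0 0 x t) * D 1 0 x t) (at x)"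
      using DERIV_chain2[OF H'[OF D00_pos[OF t]] Dx[OF t, of 0 0]] by simp
    then have "(W has_real_derivative
        (D 2 0 x t * D 0 1 x t + D 1 1 x t * D 1 0 x t) +
        ((D 3 0 x t + r (D 0 0 x t) * D 1 0 x t) * flux x t + - D 0 1 x t * (D 2 0 x t + H' (D 0 0 x t)))) (at x)"
      unfolding W_def using Dx[OF t, of 1 0 x] Dx[OF t, of 0 1 x] Dx[OF t, of 2 0 x]
      by (intro DERIV_add DERIV_mult flux_derivative[OF t]) (simp_all add: eval_nat_numeral)
    also have "(D 2 0 x t * D 0 1 x t + D 1 1 x t * D 1 0 x t) +
        ((D 3 0 x t + r (D 0 0 x t) * D 1 0 x t) * flux x t + - D 0 1 x t * (D 2 0 x t + H' (D 0 0 x t))) = w x"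
    proof -
      have "flux x t = f (D 0 0 x t) * (D 3 0 x t + r (D 0 0 x t) * D 1 0 x t)"
        using f_pos[OF D00_pos[OF t, of x]] by (simp add: flux_def r_eq field_simps)
      then show ?thesis by (simp add: w_def e_def power2_eq_square algebra_simps)
    qed
    finally show ?thesis .
  qed
  then have "(w has_integral W X - W 0) {0..X}"
    using X by (intro fundamental_theorem_of_calculus)
      (auto simp: has_real_derivative_iff_has_vector_derivative[symmetric] intro: has_field_derivative_at_within)
  moreover have "W X = W 0"
    using D_periodic[OF t, of _ 0] D01_periodic[OF t, of 0] flux_periodic[OF t, of 0] by (simp add: W_def)
  ultimately have w: "(w has_integral 0) {0..X}" by simp
  have "e integrable_on {0..X}"
    unfolding e_def
    by (intro integrable_continuous_real continuous_intros D_continuous_param continuous_H_D00) (use t in auto)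
  then have "(e has_integral E' t) {0..X}"
    unfolding E'_def e_def[symmetric] by (rule integrable_integral)
  then show ?thesis
  proof (rule has_integral_le[OF _ w])
    show "e x \<le> w x" for x
      using f_pos[OF D00_pos[OF t, of x]] by (simp add: w_def)
  qed
qed

lemma E_decreasing:
  assumes t: "t \<in> {0..T}"
  shows "E t \<le> E 0"
proof (cases "t = 0")
  case False
  then have "0 < t" using t by simp
  from mvt_simple[OF this, of E "\<lambda>s. (*) (E' s)"]
  obtain s where "s \<in> {0<..<t}" "E t - E 0 = E' s * (t - 0)"
    using DERIV_subset[OF E_derivative, of _ "{0..t}"] t unfolding has_field_derivative_def by auto
  moreover have "E' s \<le> 0" using E'_nonpos[of s] \<open>s \<in> {0<..<t}\<close> t by auto
  ultimately show ?thesis using \<open>0 < t\<close> mult_nonpos_nonneg[of "E' s" t] by simp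
qed simp

definition M :: "real \<Rightarrow> real" where "M t = integral {0..X} (\<lambda>x. D 0 0 x t)"

lemma M_constant:
  assumes t: "t \<in> {0..T}"
  shows "M t = M 0"
proof -
  have "(M has_real_derivative 0) (at s within {0..T})" if s: "s \<in> {0..T}" for s
  proof -
    have "((\<lambda>t. integral (cbox 0 X) (\<lambda>x. D 0 0 x t)) has_real_derivative
      integral (cbox 0 X) (\<lambda>x. D 0 1 x s)) (at s within {0..T})"
    proof (rule leibniz_rule_field_derivative[OF _ _ _ s])
      show "((\<lambda>t. D 0 0 x t) has_real_derivative D 0 1 x t) (at t within {0..T})" if "t \<in> {0..T}" for t x
        using Dt[OF that, of 0 0 x] by simp
      show "(\<lambda>x. D 0 0 x t) integrable_on cbox 0 X" if "t \<in> {0..T}" for t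
        by (intro integrable_continuous D_continuous_param continuous_intros) (use that in auto)
      show "continuous_on ({0..T} \<times> cbox 0 X) (\<lambda>(t, x). D 0 1 x t)"
        unfolding split_beta by (intro continuous_intros D_continuous_param) auto
    qed simp
    moreover have "((\<lambda>x. D 0 1 x s) has_integral - flux X s - - flux 0 s) {0..X}"
      using X DERIV_minus[OF flux_derivative[OF s]]
      by (intro fundamental_theorem_of_calculus)
        (auto simp: has_real_derivative_iff_has_vector_derivative[symmetric] intro: has_field_derivative_at_within)
    then have "integral {0..X} (\<lambda>x. D 0 1 x s) = 0"
      using flux_periodic[OF s, of 0] by (simp add: integral_unique)
    ultimately show ?thesis unfolding M_def by simp
  qed
  then have "\<exists>c. \<forall>s\<in>{0..T}. M s = c"
    by (intro has_field_derivative_zero_constant) auto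
  then show ?thesis using t T by auto
qed

lemma slice_has_L2_derivative:
  assumes t: "t \<in> {0..T}"
  shows "has_L2_derivative X (\<lambda>x. h x t) (\<lambda>x. D 1 0 x t)"
    "has_L2_derivative X (\<lambda>x. h x t - c) (\<lambda>x. D 1 0 x t)"
proof -
  have d: "((\<lambda>x. h x t) has_real_derivative D 1 0 x t) (at x)" for x
    using Dx[OF t, of 0 0 x] D00[OF t] by simp
  have c: "continuous_on UNIV (\<lambda>x. D 1 0 x t)"
    by (intro D_continuous_param continuous_intros) (use t in auto)
  show "has_L2_derivative X (\<lambda>x. h x t) (\<lambda>x. D 1 0 x t)"
    by (rule has_L2_derivative_C1[OF d c])
  show "has_L2_derivative X (\<lambda>x. h x t - c) (\<lambda>x. D 1 0 x t)"
    by (rule has_L2_derivative_C1[OF _ c]) (use d in \<open>auto intro!: derivative_eq_intros\<close>)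
qed

lemma continuous_slice:
  assumes t: "t \<in> {0..T}"
  shows "continuous_on S (\<lambda>x. h x t)"
proof -
  have "continuous_on S (\<lambda>x. D 0 0 x t)"
    by (intro D_continuous_param continuous_intros) (use t in auto)
  then show ?thesis using D00[OF t] by simp
qed

lemma slice_energy:
  assumes t: "t \<in> {0..T}"
  shows "energy H X (\<lambda>x. h x t) = E t"
proof -
  have "(\<lambda>x. h x t) \<in> H1 X" using slice_has_L2_derivative[OF t] solution[OF t] by (auto simp: H1_def)
  then have "energy H X (\<lambda>x. h x t) =
      1 / 2 * (LBINT x:{0..X}. (D 1 0 x t)\<^sup>2) - (LBINT x:{0..X}. H (D 0 0 x t))"
    using energy_eq[OF _ slice_has_L2_derivative(1)[OF t]] solution[OF t] D00[OF t] by simp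
  also have "\<dots> = (LBINT x:{0..X}. 1 / 2 * (D 1 0 x t)\<^sup>2 - H (D 0 0 x t))"
    unfolding set_integral_mult_right[symmetric]
    by (intro set_integral_diff(2)[symmetric] borel_integrable_atLeastAtMost' continuous_intros
        D_continuous_param continuous_H_D00) (use t in auto)
  also have "\<dots> = E t"
    unfolding E_def
    by (intro LBINT_eq_integral borel_integrable_atLeastAtMost' continuous_intros
        D_continuous_param continuous_H_D00) (use t in auto)
  finally show ?thesis .
qed

lemma slice_zero_mean:
  assumes t: "t \<in> {0..T}" and mean: "(LBINT x:{0..X}. h x 0) / X = hbar"
  shows "(\<lambda>x. h x t - hbar) \<in> H1_zero_mean X"
proof -
  have M: "(LBINT x:{0..X}. h x s) = M s" if s: "s \<in> {0..T}" for s
    using LBINT_eq_integral[OF borel_integrable_atLeastAtMost'[OF continuous_slice[OF s]], of 0 X] D00[OF s]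
    by (simp add: M_def)
  have "(LBINT x:{0..X}. h x t - hbar) = M t - hbar * X"
    using borel_integrable_atLeastAtMost'[OF continuous_slice[OF t], of 0 X]
      borel_integrable_atLeastAtMost'[of 0 X "\<lambda>x. hbar"] M[OF t] X by (simp add: LBINT_const)
  also have "\<dots> = 0" using M_constant[OF t] M[of 0] mean X T by (simp add: field_simps)
  finally show ?thesis
    unfolding H1_zero_mean_def H1_def using slice_has_L2_derivative(2)[OF t] solution[OF t] by auto
qed

text \<open>Joint continuity of \<open>D\<close> on the strip makes the norm continuous in time, so
  it cannot jump over the level \<open>\<delta> / 2\<close>.\<close>

lemma continuous_slice_norm: "continuous_on {0..T} (\<lambda>t. H1_norm X (\<lambda>x. h x t - hbar))"
proof -
  have c: "continuous_on ({0..T} \<times> cbox 0 X) (\<lambda>(t, x). (D 0 0 x t - hbar)\<^sup>2 + (D 1 0 x t)\<^sup>2)"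
    unfolding split_beta by (intro continuous_intros D_continuous_param) auto
  have "continuous_on {0..T} (\<lambda>t. sqrt (integral (cbox 0 X) (\<lambda>x. (D 0 0 x t - hbar)\<^sup>2 + (D 1 0 x t)\<^sup>2)))"
    by (intro continuous_intros integral_continuous_on_param c)
  then show ?thesis
  proof (rule continuous_on_eq)
    fix t assume t: "t \<in> {0..T}"
    have i: "set_integrable lborel {0..X} (\<lambda>x. (D 0 0 x t - hbar)\<^sup>2)" "set_integrable lborel {0..X} (\<lambda>x. (D 1 0 x t)\<^sup>2)"
      by (intro borel_integrable_atLeastAtMost' continuous_intros D_continuous_param; use t in auto)+
    have "integral {0..X} (\<lambda>x. (D 0 0 x t - hbar)\<^sup>2 + (D 1 0 x t)\<^sup>2) =
      (LBINT x:{0..X}. (D 0 0 x t - hbar)\<^sup>2) + (LBINT x:{0..X}. (D 1 0 x t)\<^sup>2)"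
      using LBINT_eq_integral[OF set_integral_add(1)[OF i]] i by simp
    then show "sqrt (integral (cbox 0 X) (\<lambda>x. (D 0 0 x t - hbar)\<^sup>2 + (D 1 0 x t)\<^sup>2)) = H1_norm X (\<lambda>x. h x t - hbar)"
      unfolding H1_norm_eq[OF slice_has_L2_derivative(2)[OF t] X] using D00[OF t] by simp
  qed
qed

end

section \<open>Nonlinear stability below the critical period\<close>

context constant_state
begin

text \<open>The sphere of radius \<open>\<delta> / 2\<close> is an energy barrier: coercivity bounds
  the energy from below on it, while the initial energy lies under that bound and does not
  increase.\<close>

lemma nonlinear_stability:
  assumes f: "\<And>y. y > 0 \<Longrightarrow> (f has_real_derivative f' y) (at y)"
    and g: "\<And>y. y > 0 \<Longrightarrow> (g has_real_derivative g' y) (at y)"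
    and f_pos: "\<And>y. y > 0 \<Longrightarrow> f y > 0" and r_eq: "r = (\<lambda>y. g y / f y)"
    and r: "r hbar < (2 * pi / X)\<^sup>2"
  shows "nonlinearly_stable f g X hbar"
proof -
  obtain c K \<rho> where c: "c > 0" and K: "K > 0" and \<rho>: "\<rho> > 0"
    and coercive: "\<And>u. u \<in> H1_zero_mean X \<Longrightarrow> H1_norm X u \<le> \<rho> \<Longrightarrow>
      c * (H1_norm X u)\<^sup>2 \<le> energy H X (\<lambda>x. hbar + u x) - energy H X (\<lambda>x. hbar) \<and>
      energy H X (\<lambda>x. hbar + u x) - energy H X (\<lambda>x. hbar) \<le> K * (H1_norm X u)\<^sup>2"
    using energy_coercive[OF r] by meson
  \<comment> \<open>The ratio of the upper to the lower energy constant is the loss in passing from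
    the initial norm to the energy and back.\<close>
  define C where "C = max 1 (K / c)"
  have C: "C \<ge> 1" "K \<le> c * C" using c by (auto simp: C_def field_simps max_def)
  have main: "H1_norm X (\<lambda>x. h x t - hbar) < \<delta> / 2"
    if \<delta>: "0 < \<delta>" "\<delta> < 1" "\<delta> < \<rho>" and T: "T > 0" and sol: "smooth_positive_solution f g X T h"
      and mean: "(LBINT x:{0..X}. h x 0) / X = hbar"
      and init: "H1_norm X (\<lambda>x. h x 0 - hbar) < sqrt (\<delta> ^ 3 / (4 * C))" and t: "t \<in> {0..T}"
    for \<delta> T h t
  proof -
    have strip: "smooth_on_strip T h" and pde: "\<forall>x. \<forall>t\<in>{0..T}. h (x + X) t = h x t \<and> h x t > 0 \<and>
        ((\<lambda>s. h x s) has_real_derivative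
           - deriv (\<lambda>y. f (h y t) * (deriv ^^ 3) (\<lambda>z. h z t) y) x
           - deriv (\<lambda>y. g (h y t) * deriv (\<lambda>z. h z t) y) x) (at t within {0..T})"
      using sol unfolding smooth_positive_solution_def by (rule conjunct1, elim conjunct2)
    obtain D :: "nat \<Rightarrow> nat \<Rightarrow> real \<Rightarrow> real \<Rightarrow> real" where
      D00: "\<forall>x. \<forall>t\<in>{0..T}. D 0 0 x t = h x t" and
      D: "\<forall>i j. continuous_on (UNIV \<times> {0..T}) (\<lambda>(x, t). D i j x t) \<and>
           (\<forall>x. \<forall>t\<in>{0..T}.
              ((\<lambda>y. D i j y t) has_real_derivative D (Suc i) j x t) (at x) \<and>
              ((\<lambda>s. D i j x s) has_real_derivative D i (Suc j) x t) (at t within {0..T}))"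
      using strip unfolding smooth_on_strip_def by (elim exE conjE) (rule that)
    interpret evolution H H' r hbar X f g f' g' T h D
    proof
      fix i j show "continuous_on (UNIV \<times> {0..T}) (\<lambda>(x, t). D i j x t)"
        using D[rule_format, of i j] by (rule conjunct1)
      fix x t assume t: "t \<in> {0..T}"
      show "D 0 0 x t = h x t" by (rule D00[rule_format, OF t])
      note Dij = D[rule_format, of i j, THEN conjunct2, rule_format, OF t, of x]
      show "((\<lambda>y. D i j y t) has_real_derivative D (Suc i) j x t) (at x)" by (rule Dij[THEN conjunct1])
      show "((\<lambda>s. D i j x s) has_real_derivative D i (Suc j) x t) (at t within {0..T})"
        by (rule Dij[THEN conjunct2])
      show "h (x + X) t = h x t \<and> h x t > 0 \<and>
        ((\<lambda>s. h x s) has_real_derivative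
           - deriv (\<lambda>y. f (h y t) * (deriv ^^ 3) (\<lambda>z. h z t) y) x
           - deriv (\<lambda>y. g (h y t) * deriv (\<lambda>z. h z t) y) x) (at t within {0..T})"
        by (rule pde[rule_format, OF t])
    qed (fact f g f_pos r_eq T)+
    define n where "n s = H1_norm X (\<lambda>x. h x s - hbar)" for s
    have n_nonneg: "n s \<ge> 0" for s by (simp add: n_def H1_norm_def LBINT_nonneg)
    have zero_mean: "(\<lambda>x. h x s - hbar) \<in> H1_zero_mean X" if "s \<in> {0..T}" for s
      by (rule slice_zero_mean[OF that mean])
    have bounds: "c * (n s)\<^sup>2 \<le> E s - energy H X (\<lambda>x. hbar)" "E s - energy H X (\<lambda>x. hbar) \<le> K * (n s)\<^sup>2"
      if "s \<in> {0..T}" "n s \<le> \<rho>" for s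
      using coercive[OF zero_mean[OF that(1)]] that slice_energy[OF that(1)] by (simp_all add: n_def)
    have "(n 0)\<^sup>2 < (sqrt (\<delta> ^ 3 / (4 * C)))\<^sup>2"
      using init n_nonneg[of 0] unfolding n_def[symmetric] by (rule power_strict_mono) simp
    then have n0: "(n 0)\<^sup>2 < \<delta> ^ 3 / (4 * C)" using \<delta> C by simp
    \<comment> \<open>Since \<open>\<delta> < 1\<close>, the initial condition bounds the squared
      norm by a quarter of \<open>\<delta> ^ 2\<close>, divided by \<open>C\<close>; the same
      quantity reappears in the contradiction.\<close>
    have cube: "\<delta> ^ 3 \<le> \<delta>\<^sup>2" using \<delta> by (intro power_decreasing) auto
    have "\<delta> ^ 3 / (4 * C) \<le> \<delta>\<^sup>2 / (4 * 1)"
      using cube C \<delta> by (intro frac_le) auto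
    then have "(n 0)\<^sup>2 < (\<delta> / 2)\<^sup>2" using n0 by (simp add: power_divide)
    then have n0': "n 0 < \<delta> / 2" by (rule power_less_imp_less_base) (use \<delta> in simp)
    show ?thesis
    proof (rule ccontr)
      assume "\<not> ?thesis"
      then have "\<delta> / 2 \<le> n t" by (simp add: n_def)
      moreover have "continuous_on {0..t} n"
        unfolding n_def by (rule continuous_on_subset[OF continuous_slice_norm]) (use t in auto)
      \<comment> \<open>The exact value \<open>\<delta> / 2\<close> at time \<open>s\<close> is
        below \<rho>, so coercivity may be used there although nothing bounds the norm at time
        \<open>t\<close>.\<close>
      ultimately obtain s where s: "0 \<le> s" "s \<le> t" "n s = \<delta> / 2"
        using IVT'[of n 0 "\<delta> / 2" t] n0' t by auto
      then have sT: "s \<in> {0..T}" using t by auto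
      have "n s \<le> \<rho>" using s(3) \<delta> by simp
      from bounds(1)[OF sT this] have "c * (n s)\<^sup>2 \<le> E s - energy H X (\<lambda>x. hbar)" .
      also have "\<dots> \<le> E 0 - energy H X (\<lambda>x. hbar)" using E_decreasing[OF sT] by simp
      also have "\<dots> \<le> K * (n 0)\<^sup>2" using bounds(2)[of 0] n0' \<delta> T by simp
      also have "\<dots> < K * (\<delta> ^ 3 / (4 * C))" by (rule mult_strict_left_mono[OF n0 K])
      also have "\<dots> \<le> (c * C) * (\<delta> ^ 3 / (4 * C))" using C \<delta> by (intro mult_right_mono) auto
      also have "\<dots> = c * (\<delta> ^ 3 / 4)" using C by simp
      also have "\<dots> \<le> c * (\<delta>\<^sup>2 / 4)" using cube c by simp
      also have "\<dots> = c * (n s)\<^sup>2" by (simp add: s power_divide)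
      finally show False by simp
    qed
  qed
  have "\<forall>\<^sub>F \<delta> in at_right 0. 0 < \<delta> \<and> \<delta> < 1 \<and> \<delta> < \<rho>"
    unfolding eventually_at_right_field by (rule exI[of _ "min 1 \<rho>"]) (use \<rho> in auto)
  then have "\<forall>\<^sub>F \<delta> in at_right 0. \<forall>T>0. \<forall>h. smooth_positive_solution f g X T h \<and>
      (LBINT x:{0..X}. h x 0) / X = hbar \<and> H1_norm X (\<lambda>x. h x 0 - hbar) < sqrt (\<delta> ^ 3 / (4 * C)) \<longrightarrow>
      (\<forall>t\<in>{0..T}. H1_norm X (\<lambda>x. h x t - hbar) < \<delta> / 2)"
    by (rule eventually_mono) (use main in blast)
  then show ?thesis unfolding nonlinearly_stable_def using C(1) by blast
qed

end

section \<open>The second derivative of \<open>r\<close> and the critical period\<close>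

theorem theorem10:
  fixes f g r H H' :: "real \<Rightarrow> real" and hbar X :: real
  assumes "C2_on {0<..} f" and "C2_on {0<..} g"
    and "\<And>y. y > 0 \<Longrightarrow> f y > 0"
    and "r = (\<lambda>y. g y / f y)"
    and "\<And>y. y > 0 \<Longrightarrow> (H has_real_derivative H' y) (at y)"
    and "\<And>y. y > 0 \<Longrightarrow> (H' has_real_derivative r y) (at y)"
    and "hbar > 0" and "X > 0"
  shows
   "tau1 r X (\<lambda>x. hbar) = (2 * pi / X)\<^sup>2 - r hbar \<and>
    tau1_eigenspace r X (\<lambda>x. hbar) =
      {u. \<exists>a b. u = (\<lambda>x. a * sin (2 * pi * x / X) + b * cos (2 * pi * x / X))} \<and>
    (r hbar * X\<^sup>2 > 4 * pi\<^sup>2 \<longrightarrow> linearly_unstable r X (\<lambda>x. hbar)) \<and>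
    (r hbar * X\<^sup>2 = 4 * pi\<^sup>2 \<longrightarrow> linearly_neutrally_stable r X (\<lambda>x. hbar)) \<and>
    (r hbar * X\<^sup>2 < 4 * pi\<^sup>2 \<longrightarrow> linearly_asymptotically_stable r X (\<lambda>x. hbar)) \<and>
    (r hbar * X\<^sup>2 > 4 * pi\<^sup>2 \<or> (r hbar * X\<^sup>2 = 4 * pi\<^sup>2 \<and> (deriv ^^ 2) r hbar > 0) \<longrightarrow>
      energy_unstable_in_direction H X (\<lambda>x. hbar) (\<lambda>x. sin (2 * pi * x / X)) \<and>
      energy_unstable_in_direction H X (\<lambda>x. hbar) (\<lambda>x. - sin (2 * pi * x / X)) \<and>
      energy_unstable_in_direction H X (\<lambda>x. hbar) (\<lambda>x. cos (2 * pi * x / X)) \<and>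
      energy_unstable_in_direction H X (\<lambda>x. hbar) (\<lambda>x. - cos (2 * pi * x / X))) \<and>
    (r hbar * X\<^sup>2 < 4 * pi\<^sup>2 \<or> (r hbar * X\<^sup>2 = 4 * pi\<^sup>2 \<and> (deriv ^^ 2) r hbar < 0) \<longrightarrow>
      energy_stable H X (\<lambda>x. hbar)) \<and>
    (r hbar * X\<^sup>2 < 4 * pi\<^sup>2 \<longrightarrow>
      strict_local_energy_min H X (\<lambda>x. hbar) \<and> nonlinearly_stable f g X hbar)"
proof -
  interpret constant_state H H' r hbar X
    by unfold_locales (use assms in auto)
  obtain f' f'' where f: "\<And>y. y > 0 \<Longrightarrow> (f has_real_derivative f' y) (at y)"
    "\<And>y. y > 0 \<Longrightarrow> (f' has_real_derivative f'' y) (at y)"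
    using assms(1) unfolding C2_on_def by (metis greaterThan_iff)
  obtain g' g'' where g: "\<And>y. y > 0 \<Longrightarrow> (g has_real_derivative g' y) (at y)"
    "\<And>y. y > 0 \<Longrightarrow> (g' has_real_derivative g'' y) (at y)"
    using assms(2) unfolding C2_on_def by (metis greaterThan_iff)
  define r1 where "r1 y = (g' y * f y - g y * f' y) / (f y * f y)" for y
  have r1: "(r has_real_derivative r1 y) (at y)" if "y > 0" for y
    unfolding assms(4) r1_def
    using f(1)[OF that] g(1)[OF that] assms(3)[OF that] by (auto intro!: derivative_eq_intros)
  have "r1 differentiable (at hbar)"
    unfolding r1_def using f[OF hbar] g[OF hbar] assms(3)[OF hbar]
    by (intro differentiable_divide differentiable_diff differentiable_mult)
       (auto simp: real_differentiable_def)
  moreover have "deriv r1 hbar = (deriv ^^ 2) r hbar"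
  proof -
    \<comment> \<open>\<open>deriv r\<close> is known to equal \<open>r1\<close> only on the
      positive half line; this is a neighbourhood of \<open>hbar\<close>, which is enough to compare
      derivatives there.\<close>
    have "\<forall>\<^sub>F y in nhds hbar. deriv r y = r1 y"
      using eventually_nhds_in_open[of "{0<..}" hbar] hbar
      by (auto elim!: eventually_mono intro: DERIV_imp_deriv r1)
    from deriv_cong_ev[OF this refl] show ?thesis by (simp add: eval_nat_numeral)
  qed
  ultimately have r2: "(r1 has_real_derivative (deriv ^^ 2) r hbar) (at hbar)"
    by (metis DERIV_deriv_iff_real_differentiable)
  have mode: "first_mode X a b = (\<lambda>x. a * sin (2 * pi * x / X) + b * cos (2 * pi * x / X))" for a b
    by (simp add: first_mode_def fun_eq_iff)
  have kX: "(2 * pi / X)\<^sup>2 = 4 * pi\<^sup>2 / X\<^sup>2" by (simp add: power_divide power_mult_distrib)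
  have lt: "r hbar * X\<^sup>2 < 4 * pi\<^sup>2 \<longleftrightarrow> r hbar < (2 * pi / X)\<^sup>2"
    and eq: "r hbar * X\<^sup>2 = 4 * pi\<^sup>2 \<longleftrightarrow> r hbar = (2 * pi / X)\<^sup>2"
    and gt: "r hbar * X\<^sup>2 > 4 * pi\<^sup>2 \<longleftrightarrow> r hbar > (2 * pi / X)\<^sup>2"
    unfolding kX using X by (auto simp: field_simps)
  have unstable: "energy_unstable_in_direction H X (\<lambda>x. hbar) (first_mode X a b)"
    if "r hbar > (2 * pi / X)\<^sup>2 \<or> (r hbar = (2 * pi / X)\<^sup>2 \<and> (deriv ^^ 2) r hbar > 0)"
      and ab: "a \<noteq> 0 \<or> b \<noteq> 0" for a b
  proof -
    let ?u = "first_mode X a b"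
    note u = first_mode_zero_mean[OF X, of a b] first_mode_nonzero[OF X ab]
    have "0 < (LBINT x:{0..X}. (?u x)\<^sup>2)"
      using LBINT_power_pos[OF H1_zero_mean_H1[OF u(1)] u(2) X, of 2] by simp
    \<comment> \<open>Every nonzero first mode is covered at once: beyond the critical period its
      second variation is negative, and at the critical period it vanishes together with the cubic
      term.\<close>
    then have "quad ?u < 0 \<or> (quad ?u = 0 \<and> (deriv ^^ 2) r hbar > 0)"
      using that(1) unfolding quad_first_mode by (auto simp: mult_neg_pos)
    then have "\<forall>\<^sub>F \<epsilon> in at_right 0. (\<forall>x. 0 < hbar + \<epsilon> * ?u x) \<and>
        energy H X (\<lambda>x. hbar + \<epsilon> * ?u x) < energy H X (\<lambda>x. hbar)"
      using quad_sign(2)[OF u] quartic_sign(2)[OF r1 r2 u _ first_mode_cube[OF X]] by blast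
    then show ?thesis unfolding energy_unstable_in_direction_def using u(1) by blast
  qed
  have stable: "energy_stable H X (\<lambda>x. hbar)"
    if "r hbar < (2 * pi / X)\<^sup>2 \<or> (r hbar = (2 * pi / X)\<^sup>2 \<and> (deriv ^^ 2) r hbar < 0)"
    unfolding energy_stable_def
  proof
    fix u assume "u \<in> H1_zero_mean X - {\<lambda>x. 0}"
    then have u: "u \<in> H1_zero_mean X" "u \<noteq> (\<lambda>x. 0)" by auto
    have "r hbar \<le> (2 * pi / X)\<^sup>2" using that by auto
    moreover have "r hbar = (2 * pi / X)\<^sup>2 \<Longrightarrow> (deriv ^^ 2) r hbar < 0" using that by auto
    ultimately consider "quad u > 0"
      | a b where "u = first_mode X a b" "quad u = 0" "(deriv ^^ 2) r hbar < 0"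
      using quad_nonneg[OF u] by blast
    then show "\<forall>\<^sub>F \<epsilon> in at_right 0. (\<forall>x. 0 < hbar + \<epsilon> * u x) \<and>
        energy H X (\<lambda>x. hbar + \<epsilon> * u x) > energy H X (\<lambda>x. hbar)"
    proof cases
      case 1
      then show ?thesis by (rule quad_sign(1)[OF u])
    next
      case 2
      then show ?thesis using quartic_sign(1)[OF r1 r2 u] first_mode_cube[OF X] by blast
    qed
  qed
  have "energy_unstable_in_direction H X (\<lambda>x. hbar) (\<lambda>x. sin (2 * pi * x / X)) \<and>
      energy_unstable_in_direction H X (\<lambda>x. hbar) (\<lambda>x. - sin (2 * pi * x / X)) \<and>
      energy_unstable_in_direction H X (\<lambda>x. hbar) (\<lambda>x. cos (2 * pi * x / X)) \<and>
      energy_unstable_in_direction H X (\<lambda>x. hbar) (\<lambda>x. - cos (2 * pi * x / X))"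
    if "r hbar > (2 * pi / X)\<^sup>2 \<or> (r hbar = (2 * pi / X)\<^sup>2 \<and> (deriv ^^ 2) r hbar > 0)"
    using unstable[OF that, of 1 0] unstable[OF that, of "-1" 0] unstable[OF that, of 0 1]
      unstable[OF that, of 0 "-1"] unfolding mode by simp
  then show ?thesis
    unfolding lt eq gt linearly_unstable_def linearly_neutrally_stable_def
      linearly_asymptotically_stable_def tau1_constant[OF X] tau1_eigenspace_constant[OF X] mode
    using stable strict_local_min nonlinear_stability[OF f(1) g(1) assms(3,4)] by auto
qed

end
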